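(* The superspace $\mathscr V_\upsilon(n)$ is a $U_\upsilon(\mathfrak q_n)$-submodule of $\widehat{\mathscr T}_\upsilon(n)$, and the set $\mathfrak L_{\mathscr V}=\{A(\mathbf j)\mid A\in M_n(\mathbb N|\mathbb Z_2)',\ \mathbf j\in\mathbb Z^n\}$ is a basis of $\mathscr V_\upsilon(n)$. Moreover, $\mathscr V_\upsilon(n)$ is a $U_\upsilon(\mathfrak q_n)$-supermodule.
   Context: Let $n\ge 2$, let $\upsilon$ be an indeterminate, $[c]=\frac{\upsilon^c-\upsilon^{-c}}{\upsilon-\upsilon^{-1}}$, $[m]^!=[m]\cdots[2][1]$, $[0]^!=1$, $Z^{(m)}=Z^m/[m]^!$. $U=U_\upsilon(\mathfrak q_n)$ denotes the unital associative $\mathbb Q(\upsilon)$-superalgebra with even generators $K_i^{\pm1},E_j,F_j$ and odd generators $K_{\bar i},E_{\bar j},F_{\bar j}$ ($1\le i\le n$, $1\le j\le n-1$) and relations (indices in all admissible ranges): (QQ1) $K_iK_i^{-1}=K_i^{-1}K_i=1$, $K_iK_j=K_jK_i$, $K_iK_{\bar j}=K_{\bar j}K_i$, $K_{\bar i}K_{\bar j}+K_{\bar j}K_{\bar i}=2\delta_{ij}\frac{K_i^2-K_i^{-2}}{\upsilon^2-\upsilon^{-2}}$; (QQ2) $K_iE_j=\upsilon^{\delta_{i,j}-\delta_{i,j+1}}E_jK_i$, $K_iF_j=\upsilon^{-(\delta_{i,j}-\delta_{i,j+1})}F_jK_i$, and the same two relations with $E_j,F_j$ replaced by $E_{\bar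 j},F_{\bar j}$; (QQ3) $K_{\bar i}E_j=E_jK_{\bar i}$, $K_{\bar i}F_j=F_jK_{\bar i}$ for $i\ne j,j+1$; $K_{\bar j}E_j-\upsilon E_jK_{\bar j}=E_{\bar j}K_j^{-1}$, $\upsilon K_{\overline{j+1}}E_j-E_jK_{\overline{j+1}}=-K_{j+1}^{-1}E_{\bar j}$, $K_{\bar j}F_j-\upsilon F_jK_{\bar j}=-F_{\bar j}K_j$, $\upsilon K_{\overline{j+1}}F_j-F_jK_{\overline{j+1}}=K_{j+1}F_{\bar j}$; (QQ4) $E_iF_j-F_jE_i=\delta_{ij}\frac{K_iK_{i+1}^{-1}-K_i^{-1}K_{i+1}}{\upsilon-\upsilon^{-1}}$, $E_iF_{\bar j}-F_{\bar j}E_i=\delta_{ij}(K_{i+1}^{-1}K_{\bar i}-K_{\overline{i+1}}K_i^{-1})$, $E_{\bar i}F_j-F_jE_{\bar i}=\delta_{ij}(K_{i+1}K_{\bar i}-K_{\overline{i+1}}K_i)$; (QQ5) $E_iE_j=E_jE_i$, $F_iF_j=F_jF_i$ for $|i-j|>1$; $E_iE_{\bar i}=E_{\bar i}E_i$, $F_iF_{\bar i}=F_{\bar i}F_i$; $E_iE_{i+1}-\upsilon E_{i+1}E_i=E_{\bar i}E_{\overline{i+1}}+\upsilon E_{\overline{i+1}}E_{\bar i}$, $\upsilon F_{i+1}F_i-F_iF_{i+1}=F_{\bar i}F_{\overline{i+1}}+\upsilon F_{\overline{i+1}}F_{\bar i}$; (QQ6) for $|i-j|=1$: $E_i^2Z-(\upsilon+\upsilon^{-1})E_iZE_i+ZE_i^2=0$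 for $Z\in\{E_j,E_{\bar j}\}$ and $F_i^2Z-(\upsilon+\upsilon^{-1})F_iZF_i+ZF_i^2=0$ for $Z\in\{F_j,F_{\bar j}\}$. $U$ is generated by $K_i^{\pm1},E_h,F_h,K_{\bar1}$ and is a Hopf superalgebra with coassociative comultiplication determined by $\Delta(K_i)=K_i\otimes K_i$, $\Delta(E_h)=E_h\otimes \widetilde K_h^{-1}+1\otimes E_h$, $\Delta(F_h)=F_h\otimes1+\widetilde K_h\otimes F_h$, $\Delta(K_{\bar1})=K_{\bar1}\otimes K_1+K_1^{-1}\otimes K_{\bar1}$, where $\widetilde K_h=K_hK_{h+1}^{-1}$. $\mathscr A_\upsilon(n)$ is the $\mathbb Q(\upsilon)$-superalgebra with even generators $X_1,\dots,X_n$, odd generators $X_{\bar1},\dots,X_{\bar n}$ and relations $X_iX_j=X_jX_i$, $X_iX_{\bar j}=X_{\bar j}X_i$, $X_{\bar i}X_{\bar j}=-X_{\bar j}X_{\bar i}$ ($i\ne j$), $X_{\bar i}^2=\frac{\upsilon-\upsilon^{-1}}{\upsilon+\upsilon^{-1}}X_i^2$. Put $X^{\mathbf a}=X_1^{a_1}\cdots X_n^{a_n}X_{\bar1}^{a_{\bar1}}\cdots X_{\bar n}^{a_{\bar n}}$; those with $\mathbf a\in\mathbb N^n\times\{0,1\}^n$ form a basis. $\mathscr A_\upsilon(n)$ is a $U$-supermodule with action determined by (terms with coefficient $[0]$ being $0$; $\mathbf e_i,\mathbf e_{\bar i}$ the standard basis of $\mathbb Z^{2n}$) $K_i.X^{\mathbf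 a}=\upsilon^{a_i+a_{\bar i}}X^{\mathbf a}$, $E_h.X^{\mathbf a}=\upsilon^{a_{\overline{h+1}}}[a_{h+1}]X^{\mathbf a+\mathbf e_h-\mathbf e_{h+1}}+\upsilon^{-a_{h+1}}[a_{\overline{h+1}}]X^{\mathbf a+\mathbf e_{\bar h}-\mathbf e_{\overline{h+1}}}$, $F_h.X^{\mathbf a}=\upsilon^{-a_{\bar h}}[a_h]X^{\mathbf a-\mathbf e_h+\mathbf e_{h+1}}+\upsilon^{a_h}[a_{\bar h}]X^{\mathbf a-\mathbf e_{\bar h}+\mathbf e_{\overline{h+1}}}$, $K_{\bar1}.X^{\mathbf a}=\upsilon^{-a_1}[a_{\bar1}]X^{\mathbf a+\mathbf e_1-\mathbf e_{\bar1}}+\upsilon^{a_{\bar1}}[a_1]X^{\mathbf a+\mathbf e_{\bar1}-\mathbf e_1}$. $M_n(\mathbb N|\mathbb Z_2)$ is the set of pairs $A=(A^0|A^1)$ of $n\times n$ matrices $A^s=(a^s_{i,j})$, $A^0$ over $\mathbb N$ and $A^1$ with entries in $\{0,1\}$; $M_n(\mathbb N|\mathbb Z_2)'$ is the subset with $A^0$ of zero diagonal. $\mathscr T_\upsilon(n)=\mathscr A_\upsilon(n)^{\otimes n}$ is a $U$-supermodule via the iterated comultiplication and the sign rule $(g_1\otimes g_2)(v_1\otimes v_2)=(-1)^{p(g_2)p(v_1)}g_1v_1\otimes g_2v_2$. For $A\in M_n(\mathbb N|\mathbb Z_2)$, $X^{[A]}=Y_1\otimes\cdots\otimes Y_n$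 with $Y_j=X_1^{(a^0_{1,j})}\cdots X_n^{(a^0_{n,j})}X_{\bar1}^{a^1_{1,j}}\cdots X_{\bar n}^{a^1_{n,j}}$. These form a basis of $\mathscr T_\upsilon(n)$; those with sum of all entries equal to $r$ span a finite-dimensional submodule $\mathscr T_\upsilon(n,r)$, and $\mathscr T_\upsilon(n)=\bigoplus_r\mathscr T_\upsilon(n,r)$. $\widehat{\mathscr T}_\upsilon(n)=\prod_{r\ge0}\mathscr T_\upsilon(n,r)$ with the componentwise $U$-action. For $A\in M_n(\mathbb N|\mathbb Z_2)'$, $\mathbf j\in\mathbb Z^n$: $A(\mathbf j)=\sum_{\lambda\in\mathbb N^n}\upsilon^{\lambda_1j_1+\cdots+\lambda_nj_n}X^{[(A^0+\mathrm{diag}(\lambda)|A^1)]}\in\widehat{\mathscr T}_\upsilon(n)$. $\mathscr V_\upsilon(n)$ is the subspace of $\widehat{\mathscr T}_\upsilon(n)$ spanned by all these $A(\mathbf j)$, regarded as a superspace by giving $A(\mathbf j)$ parity $\sum_{i,j}a^1_{i,j}$ mod 2. *)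

theory Defs
  imports
    Complex_Main
    "HOL-Computational_Algebra.Polynomial"
    "HOL-Computational_Algebra.Fraction_Field"
    "HOL-Library.Poly_Mapping"
    "HOL-Library.Function_Algebras"
    "HOL-Library.Cardinality"
    "HOL-Library.Z2"
begin

section \<open>The ground field and quantum integers\<close>

type_synonym qfield = "rat poly fract"

definition upsilon :: qfield  ("\<upsilon>")
  where "\<upsilon> = Fract [:0, 1:] 1"

definition qint :: "int \<Rightarrow> qfield"
  where "qint c = (\<upsilon> powi c - \<upsilon> powi (- c)) / (\<upsilon> - inverse \<upsilon>)"

definition qfact :: "nat \<Rightarrow> qfield"
  where "qfact m = (\<Prod>k = 1..m. qint (int k))"


section \<open>Algebras given by generators and relations\<close>

text \<open>Words form a monoid under concatenation, so that \<open>'g list \<Rightarrow>\<^sub>0 qfield\<close> with the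
  convolution product is the free associative algebra on \<open>'g\<close>.\<close>

instantiation list :: (type) monoid_add
begin
definition zero_list :: "'a list" where "zero_list = []"
definition plus_list :: "'a list \<Rightarrow> 'a list \<Rightarrow> 'a list" where "plus_list = (@)"
instance by standard (simp_all add: zero_list_def plus_list_def)
end

type_synonym 'g free_algebra = "'g list \<Rightarrow>\<^sub>0 qfield"

definition letter :: "'g \<Rightarrow> 'g free_algebra"  ("\<langle>_\<rangle>")
  where "\<langle>g\<rangle> = Poly_Mapping.single [g] 1"

definition fscale :: "qfield \<Rightarrow> 'g free_algebra \<Rightarrow> 'g free_algebra"  (infixr "*\<^sub>f" 75)
  where "c *\<^sub>f p = Poly_Mapping.single [] c * p"

text \<open>A presentation is attached to the type of generators; an element \<open>r\<close> of \<open>rels\<close>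
  stands for the relation \<open>r = 0\<close>.\<close>

class presented =
  fixes rels :: "'a free_algebra set"

class super_presented = presented +
  fixes gen_parity :: "'a \<Rightarrow> bit"

inductive_set rel_ideal :: "'g::presented free_algebra set" where
  zero: "0 \<in> rel_ideal"
| add: "x \<in> rel_ideal \<Longrightarrow> r \<in> rels \<Longrightarrow> x + p * r * q \<in> rel_ideal"

lemma rel_ideal_add: "x \<in> rel_ideal \<Longrightarrow> y \<in> rel_ideal \<Longrightarrow> y + x \<in> rel_ideal"
proof (induction x rule: rel_ideal.induct)
  case (add x r p q)
  then have "(y + x) + p * r * q \<in> rel_ideal" by (intro rel_ideal.add) auto
  then show ?case by (simp add: add.assoc)
qed simp

lemma rel_ideal_mult: "x \<in> rel_ideal \<Longrightarrow> s * x * t \<in> rel_ideal"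
proof (induction x rule: rel_ideal.induct)
  case (add x r p q)
  then have "s * x * t + (s * p) * r * (q * t) \<in> rel_ideal" by (intro rel_ideal.add) auto
  then show ?case by (simp only: distrib_left distrib_right mult.assoc)
qed (simp add: rel_ideal.zero)

lemma rel_ideal_uminus: "x \<in> rel_ideal \<Longrightarrow> - x \<in> rel_ideal"
  using rel_ideal_mult[of x "- 1" 1] by simp

definition rel_eq :: "'g::presented free_algebra \<Rightarrow> 'g free_algebra \<Rightarrow> bool"
  where "rel_eq p q \<longleftrightarrow> p - q \<in> rel_ideal"

text \<open>The presented algebra: the free algebra modulo the two-sided ideal generated by
  the relations.  Its class is \<open>{ring, monoid_mult}\<close> because \<open>ring_1\<close> demands
  \<open>0 \<noteq> 1\<close>, which need not hold for an arbitrary presentation.\<close>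

quotient_type (overloaded) 'g palg = "'g::presented free_algebra" / rel_eq
proof (rule equivpI)
  show "reflp (rel_eq :: 'g free_algebra \<Rightarrow> _)"
    by (simp add: reflp_def rel_eq_def rel_ideal.zero)
  show "symp (rel_eq :: 'g free_algebra \<Rightarrow> _)"
  proof (rule sympI)
    fix p q :: "'g free_algebra"
    assume "rel_eq p q"
    then have "- (p - q) \<in> rel_ideal" unfolding rel_eq_def by (rule rel_ideal_uminus)
    then show "rel_eq q p" by (simp add: rel_eq_def)
  qed
  show "transp (rel_eq :: 'g free_algebra \<Rightarrow> _)"
  proof (rule transpI)
    fix p q r :: "'g free_algebra"
    assume "rel_eq p q" "rel_eq q r"
    then have "(p - q) + (q - r) \<in> rel_ideal" unfolding rel_eq_def by (intro rel_ideal_add)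
    then show "rel_eq p r" by (simp add: rel_eq_def)
  qed
qed

instantiation palg :: (presented) "{ring, monoid_mult}"
begin

lift_definition zero_palg :: "'a palg" is 0 .
lift_definition one_palg :: "'a palg" is 1 .
lift_definition plus_palg :: "'a palg \<Rightarrow> 'a palg \<Rightarrow> 'a palg" is "(+)"
proof -
  fix a b c d :: "'a free_algebra"
  assume "rel_eq a b" "rel_eq c d"
  then have "(a - b) + (c - d) \<in> rel_ideal" unfolding rel_eq_def by (intro rel_ideal_add)
  then show "rel_eq (a + c) (b + d)" by (simp only: rel_eq_def add_diff_add)
qed
lift_definition uminus_palg :: "'a palg \<Rightarrow> 'a palg" is uminus
proof -
  fix a b :: "'a free_algebra"
  assume "rel_eq a b"
  then have "- (a - b) \<in> rel_ideal" unfolding rel_eq_def by (rule rel_ideal_uminus)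
  then show "rel_eq (- a) (- b)" by (simp only: rel_eq_def minus_diff_minus)
qed
lift_definition minus_palg :: "'a palg \<Rightarrow> 'a palg \<Rightarrow> 'a palg" is "(-)"
proof -
  fix a b c d :: "'a free_algebra"
  assume "rel_eq a b" "rel_eq c d"
  then have "(a - b) + - (c - d) \<in> rel_ideal"
    unfolding rel_eq_def using rel_ideal_add rel_ideal_uminus by blast
  moreover have "(a - b) + - (c - d) = (a - c) - (b - d)" by simp
  ultimately show "rel_eq (a - c) (b - d)" by (simp only: rel_eq_def)
qed
lift_definition times_palg :: "'a palg \<Rightarrow> 'a palg \<Rightarrow> 'a palg" is "(*)"
proof -
  fix a b c d :: "'a free_algebra"
  assume "rel_eq a b" "rel_eq c d"
  then have "1 * (a - b) * c + b * (c - d) * 1 \<in> rel_ideal"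
    unfolding rel_eq_def by (intro rel_ideal_add rel_ideal_mult)
  moreover have "1 * (a - b) * c + b * (c - d) * 1 = a * c - b * d"
    by (simp add: left_diff_distrib right_diff_distrib)
  ultimately show "rel_eq (a * c) (b * d)" by (simp only: rel_eq_def)
qed

lemma rel_eq_refl: "p = q \<Longrightarrow> rel_eq p q"
  by (simp add: rel_eq_def rel_ideal.zero)

instance
proof
  fix a b c :: "'a palg"
  show "a * b * c = a * (b * c)" by transfer (rule rel_eq_refl, rule mult.assoc)
  show "1 * a = a" by transfer (rule rel_eq_refl, rule mult_1_left)
  show "a * 1 = a" by transfer (rule rel_eq_refl, rule mult_1_right)
  show "a + b + c = a + (b + c)" by transfer (rule rel_eq_refl, rule add.assoc)
  show "a + b = b + a" by transfer (rule rel_eq_refl, rule add.commute)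
  show "0 + a = a" by transfer (rule rel_eq_refl, rule add_0_left)
  show "- a + a = 0" by transfer (rule rel_eq_refl, rule left_minus)
  show "a - b = a + - b" by transfer (rule rel_eq_refl, rule diff_conv_add_uminus)
  show "(a + b) * c = a * c + b * c" by transfer (rule rel_eq_refl, rule distrib_right)
  show "a * (b + c) = a * b + a * c" by transfer (rule rel_eq_refl, rule distrib_left)
qed

end

lift_definition pscale :: "qfield \<Rightarrow> 'g::presented palg \<Rightarrow> 'g palg"  (infixr "\<cdot>" 75) is fscale
proof -
  fix c :: qfield and a b :: "'g free_algebra"
  assume "rel_eq a b"
  then have "Poly_Mapping.single [] c * (a - b) * 1 \<in> rel_ideal"
    unfolding rel_eq_def by (rule rel_ideal_mult)
  then show "rel_eq (c *\<^sub>f a) (c *\<^sub>f b)"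
    by (simp only: rel_eq_def fscale_def right_diff_distrib mult_1_right)
qed

interpretation palg: vector_space "pscale :: qfield \<Rightarrow> 'g::presented palg \<Rightarrow> 'g palg"
proof
  fix a b :: qfield and x y :: "'g palg"
  have one: "Poly_Mapping.single [] 1 = (1 :: 'g free_algebra)"
    by (metis single_one zero_list_def)
  show "a \<cdot> (x + y) = a \<cdot> x + a \<cdot> y"
    by transfer (rule rel_eq_refl, simp only: fscale_def distrib_left)
  show "(a + b) \<cdot> x = a \<cdot> x + b \<cdot> x"
    by transfer (rule rel_eq_refl, simp only: fscale_def single_add distrib_right)
  show "a \<cdot> b \<cdot> x = (a * b) \<cdot> x"
    by transfer (rule rel_eq_refl,
        simp only: fscale_def mult.assoc[symmetric] mult_single plus_list_def append_Nil)
  show "1 \<cdot> x = x"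
    by transfer (rule rel_eq_refl, simp only: fscale_def one mult_1_left)
qed

definition gen :: "'g::presented \<Rightarrow> 'g palg"
  where "gen g = abs_palg \<langle>g\<rangle>"

definition divpow :: "'g::presented palg \<Rightarrow> nat \<Rightarrow> 'g palg"
  where "divpow z m = inverse (qfact m) \<cdot> z ^ m"


section \<open>Superspaces and supermodules\<close>

definition word_parity :: "'g::super_presented list \<Rightarrow> bit"
  where "word_parity w = (\<Sum>g\<leftarrow>w. gen_parity g)"

definition homogeneous :: "bit \<Rightarrow> 'g::super_presented palg set"
  where "homogeneous p = {abs_palg f | f. \<forall>w \<in> Poly_Mapping.keys f. word_parity w = p}"

definition superspace :: "(qfield \<Rightarrow> 'm \<Rightarrow> 'm::ab_group_add) \<Rightarrow> 'm set \<Rightarrow> (bit \<Rightarrow> 'm set) \<Rightarrow> bool"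
  where "superspace sc M Mp \<longleftrightarrow>
    (\<forall>p. module.subspace sc (Mp p)) \<and>
    M = {x + y | x y. x \<in> Mp 0 \<and> y \<in> Mp 1} \<and> Mp 0 \<inter> Mp 1 = {0}"

definition is_module ::
  "(qfield \<Rightarrow> 'm \<Rightarrow> 'm::ab_group_add) \<Rightarrow> ('g::presented palg \<Rightarrow> 'm \<Rightarrow> 'm) \<Rightarrow> 'm set \<Rightarrow> bool"
  where "is_module sc act M \<longleftrightarrow>
    module.subspace sc M \<and>
    (\<forall>u. \<forall>x\<in>M. act u x \<in> M) \<and>
    (\<forall>u. \<forall>x\<in>M. \<forall>y\<in>M. act u (x + y) = act u x + act u y) \<and>
    (\<forall>u c. \<forall>x\<in>M. act u (sc c x) = sc c (act u x)) \<and>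
    (\<forall>u w. \<forall>x\<in>M. act (u + w) x = act u x + act w x) \<and>
    (\<forall>u c. \<forall>x\<in>M. act (c \<cdot> u) x = sc c (act u x)) \<and>
    (\<forall>u w. \<forall>x\<in>M. act (u * w) x = act u (act w x)) \<and>
    (\<forall>x\<in>M. act 1 x = x)"

definition is_submodule ::
  "(qfield \<Rightarrow> 'm \<Rightarrow> 'm::ab_group_add) \<Rightarrow> ('g::presented palg \<Rightarrow> 'm \<Rightarrow> 'm) \<Rightarrow> 'm set \<Rightarrow> 'm set \<Rightarrow> bool"
  where "is_submodule sc act M N \<longleftrightarrow>
    is_module sc act M \<and> module.subspace sc N \<and> N \<subseteq> M \<and> (\<forall>u. \<forall>x\<in>N. act u x \<in> N)"

definition is_supermodule ::
  "(qfield \<Rightarrow> 'm \<Rightarrow> 'm::ab_group_add) \<Rightarrow> ('g::super_presented palg \<Rightarrow> 'm \<Rightarrow> 'm) \<Rightarrow>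
    'm set \<Rightarrow> (bit \<Rightarrow> 'm set) \<Rightarrow> bool"
  where "is_supermodule sc act M Mp \<longleftrightarrow>
    is_module sc act M \<and> superspace sc M Mp \<and>
    (\<forall>p q. \<forall>u \<in> homogeneous p. \<forall>x \<in> Mp q. act u x \<in> Mp (p + q))"

text \<open>The component of parity \<open>p\<close>, for algebras with homogeneous relations.\<close>

definition part :: "bit \<Rightarrow> 'g::super_presented palg \<Rightarrow> 'g palg"
  where "part p x = (THE y. y \<in> homogeneous p \<and> x - y \<in> homogeneous (p + 1))"

text \<open>The linear map equal to \<open>(-1)\<^sup>p\<close> on the component of parity \<open>p\<close>.\<close>

definition parity_inv :: "'g::super_presented palg \<Rightarrow> 'g palg"
  where "parity_inv x = part 0 x - part 1 x"


section \<open>Tensor powers\<close>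

text \<open>The tensor algebra of the vector space \<open>'g palg\<close> is itself presented: one generator
  for each vector, subject to the relations of linearity.  Its product is concatenation of
  tensors, and its component of degree \<open>k\<close> is the \<open>k\<close>-th tensor power.\<close>

context
  notes [[typedef_overloaded]]
begin

datatype (dead 'g::presented) vec_letter = Vec "'g palg"

end

instantiation vec_letter :: (presented) presented
begin
definition rels_vec_letter :: "'a vec_letter free_algebra set"
  where "rels_vec_letter =
    {\<langle>Vec (x + y)\<rangle> - \<langle>Vec x\<rangle> - \<langle>Vec y\<rangle> | x y. True} \<union>
    {\<langle>Vec (c \<cdot> x)\<rangle> - c *\<^sub>f \<langle>Vec x\<rangle> | c x. True}"
instance ..
end

type_synonym 'g tensor = "'g vec_letter palg"

text \<open>\<open>tens [x\<^sub>1, \<dots>, x\<^sub>k]\<close> is \<open>x\<^sub>1 \<otimes> \<dots> \<otimes> x\<^sub>k\<close>.\<close>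

definition tens :: "'g::presented palg list \<Rightarrow> 'g tensor"
  where "tens xs = (\<Prod>x\<leftarrow>xs. gen (Vec x))"

definition tensor_power :: "nat \<Rightarrow> 'g::presented tensor set"
  where "tensor_power k = palg.span (tens ` {xs. length xs = k})"

text \<open>The linear map with prescribed values on pure tensors.  It exists if, for each length,
  \<open>f\<close> is multilinear on the lists of that length, and is then unique.\<close>

definition tensor_lift :: "('g::presented palg list \<Rightarrow> 'h::presented palg) \<Rightarrow> 'g tensor \<Rightarrow> 'h palg"
  where "tensor_lift f =
    (THE L. Vector_Spaces.linear pscale pscale L \<and> (\<forall>xs. L (tens xs) = f xs))"

definition pair_lift ::
  "('g::presented palg \<Rightarrow> 'g palg \<Rightarrow> 'h::presented palg) \<Rightarrow> 'g tensor \<Rightarrow> 'h palg"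
  where "pair_lift f = tensor_lift (\<lambda>xs. case xs of [x, y] \<Rightarrow> f x y | _ \<Rightarrow> 0)"

text \<open>The product of the superalgebra \<open>U \<otimes> U\<close>, that is
  \<open>(a \<otimes> b)(c \<otimes> d) = (-1)\<^bsup>p(b)p(c)\<^esup> ac \<otimes> bd\<close>; the two summands
  come from the even and the odd component of \<open>c\<close>.\<close>

definition tensor2_mult ::
  "'g::super_presented tensor \<Rightarrow> 'g tensor \<Rightarrow> 'g tensor"  (infixl "\<star>" 70)
  where "s \<star> t =
    pair_lift (\<lambda>a b. pair_lift (\<lambda>c d.
      tens [a * part 0 c, b * d] + tens [a * part 1 c, parity_inv b * d]) t) s"

definition tensor2_homogeneous :: "bit \<Rightarrow> 'g::super_presented tensor set"
  where "tensor2_homogeneous p =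
    palg.span {tens [a, b] | a b q r. a \<in> homogeneous q \<and> b \<in> homogeneous r \<and> q + r = p}"

text \<open>\<open>iter_comult \<Delta> k\<close> is the iterated comultiplication with values in the tensor power
  of exponent \<open>k + 1\<close>.\<close>

primrec iter_comult ::
  "('g::presented palg \<Rightarrow> 'g tensor) \<Rightarrow> nat \<Rightarrow> 'g palg \<Rightarrow> 'g tensor"
where
  "iter_comult \<Delta> 0 u = tens [u]"
| "iter_comult \<Delta> (Suc k) u = pair_lift (\<lambda>a b. tens [a] * iter_comult \<Delta> k b) (\<Delta> u)"

text \<open>The action of \<open>g\<^sub>1 \<otimes> \<dots> \<otimes> g\<^sub>k\<close> on \<open>v\<^sub>1 \<otimes> \<dots> \<otimes> v\<^sub>k\<close> by the sign rule:
  moving \<open>g\<^sub>2 \<otimes> \<dots> \<otimes> g\<^sub>k\<close> past an odd \<open>v\<^sub>1\<close> multiplies it by the sign of its parity, i.e.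
  applies \<open>parity_inv\<close> to each factor.\<close>

fun word_act ::
  "('g::super_presented palg \<Rightarrow> 'h::super_presented palg \<Rightarrow> 'h palg) \<Rightarrow>
    'g palg list \<Rightarrow> 'h palg list \<Rightarrow> 'h tensor"
where
  "word_act \<rho> [] [] = 1"
| "word_act \<rho> (g # gs) (v # vs) =
     tens [\<rho> g (part 0 v)] * word_act \<rho> gs vs +
     tens [\<rho> g (part 1 v)] * word_act \<rho> (map parity_inv gs) vs"
| "word_act \<rho> _ _ = 0"


section \<open>The quantum queer superalgebra\<close>

text \<open>Throughout, \<open>n\<close> is \<open>CARD('n)\<close>.  Generators are indexed by all natural numbers;
  those with an index outside the admissible range are set to \<open>0\<close>.\<close>

datatype 'n ugen =
  qK nat | qKinv nat | qE nat | qF nat | qKbar nat | qEbar nat | qFbar nat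

fun admissible :: "nat \<Rightarrow> 'n ugen \<Rightarrow> bool"
where
  "admissible n (qK i) \<longleftrightarrow> i \<in> {1..n}"
| "admissible n (qKinv i) \<longleftrightarrow> i \<in> {1..n}"
| "admissible n (qKbar i) \<longleftrightarrow> i \<in> {1..n}"
| "admissible n (qE j) \<longleftrightarrow> j \<in> {1..<n}"
| "admissible n (qF j) \<longleftrightarrow> j \<in> {1..<n}"
| "admissible n (qEbar j) \<longleftrightarrow> j \<in> {1..<n}"
| "admissible n (qFbar j) \<longleftrightarrow> j \<in> {1..<n}"

definition wt :: "nat \<Rightarrow> nat \<Rightarrow> int"
  where "wt i j = of_bool (i = j) - of_bool (i = j + 1)"

inductive_set urels :: "nat \<Rightarrow> 'n ugen free_algebra set" for n :: nat
where
  range: "\<not> admissible n g \<Longrightarrow> \<langle>g\<rangle> \<in> urels n"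

| QQ1_inv_right: "i \<in> {1..n} \<Longrightarrow> \<langle>qK i\<rangle> * \<langle>qKinv i\<rangle> - 1 \<in> urels n"
| QQ1_inv_left: "i \<in> {1..n} \<Longrightarrow> \<langle>qKinv i\<rangle> * \<langle>qK i\<rangle> - 1 \<in> urels n"
| QQ1_K_K: "i \<in> {1..n} \<Longrightarrow> j \<in> {1..n} \<Longrightarrow> \<langle>qK i\<rangle> * \<langle>qK j\<rangle> - \<langle>qK j\<rangle> * \<langle>qK i\<rangle> \<in> urels n"
| QQ1_K_Kbar: "i \<in> {1..n} \<Longrightarrow> j \<in> {1..n} \<Longrightarrow>
    \<langle>qK i\<rangle> * \<langle>qKbar j\<rangle> - \<langle>qKbar j\<rangle> * \<langle>qK i\<rangle> \<in> urels n"
| QQ1_Kbar_Kbar: "i \<in> {1..n} \<Longrightarrow> j \<in> {1..n} \<Longrightarrow>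
    \<langle>qKbar i\<rangle> * \<langle>qKbar j\<rangle> + \<langle>qKbar j\<rangle> * \<langle>qKbar i\<rangle>
      - (2 * of_bool (i = j) / (\<upsilon>^2 - inverse \<upsilon>^2)) *\<^sub>f (\<langle>qK i\<rangle>^2 - \<langle>qKinv i\<rangle>^2) \<in> urels n"

| QQ2_E: "i \<in> {1..n} \<Longrightarrow> j \<in> {1..<n} \<Longrightarrow>
    \<langle>qK i\<rangle> * \<langle>qE j\<rangle> - (\<upsilon> powi wt i j) *\<^sub>f (\<langle>qE j\<rangle> * \<langle>qK i\<rangle>) \<in> urels n"
| QQ2_F: "i \<in> {1..n} \<Longrightarrow> j \<in> {1..<n} \<Longrightarrow>
    \<langle>qK i\<rangle> * \<langle>qF j\<rangle> - (\<upsilon> powi (- wt i j)) *\<^sub>f (\<langle>qF j\<rangle> * \<langle>qK i\<rangle>) \<in> urels n"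
| QQ2_Ebar: "i \<in> {1..n} \<Longrightarrow> j \<in> {1..<n} \<Longrightarrow>
    \<langle>qK i\<rangle> * \<langle>qEbar j\<rangle> - (\<upsilon> powi wt i j) *\<^sub>f (\<langle>qEbar j\<rangle> * \<langle>qK i\<rangle>) \<in> urels n"
| QQ2_Fbar: "i \<in> {1..n} \<Longrightarrow> j \<in> {1..<n} \<Longrightarrow>
    \<langle>qK i\<rangle> * \<langle>qFbar j\<rangle> - (\<upsilon> powi (- wt i j)) *\<^sub>f (\<langle>qFbar j\<rangle> * \<langle>qK i\<rangle>) \<in> urels n"

| QQ3_E: "i \<in> {1..n} \<Longrightarrow> j \<in> {1..<n} \<Longrightarrow> i \<noteq> j \<Longrightarrow> i \<noteq> j + 1 \<Longrightarrow>
    \<langle>qKbar i\<rangle> * \<langle>qE j\<rangle> - \<langle>qE j\<rangle> * \<langle>qKbar i\<rangle> \<in> urels n"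
| QQ3_F: "i \<in> {1..n} \<Longrightarrow> j \<in> {1..<n} \<Longrightarrow> i \<noteq> j \<Longrightarrow> i \<noteq> j + 1 \<Longrightarrow>
    \<langle>qKbar i\<rangle> * \<langle>qF j\<rangle> - \<langle>qF j\<rangle> * \<langle>qKbar i\<rangle> \<in> urels n"
| QQ3_E_same: "j \<in> {1..<n} \<Longrightarrow>
    \<langle>qKbar j\<rangle> * \<langle>qE j\<rangle> - \<upsilon> *\<^sub>f (\<langle>qE j\<rangle> * \<langle>qKbar j\<rangle>) - \<langle>qEbar j\<rangle> * \<langle>qKinv j\<rangle> \<in> urels n"
| QQ3_E_next: "j \<in> {1..<n} \<Longrightarrow>
    \<upsilon> *\<^sub>f (\<langle>qKbar (j + 1)\<rangle> * \<langle>qE j\<rangle>) - \<langle>qE j\<rangle> * \<langle>qKbar (j + 1)\<rangle>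
      + \<langle>qKinv (j + 1)\<rangle> * \<langle>qEbar j\<rangle> \<in> urels n"
| QQ3_F_same: "j \<in> {1..<n} \<Longrightarrow>
    \<langle>qKbar j\<rangle> * \<langle>qF j\<rangle> - \<upsilon> *\<^sub>f (\<langle>qF j\<rangle> * \<langle>qKbar j\<rangle>) + \<langle>qFbar j\<rangle> * \<langle>qK j\<rangle> \<in> urels n"
| QQ3_F_next: "j \<in> {1..<n} \<Longrightarrow>
    \<upsilon> *\<^sub>f (\<langle>qKbar (j + 1)\<rangle> * \<langle>qF j\<rangle>) - \<langle>qF j\<rangle> * \<langle>qKbar (j + 1)\<rangle>
      - \<langle>qK (j + 1)\<rangle> * \<langle>qFbar j\<rangle> \<in> urels n"

| QQ4_E_F: "i \<in> {1..<n} \<Longrightarrow> j \<in> {1..<n} \<Longrightarrow>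
    \<langle>qE i\<rangle> * \<langle>qF j\<rangle> - \<langle>qF j\<rangle> * \<langle>qE i\<rangle>
      - (of_bool (i = j) / (\<upsilon> - inverse \<upsilon>)) *\<^sub>f
          (\<langle>qK i\<rangle> * \<langle>qKinv (i + 1)\<rangle> - \<langle>qKinv i\<rangle> * \<langle>qK (i + 1)\<rangle>) \<in> urels n"
| QQ4_E_Fbar: "i \<in> {1..<n} \<Longrightarrow> j \<in> {1..<n} \<Longrightarrow>
    \<langle>qE i\<rangle> * \<langle>qFbar j\<rangle> - \<langle>qFbar j\<rangle> * \<langle>qE i\<rangle>
      - of_bool (i = j) *\<^sub>f
          (\<langle>qKinv (i + 1)\<rangle> * \<langle>qKbar i\<rangle> - \<langle>qKbar (i + 1)\<rangle> * \<langle>qKinv i\<rangle>) \<in> urels n"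
| QQ4_Ebar_F: "i \<in> {1..<n} \<Longrightarrow> j \<in> {1..<n} \<Longrightarrow>
    \<langle>qEbar i\<rangle> * \<langle>qF j\<rangle> - \<langle>qF j\<rangle> * \<langle>qEbar i\<rangle>
      - of_bool (i = j) *\<^sub>f
          (\<langle>qK (i + 1)\<rangle> * \<langle>qKbar i\<rangle> - \<langle>qKbar (i + 1)\<rangle> * \<langle>qK i\<rangle>) \<in> urels n"

| QQ5_E_far: "i \<in> {1..<n} \<Longrightarrow> j \<in> {1..<n} \<Longrightarrow> \<bar>int i - int j\<bar> > 1 \<Longrightarrow>
    \<langle>qE i\<rangle> * \<langle>qE j\<rangle> - \<langle>qE j\<rangle> * \<langle>qE i\<rangle> \<in> urels n"
| QQ5_F_far: "i \<in> {1..<n} \<Longrightarrow> j \<in> {1..<n} \<Longrightarrow> \<bar>int i - int j\<bar> > 1 \<Longrightarrow>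
    \<langle>qF i\<rangle> * \<langle>qF j\<rangle> - \<langle>qF j\<rangle> * \<langle>qF i\<rangle> \<in> urels n"
| QQ5_E_Ebar: "i \<in> {1..<n} \<Longrightarrow> \<langle>qE i\<rangle> * \<langle>qEbar i\<rangle> - \<langle>qEbar i\<rangle> * \<langle>qE i\<rangle> \<in> urels n"
| QQ5_F_Fbar: "i \<in> {1..<n} \<Longrightarrow> \<langle>qF i\<rangle> * \<langle>qFbar i\<rangle> - \<langle>qFbar i\<rangle> * \<langle>qF i\<rangle> \<in> urels n"
| QQ5_E_next: "i \<in> {1..<n} \<Longrightarrow> i + 1 \<in> {1..<n} \<Longrightarrow>
    \<langle>qE i\<rangle> * \<langle>qE (i + 1)\<rangle> - \<upsilon> *\<^sub>f (\<langle>qE (i + 1)\<rangle> * \<langle>qE i\<rangle>)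
      - (\<langle>qEbar i\<rangle> * \<langle>qEbar (i + 1)\<rangle> + \<upsilon> *\<^sub>f (\<langle>qEbar (i + 1)\<rangle> * \<langle>qEbar i\<rangle>)) \<in> urels n"
| QQ5_F_next: "i \<in> {1..<n} \<Longrightarrow> i + 1 \<in> {1..<n} \<Longrightarrow>
    \<upsilon> *\<^sub>f (\<langle>qF (i + 1)\<rangle> * \<langle>qF i\<rangle>) - \<langle>qF i\<rangle> * \<langle>qF (i + 1)\<rangle>
      - (\<langle>qFbar i\<rangle> * \<langle>qFbar (i + 1)\<rangle> + \<upsilon> *\<^sub>f (\<langle>qFbar (i + 1)\<rangle> * \<langle>qFbar i\<rangle>)) \<in> urels n"

| QQ6_E: "i \<in> {1..<n} \<Longrightarrow> j \<in> {1..<n} \<Longrightarrow> \<bar>int i - int j\<bar> = 1 \<Longrightarrow>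
    Z \<in> {\<langle>qE j\<rangle>, \<langle>qEbar j\<rangle>} \<Longrightarrow>
    \<langle>qE i\<rangle>^2 * Z - (\<upsilon> + inverse \<upsilon>) *\<^sub>f (\<langle>qE i\<rangle> * Z * \<langle>qE i\<rangle>) + Z * \<langle>qE i\<rangle>^2 \<in> urels n"
| QQ6_F: "i \<in> {1..<n} \<Longrightarrow> j \<in> {1..<n} \<Longrightarrow> \<bar>int i - int j\<bar> = 1 \<Longrightarrow>
    Z \<in> {\<langle>qF j\<rangle>, \<langle>qFbar j\<rangle>} \<Longrightarrow>
    \<langle>qF i\<rangle>^2 * Z - (\<upsilon> + inverse \<upsilon>) *\<^sub>f (\<langle>qF i\<rangle> * Z * \<langle>qF i\<rangle>) + Z * \<langle>qF i\<rangle>^2 \<in> urels n"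

instantiation ugen :: (type) super_presented
begin
definition rels_ugen :: "'a ugen free_algebra set"
  where "rels_ugen = urels CARD('a)"
fun gen_parity_ugen :: "'a ugen \<Rightarrow> bit"
where
  "gen_parity_ugen (qKbar i) = 1"
| "gen_parity_ugen (qEbar j) = 1"
| "gen_parity_ugen (qFbar j) = 1"
| "gen_parity_ugen _ = 0"
instance ..
end

type_synonym 'n U = "'n ugen palg"

definition Ktilde :: "nat \<Rightarrow> 'n U"
  where "Ktilde h = gen (qK h) * gen (qKinv (h + 1))"

definition Ktilde_inv :: "nat \<Rightarrow> 'n U"
  where "Ktilde_inv h = gen (qKinv h) * gen (qK (h + 1))"

text \<open>The comultiplication: an even, coassociative homomorphism of superalgebras with the
  given values on a generating set, and hence unique.\<close>

definition is_comultiplication :: "('n U \<Rightarrow> 'n ugen tensor) \<Rightarrow> bool"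
  where "is_comultiplication \<Delta> \<longleftrightarrow>
    Vector_Spaces.linear pscale pscale \<Delta> \<and>
    range \<Delta> \<subseteq> tensor_power 2 \<and>
    (\<forall>p. \<Delta> ` homogeneous p \<subseteq> tensor2_homogeneous p) \<and>
    \<Delta> 1 = tens [1, 1] \<and>
    (\<forall>x y. \<Delta> (x * y) = \<Delta> x \<star> \<Delta> y) \<and>
    (\<forall>x. pair_lift (\<lambda>a b. \<Delta> a * tens [b]) (\<Delta> x) = pair_lift (\<lambda>a b. tens [a] * \<Delta> b) (\<Delta> x)) \<and>
    (\<forall>i \<in> {1..CARD('n)}. \<Delta> (gen (qK i)) = tens [gen (qK i), gen (qK i)]) \<and>
    (\<forall>h \<in> {1..<CARD('n)}.
       \<Delta> (gen (qE h)) = tens [gen (qE h), Ktilde_inv h] + tens [1, gen (qE h)]) \<and>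
    (\<forall>h \<in> {1..<CARD('n)}.
       \<Delta> (gen (qF h)) = tens [gen (qF h), 1] + tens [Ktilde h, gen (qF h)]) \<and>
    \<Delta> (gen (qKbar 1)) = tens [gen (qKbar 1), gen (qK 1)] + tens [gen (qKinv 1), gen (qKbar 1)]"


section \<open>The quantum symmetric superalgebra and its natural action\<close>

datatype 'n agen = qX nat | qXbar nat

inductive_set arels :: "nat \<Rightarrow> 'n agen free_algebra set" for n :: nat
where
  range_X: "i \<notin> {1..n} \<Longrightarrow> \<langle>qX i\<rangle> \<in> arels n"
| range_Xbar: "i \<notin> {1..n} \<Longrightarrow> \<langle>qXbar i\<rangle> \<in> arels n"
| X_X: "i \<in> {1..n} \<Longrightarrow> j \<in> {1..n} \<Longrightarrow> \<langle>qX i\<rangle> * \<langle>qX j\<rangle> - \<langle>qX j\<rangle> * \<langle>qX i\<rangle> \<in> arels n"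
| X_Xbar: "i \<in> {1..n} \<Longrightarrow> j \<in> {1..n} \<Longrightarrow>
    \<langle>qX i\<rangle> * \<langle>qXbar j\<rangle> - \<langle>qXbar j\<rangle> * \<langle>qX i\<rangle> \<in> arels n"
| Xbar_Xbar: "i \<in> {1..n} \<Longrightarrow> j \<in> {1..n} \<Longrightarrow> i \<noteq> j \<Longrightarrow>
    \<langle>qXbar i\<rangle> * \<langle>qXbar j\<rangle> + \<langle>qXbar j\<rangle> * \<langle>qXbar i\<rangle> \<in> arels n"
| Xbar_square: "i \<in> {1..n} \<Longrightarrow>
    \<langle>qXbar i\<rangle>^2 - ((\<upsilon> - inverse \<upsilon>) / (\<upsilon> + inverse \<upsilon>)) *\<^sub>f \<langle>qX i\<rangle>^2 \<in> arels n"

instantiation agen :: (type) super_presented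
begin
definition rels_agen :: "'a agen free_algebra set"
  where "rels_agen = arels CARD('a)"
fun gen_parity_agen :: "'a agen \<Rightarrow> bit"
where
  "gen_parity_agen (qX i) = 0"
| "gen_parity_agen (qXbar i) = 1"
instance ..
end

type_synonym 'n A = "'n agen palg"

text \<open>The monomial with exponents \<open>a i\<close> of \<open>X\<^sub>i\<close> and \<open>b i\<close> of its odd companion.  Exponents
  \<open>b i = 2\<close> do occur on the right-hand sides of the action formulas below.\<close>

definition Xmon :: "(nat \<Rightarrow> nat) \<Rightarrow> (nat \<Rightarrow> nat) \<Rightarrow> 'n A"
  where "Xmon a b =
    (\<Prod>i\<leftarrow>[1..<Suc CARD('n)]. gen (qX i) ^ a i) *
    (\<Prod>i\<leftarrow>[1..<Suc CARD('n)]. gen (qXbar i) ^ b i)"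

text \<open>The supermodule structure on \<open>'n A\<close>, determined by the action of the generators
  on the monomial basis.  Whenever a truncated subtraction \<open>0 - 1\<close> occurs, its coefficient
  is \<open>qint 0 = 0\<close>.\<close>

definition is_natural_action :: "('n U \<Rightarrow> 'n A \<Rightarrow> 'n A) \<Rightarrow> bool"
  where "is_natural_action \<rho> \<longleftrightarrow>
    is_supermodule pscale \<rho> UNIV homogeneous \<and>
    (\<forall>a b. (\<forall>i. b i \<in> {0, 1}) \<longrightarrow>
      (\<forall>i \<in> {1..CARD('n)}. \<rho> (gen (qK i)) (Xmon a b) = \<upsilon> powi (int (a i + b i)) \<cdot> Xmon a b) \<and>
      (\<forall>h \<in> {1..<CARD('n)}. \<rho> (gen (qE h)) (Xmon a b) =
         (\<upsilon> powi int (b (h + 1)) * qint (int (a (h + 1)))) \<cdot>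
            Xmon (a(h := a h + 1, h + 1 := a (h + 1) - 1)) b +
         (\<upsilon> powi (- int (a (h + 1))) * qint (int (b (h + 1)))) \<cdot>
            Xmon a (b(h := b h + 1, h + 1 := b (h + 1) - 1))) \<and>
      (\<forall>h \<in> {1..<CARD('n)}. \<rho> (gen (qF h)) (Xmon a b) =
         (\<upsilon> powi (- int (b h)) * qint (int (a h))) \<cdot>
            Xmon (a(h := a h - 1, h + 1 := a (h + 1) + 1)) b +
         (\<upsilon> powi int (a h) * qint (int (b h))) \<cdot>
            Xmon a (b(h := b h - 1, h + 1 := b (h + 1) + 1))) \<and>
      \<rho> (gen (qKbar 1)) (Xmon a b) =
         (\<upsilon> powi (- int (a 1)) * qint (int (b 1))) \<cdot> Xmon (a(1 := a 1 + 1)) (b(1 := b 1 - 1)) +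
         (\<upsilon> powi int (b 1) * qint (int (a 1))) \<cdot> Xmon (a(1 := a 1 - 1)) (b(1 := b 1 + 1)))"


section \<open>The tensor space, its completion, and the elements \<open>A(j)\<close>\<close>

definition tensor_act ::
  "('n U \<Rightarrow> 'n ugen tensor) \<Rightarrow> ('n U \<Rightarrow> 'n A \<Rightarrow> 'n A) \<Rightarrow> 'n U \<Rightarrow> 'n agen tensor \<Rightarrow> 'n agen tensor"
  where "tensor_act \<Delta> \<rho> u t =
    tensor_lift (\<lambda>gs. tensor_lift (word_act \<rho> gs) t) (iter_comult \<Delta> (CARD('n) - 1) u)"

text \<open>Pairs of \<open>n \<times> n\<close> matrices are functions vanishing outside \<open>{1..n} \<times> {1..n}\<close>.\<close>

type_synonym smatrix = "(nat \<Rightarrow> nat \<Rightarrow> nat) \<times> (nat \<Rightarrow> nat \<Rightarrow> nat)"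

definition smatrices :: "nat \<Rightarrow> smatrix set"
  where "smatrices n =
    {(A0, A1). (\<forall>i j. A1 i j \<in> {0, 1}) \<and>
       (\<forall>i j. i \<notin> {1..n} \<or> j \<notin> {1..n} \<longrightarrow> A0 i j = 0 \<and> A1 i j = 0)}"

definition smatrices' :: "nat \<Rightarrow> smatrix set"
  where "smatrices' n = {(A0, A1) \<in> smatrices n. \<forall>i. A0 i i = 0}"

definition int_vectors :: "nat \<Rightarrow> (nat \<Rightarrow> int) set"
  where "int_vectors n = {j. \<forall>i. i \<notin> {1..n} \<longrightarrow> j i = 0}"

definition nat_vectors :: "nat \<Rightarrow> (nat \<Rightarrow> nat) set"
  where "nat_vectors n = {l. \<forall>i. i \<notin> {1..n} \<longrightarrow> l i = 0}"

definition entry_sum :: "nat \<Rightarrow> smatrix \<Rightarrow> nat"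
  where "entry_sum n A = (\<Sum>i = 1..n. \<Sum>j = 1..n. fst A i j + snd A i j)"

definition smatrix_parity :: "nat \<Rightarrow> smatrix \<Rightarrow> bit"
  where "smatrix_parity n A = of_nat (\<Sum>i = 1..n. \<Sum>j = 1..n. snd A i j)"

definition add_diag :: "smatrix \<Rightarrow> (nat \<Rightarrow> nat) \<Rightarrow> smatrix"
  where "add_diag A l = ((\<lambda>i j. fst A i j + (if i = j then l i else 0)), snd A)"

definition Ycol :: "smatrix \<Rightarrow> nat \<Rightarrow> 'n A"
  where "Ycol A j =
    (\<Prod>i\<leftarrow>[1..<Suc CARD('n)]. divpow (gen (qX i)) (fst A i j)) *
    (\<Prod>i\<leftarrow>[1..<Suc CARD('n)]. gen (qXbar i) ^ snd A i j)"

definition Xmat :: "smatrix \<Rightarrow> 'n agen tensor"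
  where "Xmat A = tens (map (Ycol A) [1..<Suc CARD('n)])"

definition tensor_deg :: "nat \<Rightarrow> 'n agen tensor set"
  where "tensor_deg r = palg.span (Xmat ` {A \<in> smatrices CARD('n). entry_sum CARD('n) A = r})"

text \<open>Elements of the completion are families indexed by the degree \<open>r\<close>.\<close>

definition That :: "(nat \<Rightarrow> 'n agen tensor) set"
  where "That = {f. \<forall>r. f r \<in> tensor_deg r}"

definition hscale :: "qfield \<Rightarrow> (nat \<Rightarrow> 'g::presented palg) \<Rightarrow> (nat \<Rightarrow> 'g palg)"
  where "hscale c f = (\<lambda>r. c \<cdot> f r)"

interpretation hat: vector_space "hscale :: qfield \<Rightarrow> (nat \<Rightarrow> 'g::presented palg) \<Rightarrow> _"
  by standard
    (simp_all add: hscale_def fun_eq_iff palg.scale_right_distrib palg.scale_left_distrib)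

definition hat_act ::
  "('n U \<Rightarrow> 'n ugen tensor) \<Rightarrow> ('n U \<Rightarrow> 'n A \<Rightarrow> 'n A) \<Rightarrow>
    'n U \<Rightarrow> (nat \<Rightarrow> 'n agen tensor) \<Rightarrow> (nat \<Rightarrow> 'n agen tensor)"
  where "hat_act \<Delta> \<rho> u f = (\<lambda>r. tensor_act \<Delta> \<rho> u (f r))"

text \<open>\<open>A(j)\<close>: the component of degree \<open>r\<close> collects the (finitely many) summands lying in
  that degree.\<close>

definition Aj :: "smatrix \<Rightarrow> (nat \<Rightarrow> int) \<Rightarrow> nat \<Rightarrow> 'n agen tensor"
  where "Aj A j = (\<lambda>r.
    \<Sum>l \<in> {l \<in> nat_vectors CARD('n). entry_sum CARD('n) (add_diag A l) = r}.
      (\<upsilon> powi (\<Sum>i = 1..CARD('n). int (l i) * j i)) \<cdot> Xmat (add_diag A l))"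

definition LV :: "(nat \<Rightarrow> 'n agen tensor) set"
  where "LV = {Aj A j | A j. A \<in> smatrices' CARD('n) \<and> j \<in> int_vectors CARD('n)}"

definition VV :: "(nat \<Rightarrow> 'n agen tensor) set"
  where "VV = hat.span LV"

definition VV_part :: "bit \<Rightarrow> (nat \<Rightarrow> 'n agen tensor) set"
  where "VV_part p = hat.span {Aj A j | A j.
    A \<in> smatrices' CARD('n) \<and> j \<in> int_vectors CARD('n) \<and> smatrix_parity CARD('n) A = p}"

end

theory Submission
  imports Defs
begin

text \<open>Up to a scalar, \<open>A(j)\<close> is a product of sequences \<open>y\<^sub>1 \<otimes> \<dots> \<otimes> y\<^sub>n\<close>, one for each column of
  the matrix, where \<open>y\<^sub>m\<close> is a sequence of divided monomials whose degree \<open>r\<close> term is multiplied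
  by \<open>\<upsilon>\<^bsup>kr\<^esup>\<close> and in which only the exponent of \<open>X\<^sub>m\<close> varies.  The span of these sequences is stable
  under the generators of the quantum queer superalgebra, because the coefficients in the action
  formulas are Laurent polynomials in \<open>\<upsilon>\<^sup>r\<close>; hence it is a submodule of the completed symmetric superalgebra.
  Consequently the span of all \<open>A(j)\<close> is stable under every factorwise action, in particular under
  the one given by the iterated comultiplication.  Independence reduces, by comparing coefficients of the monomial
  basis, to that of the characters \<open>l \<mapsto> \<upsilon>\<^bsup>l\<cdot>j\<^esup>\<close>.\<close>

text \<open>The action and the comultiplication are arbitrary maps with prescribed properties, while
  lifts and parity components are definite descriptions, and no basis is given in advance. Linear
  maps out of the algebras, the parity grading, a generating set and the independence of monomials
  are therefore derived from the presentations. Why products over columns appear: in column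
  \<open>j\<close>, \<lambda>_j differs from the degree of the column by a constant. Hence the
  weight \<upsilon>^(\<lambda>_j j_j) is, up to a constant, a power of \<upsilon>^r with r that
  degree, and the sum over \<lambda> factors into one sequence per column. Two choices keep the
  computation uniform. With divided powers the coefficient attached to a move of an even variable is
  the quantum integer of the raised exponent; formulas then hold for all integer exponents, because
  on negative ones either the coefficient or the monomial vanishes, so a sequence has no boundary
  terms. And the signs of the sign rule depend on parities only, so a word of homogeneous factors
  acts on a product of homogeneous sequences factorwise up to one sign common to all
  degrees.\<close>

lemma free_induct [case_names zero single add]:
  fixes p :: "'g free_algebra"
  assumes "P 0" "\<And>w c. P (Poly_Mapping.single w c)" "\<And>p q. P p \<Longrightarrow> P q \<Longrightarrow> P (p + q)"
  shows "P p"
proof (induction p rule: Poly_Mapping.update_induct)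
  case const
  show ?case by (rule assms(1))
next
  case (update f a b)
  have "Poly_Mapping.update a b f = f + Poly_Mapping.single a b"
    using update(1)
    by (intro poly_mapping_eqI) (auto simp: lookup_update lookup_add lookup_single when_def in_keys_iff)
  then show ?case using assms(2,3) update by simp
qed

lemma letter_word: "Poly_Mapping.single w 1 = (\<Prod>g\<leftarrow>w. \<langle>g\<rangle>)"
proof (induction w)
  case Nil
  show ?case by (metis list.map(1) prod_list.Nil single_one zero_list_def)
next
  case (Cons g w)
  have "Poly_Mapping.single (g # w) (1::qfield) = \<langle>g\<rangle> * Poly_Mapping.single w 1"
    by (simp add: letter_def mult_single plus_list_def)
  then show ?case by (simp add: Cons)
qed

section \<open>Presented algebras: spanning words and linear maps out of them\<close>

lemma abs_palg_eq_0: "abs_palg p = 0 \<longleftrightarrow> p \<in> rel_ideal"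
  by (simp add: zero_palg.abs_eq palg.abs_eq_iff rel_eq_def)

lemma abs_palg_cases: obtains p where "x = abs_palg p"
  using Quotient3_abs_rep[OF Quotient3_palg, of x] by metis

lemma rel_in_ideal: "r \<in> rels \<Longrightarrow> r \<in> rel_ideal"
  using rel_ideal.add[OF rel_ideal.zero, of r 1 1] by simp

lemma pscale_mult_left: "(c \<cdot> x) * y = c \<cdot> (x * y)"
  by transfer (rule rel_eq_refl, simp only: fscale_def mult.assoc)

lemma single_Nil_commute:
  fixes p :: "'g free_algebra"
  shows "Poly_Mapping.single [] c * p = p * Poly_Mapping.single [] c"
  by (induction p rule: free_induct)
    (simp_all add: mult_single plus_list_def mult.commute distrib_left distrib_right)

lemma pscale_mult_right: "x * (c \<cdot> y) = c \<cdot> (x * y)"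
  by transfer (rule rel_eq_refl, metis fscale_def mult.assoc single_Nil_commute)

lemma abs_palg_single: "abs_palg (Poly_Mapping.single w c) = c \<cdot> (\<Prod>g\<leftarrow>w. gen g)"
proof -
  have one: "abs_palg (\<Prod>g\<leftarrow>w. \<langle>g\<rangle>) = (\<Prod>g\<leftarrow>w. gen g)"
    by (induction w) (simp_all add: gen_def times_palg.abs_eq[symmetric] one_palg.abs_eq)
  have "Poly_Mapping.single w c = c *\<^sub>f Poly_Mapping.single w 1"
    by (simp add: fscale_def mult_single plus_list_def)
  then show ?thesis by (simp add: pscale.abs_eq[symmetric] letter_word one)
qed

lemma palg_word_span: "x \<in> palg.span (range (\<lambda>w. \<Prod>g\<leftarrow>w. gen g))"
proof -
  obtain p where "x = abs_palg p" by (rule abs_palg_cases)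
  moreover have "abs_palg p \<in> palg.span (range (\<lambda>w. \<Prod>g\<leftarrow>w. gen g))"
  proof (induction p rule: free_induct)
    case zero
    show ?case by (simp add: zero_palg.abs_eq[symmetric] palg.span_zero)
  next
    case (single w c)
    show ?case by (simp add: abs_palg_single palg.span_scale palg.span_base)
  next
    case (add p q)
    then show ?case by (simp add: plus_palg.abs_eq[symmetric] palg.span_add)
  qed
  ultimately show ?thesis by simp
qed

lemma palg_induct [case_names zero scale add one gen]:
  fixes x :: "'g::presented palg"
  assumes "P 0" "\<And>c x. P x \<Longrightarrow> P (c \<cdot> x)" "\<And>x y. P x \<Longrightarrow> P y \<Longrightarrow> P (x + y)"
    "P 1" "\<And>g x. P x \<Longrightarrow> P (gen g * x)"
  shows "P x"
proof -
  have *: "P (\<Prod>g\<leftarrow>w. gen g)" for w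
    by (induction w) (simp_all add: assms)
  have "palg.subspace {x. P x}" by (simp add: palg.subspace_def assms)
  then have "palg.span (range (\<lambda>w. \<Prod>g\<leftarrow>w. gen g)) \<subseteq> {x. P x}"
    by (intro palg.span_minimal) (auto simp: *)
  then show ?thesis using palg_word_span by auto
qed

text \<open>Linear extension from words. The scalar multiplication of the target is a parameter
  because both presented algebras and the ground field occur as targets.\<close>

definition free_ext :: "(qfield \<Rightarrow> 'v \<Rightarrow> 'v::ab_group_add) \<Rightarrow> ('g list \<Rightarrow> 'v) \<Rightarrow> 'g free_algebra \<Rightarrow> 'v"
  where "free_ext sc f p = (\<Sum>w\<in>Poly_Mapping.keys p. sc (Poly_Mapping.lookup p w) (f w))"

context
  fixes sc :: "qfield \<Rightarrow> 'v \<Rightarrow> 'v::ab_group_add"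
  assumes vs: "vector_space sc"
begin

interpretation v: vector_space sc by (rule vs)

lemma free_ext_superset:
  assumes "finite S" "Poly_Mapping.keys p \<subseteq> S"
  shows "free_ext sc f p = (\<Sum>w\<in>S. sc (Poly_Mapping.lookup p w) (f w))"
  unfolding free_ext_def
  by (rule sum.mono_neutral_left) (use assms in \<open>auto simp: in_keys_iff\<close>)

lemma free_ext_single: "free_ext sc f (Poly_Mapping.single w c) = sc c (f w)"
  by (subst free_ext_superset[of "{w}"]) auto

lemma free_ext_add: "free_ext sc f (p + q) = free_ext sc f p + free_ext sc f q"
proof -
  let ?S = "Poly_Mapping.keys p \<union> Poly_Mapping.keys q"
  have "Poly_Mapping.keys (p + q) \<subseteq> ?S" by (rule keys_add)
  then show ?thesis
    by (simp add: free_ext_superset[of ?S] lookup_add v.scale_left_distrib sum.distrib)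
qed

lemma free_ext_zero: "free_ext sc f 0 = 0"
  by (simp add: free_ext_def)

lemma free_ext_uminus: "free_ext sc f (- p) = - free_ext sc f p"
  using free_ext_add[of f p "- p"] by (simp add: free_ext_zero eq_neg_iff_add_eq_0 add.commute)

lemma free_ext_diff: "free_ext sc f (p - q) = free_ext sc f p - free_ext sc f q"
  using free_ext_add[of f p "- q"] by (simp add: free_ext_uminus)

lemma free_ext_fscale: "free_ext sc f (c *\<^sub>f p) = sc c (free_ext sc f p)"
  by (induction p rule: free_induct)
    (simp_all add: fscale_def free_ext_zero free_ext_add free_ext_single mult_single plus_list_def
      distrib_left v.scale_right_distrib)

text \<open>An element of the ideal is a sum of terms \<open>p * r * q\<close>. Expanding
  \<open>p\<close> and \<open>q\<close> into words and pulling out the scalars, which are central,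
  leaves words with coefficient 1, the case covered by the hypothesis.\<close>

lemma free_ext_ideal:
  assumes f: "\<And>r u w. r \<in> rels \<Longrightarrow>
    free_ext sc f (Poly_Mapping.single u 1 * r * Poly_Mapping.single w 1) = 0"
    and p: "p \<in> rel_ideal"
  shows "free_ext sc f p = 0"
  using p
proof induction
  case zero
  show ?case by (rule free_ext_zero)
next
  case (add x r p q)
  have *: "free_ext sc f (Poly_Mapping.single u c * r * Poly_Mapping.single w d) = 0" for u w c d
  proof -
    have "Poly_Mapping.single u c = c *\<^sub>f Poly_Mapping.single u 1"
      "Poly_Mapping.single w d = d *\<^sub>f Poly_Mapping.single w 1"
      by (simp_all add: fscale_def mult_single plus_list_def)
    then have "Poly_Mapping.single u c * r * Poly_Mapping.single w d =
        c *\<^sub>f d *\<^sub>f (Poly_Mapping.single u 1 * r * Poly_Mapping.single w 1)"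
      by (simp add: fscale_def mult.assoc single_Nil_commute[of d])
    then show ?thesis by (simp add: free_ext_fscale f add(2))
  qed
  have "free_ext sc f (Poly_Mapping.single u c * r * q) = 0" for u c
    by (induction q rule: free_induct) (simp_all add: * free_ext_zero free_ext_add distrib_left)
  then have "free_ext sc f (p * r * q) = 0"
    by (induction p rule: free_induct) (simp_all add: free_ext_zero free_ext_add distrib_right)
  then show ?case by (simp add: free_ext_add add)
qed

text \<open>The maps obtained are linear but need not be multiplicative, so vanishing has to be
  checked on relations placed between arbitrary words. In return the lemma yields parity
  projections, multilinear lifts and coordinate functionals alike.\<close>

lemma palg_ext:
  fixes f :: "'g::presented list \<Rightarrow> 'v"
  assumes f: "\<And>r u w. r \<in> rels \<Longrightarrow>
    free_ext sc f (Poly_Mapping.single u 1 * r * Poly_Mapping.single w 1) = 0"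
  obtains L where "Vector_Spaces.linear pscale sc L" "\<And>p. L (abs_palg p) = free_ext sc f p"
    "\<And>w. L (\<Prod>g\<leftarrow>w. gen g) = f w"
proof -
  define L where "L x = free_ext sc f (rep_palg x)" for x
  have L: "L (abs_palg p) = free_ext sc f p" for p
  proof -
    \<comment> \<open>The chosen representative differs from \<open>p\<close> by an element of the
      ideal, on which the extension vanishes.\<close>
    have "abs_palg (rep_palg (abs_palg p)) = abs_palg p" by (rule Quotient3_abs_rep[OF Quotient3_palg])
    then have "rep_palg (abs_palg p) - p \<in> rel_ideal" by (simp add: palg.abs_eq_iff rel_eq_def)
    from f this have "free_ext sc f (rep_palg (abs_palg p) - p) = 0" by (rule free_ext_ideal)
    then show ?thesis by (simp add: free_ext_diff L_def)
  qed
  have "Vector_Spaces.linear pscale sc L"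
  proof (unfold Vector_Spaces.linear_iff, intro conjI allI)
    show "vector_space (pscale :: qfield \<Rightarrow> 'g palg \<Rightarrow> _)" by (rule palg.vector_space_axioms)
    show "vector_space sc" by (rule vs)
    fix x y :: "'g palg" and c
    obtain p where "x = abs_palg p" by (rule abs_palg_cases)
    moreover obtain q where "y = abs_palg q" by (rule abs_palg_cases)
    ultimately show "L (x + y) = L x + L y" "L (c \<cdot> x) = sc c (L x)"
      by (simp_all add: L plus_palg.abs_eq pscale.abs_eq free_ext_add free_ext_fscale)
  qed
  moreover have "L (\<Prod>g\<leftarrow>w. gen g) = f w" for w
    using L[of "Poly_Mapping.single w 1"] by (simp add: abs_palg_single free_ext_single)
  ultimately show thesis using that L by blast
qed

end

abbreviation plin :: "('g::presented palg \<Rightarrow> 'h::presented palg) \<Rightarrow> bool"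
  where "plin \<equiv> Vector_Spaces.linear pscale pscale"

lemma plin_iff: "plin L \<longleftrightarrow> (\<forall>x y. L (x + y) = L x + L y) \<and> (\<forall>c x. L (c \<cdot> x) = c \<cdot> L x)"
  by (simp add: Vector_Spaces.linear_iff palg.vector_space_axioms)

lemma plin_add: "plin L \<Longrightarrow> L (x + y) = L x + L y"
  and plin_scale: "plin L \<Longrightarrow> L (c \<cdot> x) = c \<cdot> L x"
  by (simp_all add: plin_iff)

lemma plin_zero: "plin L \<Longrightarrow> L 0 = 0"
  using plin_scale[of L 0 0] by simp

lemma plin_diff: "plin L \<Longrightarrow> L (x - y) = L x - L y"
  using plin_add[of L "x - y" y] by (simp add: algebra_simps)

lemma plin_sum: "plin L \<Longrightarrow> L (sum f S) = (\<Sum>i\<in>S. L (f i))"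
  by (induction S rule: infinite_finite_induct) (simp_all add: plin_zero plin_add)

lemma plin_span_eq:
  assumes "plin L" "plin L'" "x \<in> palg.span S" "\<And>y. y \<in> S \<Longrightarrow> L y = L' y"
  shows "L x = L' x"
  using assms(3)
  by (induction rule: palg.span_induct_alt)
    (use assms in \<open>simp_all add: plin_zero plin_add plin_scale\<close>)

lemma plin_span_in:
  assumes "plin L" "x \<in> palg.span S" "palg.subspace T" "\<And>y. y \<in> S \<Longrightarrow> L y \<in> T"
  shows "L x \<in> T"
  using assms(2)
  by (induction rule: palg.span_induct_alt)
    (use assms in \<open>simp_all add: plin_zero plin_add plin_scale palg.subspace_def\<close>)

section \<open>Parity\<close>

text \<open>Homogeneous relations let the parity of words descend to the quotient, which makes the
  components selected by \<open>part\<close> exist and be unique.\<close>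

class hom_presented = super_presented +
  assumes rels_homogeneous:
    "r \<in> rels \<Longrightarrow> \<exists>p. \<forall>w\<in>Poly_Mapping.keys r. sum_list (map gen_parity w) = p"

lemma word_parity_append: "word_parity (u @ w) = word_parity u + word_parity w"
  by (simp add: word_parity_def)

lemma homogeneous_eq_span:
  "homogeneous p = palg.span {\<Prod>g\<leftarrow>w. gen g | w. word_parity w = p}" (is "_ = palg.span ?S")
proof (intro equalityI subsetI)
  fix x :: "'a palg"
  assume "x \<in> homogeneous p"
  then obtain f where f: "x = abs_palg f" "\<forall>w\<in>Poly_Mapping.keys f. word_parity w = p"
    by (auto simp: homogeneous_def)
  from f(2) have "abs_palg f \<in> palg.span ?S"
  proof (induction f rule: Poly_Mapping.update_induct)
    case const
    then show ?case by (simp add: zero_palg.abs_eq[symmetric] palg.span_zero)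
  next
    case (update f a b)
    have "Poly_Mapping.update a b f = f + Poly_Mapping.single a b"
      using update(1)
      by (intro poly_mapping_eqI) (auto simp: lookup_update lookup_add lookup_single when_def in_keys_iff)
    moreover have "Poly_Mapping.keys (Poly_Mapping.update a b f) = insert a (Poly_Mapping.keys f)"
      using update by (simp add: keys_update)
    ultimately show ?case using update
      by (auto simp: plus_palg.abs_eq[symmetric] abs_palg_single
          intro!: palg.span_add[OF _ palg.span_scale[OF palg.span_base]])
  qed
  then show "x \<in> palg.span ?S" using f by simp
next
  fix x :: "'a palg"
  assume "x \<in> palg.span ?S"
  then show "x \<in> homogeneous p"
  proof (induction rule: palg.span_induct_alt)
    case base
    show ?case unfolding homogeneous_def by (auto simp: zero_palg.abs_eq intro!: exI[of _ 0])
  next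
    case (step c x y)
    then obtain w f where *: "x = (\<Prod>g\<leftarrow>w. gen g)" "word_parity w = p"
      "y = abs_palg f" "\<forall>w\<in>Poly_Mapping.keys f. word_parity w = p"
      by (auto simp: homogeneous_def)
    then have "c \<cdot> x + y = abs_palg (Poly_Mapping.single w c + f)"
      by (simp add: plus_palg.abs_eq[symmetric] abs_palg_single)
    moreover have "\<forall>w\<in>Poly_Mapping.keys (Poly_Mapping.single w c + f). word_parity w = p"
      using * keys_add[of "Poly_Mapping.single w c" f] by (auto split: if_splits)
    ultimately show ?case by (auto simp: homogeneous_def)
  qed
qed

lemma homogeneous_subspace: "palg.subspace (homogeneous p)"
  by (simp add: homogeneous_eq_span)

lemmas homogeneous_closed =
  palg.subspace_0[OF homogeneous_subspace] palg.subspace_add[OF homogeneous_subspace]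
  palg.subspace_diff[OF homogeneous_subspace] palg.subspace_neg[OF homogeneous_subspace]
  palg.subspace_scale[OF homogeneous_subspace]

text \<open>If a relation is homogeneous, all words of its product with a word on either side have
  the same parity. On such an element the truncated assignment is either the canonical map to the
  quotient, which kills it, or zero.\<close>

lemma parity_projection:
  obtains P :: "bit \<Rightarrow> 'g::hom_presented palg \<Rightarrow> 'g palg"
  where "\<And>p. plin (P p)"
    "\<And>p w. P p (\<Prod>g\<leftarrow>w. gen g) = (if word_parity w = p then (\<Prod>g\<leftarrow>w. gen g) else 0)"
proof -
  have "\<exists>L. plin L \<and> (\<forall>w. L (\<Prod>g\<leftarrow>w. gen g) =
      (if word_parity w = p then (\<Prod>g\<leftarrow>w. gen g :: 'g palg) else 0))" for p
  proof -
    let ?f = "\<lambda>w. if word_parity w = p then (\<Prod>g\<leftarrow>w. gen g :: 'g palg) else 0"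
    have "free_ext pscale ?f (Poly_Mapping.single u 1 * r * Poly_Mapping.single w 1) = 0"
      (is "free_ext _ _ ?q = 0") if r: "r \<in> rels" for r :: "'g free_algebra" and u w
    proof -
      obtain q where q: "\<And>v. v \<in> Poly_Mapping.keys r \<Longrightarrow> word_parity v = q"
        using rels_homogeneous[OF r] by (auto simp: word_parity_def)
      have k: "word_parity v = word_parity u + q + word_parity w" if "v \<in> Poly_Mapping.keys ?q" for v
      proof -
        from that keys_mult[of "Poly_Mapping.single u 1 * r" "Poly_Mapping.single w 1"]
        obtain a where a: "a \<in> Poly_Mapping.keys (Poly_Mapping.single u 1 * r)" "v = a @ w"
          by (auto simp: plus_list_def)
        with keys_mult[of "Poly_Mapping.single u 1" r]
        obtain b where "b \<in> Poly_Mapping.keys r" "a = u @ b"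
          by (auto simp: plus_list_def)
        with a q show ?thesis by (simp only: word_parity_append add.assoc)
      qed
      have ab: "abs_palg f = free_ext pscale (\<lambda>w. \<Prod>g\<leftarrow>w. gen g) f" for f :: "'g free_algebra"
        by (induction f rule: free_induct)
          (simp_all add: free_ext_zero[OF palg.vector_space_axioms] free_ext_add[OF palg.vector_space_axioms]
            free_ext_single[OF palg.vector_space_axioms] abs_palg_single plus_palg.abs_eq[symmetric] zero_palg.abs_eq)
      show ?thesis
      proof (cases "word_parity u + q + word_parity w = p")
        case True
        then have "free_ext pscale ?f ?q = free_ext pscale (\<lambda>w. \<Prod>g\<leftarrow>w. gen g) ?q"
          unfolding free_ext_def by (intro sum.cong) (simp_all add: k)
        moreover have "?q \<in> rel_ideal" using rel_ideal_mult rel_in_ideal r by blast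
        ultimately show ?thesis by (simp add: ab[symmetric] abs_palg_eq_0)
      next
        case False
        then show ?thesis unfolding free_ext_def by (intro sum.neutral) (simp add: k)
      qed
    qed
    from palg_ext[OF palg.vector_space_axioms this] show ?thesis by blast
  qed
  then have "\<exists>P. \<forall>p. plin (P p) \<and> (\<forall>w. P p (\<Prod>g\<leftarrow>w. gen g) =
      (if word_parity w = p then (\<Prod>g\<leftarrow>w. gen g :: 'g palg) else 0))"
    by (intro choice allI)
  then show thesis using that by blast
qed

context
  fixes dummy :: "'g::hom_presented itself"
begin

lemma part_props:
  shows part_plin: "plin (part p :: 'g palg \<Rightarrow> _)"
    and part_in_homogeneous: "part p x \<in> homogeneous p"
    and part_add_part: "part 0 x + part 1 x = (x :: 'g palg)"
    and part_homogeneous: "x \<in> homogeneous p \<Longrightarrow> part q x = (if q = p then x else 0)"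
proof -
  obtain P :: "bit \<Rightarrow> 'g palg \<Rightarrow> 'g palg"
    where P: "\<And>p. plin (P p)"
      "\<And>p w. P p (\<Prod>g\<leftarrow>w. gen g) = (if word_parity w = p then (\<Prod>g\<leftarrow>w. gen g) else 0)"
    using parity_projection by blast
  have in_hom: "P p x \<in> homogeneous p" for p x
  proof (rule plin_span_in[OF P(1) palg_word_span homogeneous_subspace])
    fix y :: "'g palg" assume "y \<in> range (\<lambda>w. \<Prod>g\<leftarrow>w. gen g)"
    then obtain w where "y = (\<Prod>g\<leftarrow>w. gen g)" by blast
    then show "P p y \<in> homogeneous p"
      by (simp add: P(2) homogeneous_closed) (auto simp: homogeneous_eq_span intro!: palg.span_base)
  qed
  have add: "P 0 x + P 1 x = x" for x
  proof -
    have "plin (\<lambda>x. P 0 x + P 1 x)" using P(1) by (simp add: plin_iff palg.scale_right_distrib)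
    moreover have "plin (\<lambda>x. x :: 'g palg)" by (simp add: plin_iff)
    moreover have "P 0 y + P 1 y = y" if "y \<in> range (\<lambda>w. \<Prod>g\<leftarrow>w. gen g)" for y
      using that by (auto simp: P(2))
    ultimately show ?thesis by (rule plin_span_eq[OF _ _ palg_word_span])
  qed
  have hom: "P q x = (if q = p then x else 0)" if "x \<in> homogeneous p" for x p q
  proof -
    have "plin (\<lambda>x. if q = p then x else 0 :: 'g palg)" by (simp add: plin_iff)
    then show ?thesis
      by (rule plin_span_eq[OF P(1)[of q] _ that[unfolded homogeneous_eq_span]]) (auto simp: P(2))
  qed
  \<comment> \<open>The projection satisfies the definite description, and applying
    \<open>P p\<close> to the two homogeneity conditions shows that nothing else does.\<close>
  have "part p x = P p x" for p x
    unfolding part_def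
  proof (rule the_equality)
    have "x - P p x = P (p + 1) x" using add[of x] by (cases p) (simp_all add: algebra_simps)
    then show "P p x \<in> homogeneous p \<and> x - P p x \<in> homogeneous (p + 1)" by (simp add: in_hom)
  next
    fix y assume y: "y \<in> homogeneous p \<and> x - y \<in> homogeneous (p + 1)"
    have "P p y = y" "P p (x - y) = 0"
      using y hom[of y p p] hom[of "x - y" "p + 1" p] by (cases p; simp)+
    then show "y = P p x" by (simp add: plin_diff[OF P(1)])
  qed
  then have e: "part = P" by (simp add: fun_eq_iff)
  show "plin (part p :: 'g palg \<Rightarrow> _)" "part p x \<in> homogeneous p"
    "part 0 x + part 1 x = x" "x \<in> homogeneous p \<Longrightarrow> part q x = (if q = p then x else 0)"
    unfolding e by (rule P in_hom add hom; assumption)+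
qed

lemma homogeneous_mult:
  fixes x y :: "'g palg"
  assumes "x \<in> homogeneous p" "y \<in> homogeneous q"
  shows "x * y \<in> homogeneous (p + q)"
proof -
  have "(\<Prod>g\<leftarrow>u. gen g) * y \<in> homogeneous (p + q)" if "word_parity u = p" for u :: "'g list"
  proof (rule plin_span_in[where L = "\<lambda>y. (\<Prod>g\<leftarrow>u. gen g) * y", OF _ _ homogeneous_subspace])
    show "plin (\<lambda>y. (\<Prod>g\<leftarrow>u. gen g) * y)" by (simp add: plin_iff distrib_left pscale_mult_right)
    show "y \<in> palg.span {\<Prod>g\<leftarrow>w. gen g | w. word_parity w = q}"
      using assms(2) by (simp add: homogeneous_eq_span)
    fix z assume "z \<in> {\<Prod>g\<leftarrow>w. gen g :: 'g palg | w. word_parity w = q}"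
    then obtain w where "z = (\<Prod>g\<leftarrow>w. gen g)" "word_parity w = q" by blast
    then have "(\<Prod>g\<leftarrow>u. gen g) * z = (\<Prod>g\<leftarrow>u @ w. gen g)" "word_parity (u @ w) = p + q"
      by (simp_all add: word_parity_append that)
    then show "(\<Prod>g\<leftarrow>u. gen g) * z \<in> homogeneous (p + q)"
      unfolding homogeneous_eq_span by (intro palg.span_base) blast
  qed
  then show ?thesis
    by (intro plin_span_in[where L="\<lambda>x. x * y", OF _ assms(1)[unfolded homogeneous_eq_span] homogeneous_subspace])
      (auto simp: plin_iff distrib_right pscale_mult_left)
qed

lemma part_eq:
  fixes x y z :: "'g palg"
  assumes "x = y + z" "y \<in> homogeneous p" "z \<in> homogeneous (p + 1)"
  shows "part p x = y" "part (p + 1) x = z"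
  using assms by (simp_all add: plin_add[OF part_plin] part_homogeneous[where p=p] part_homogeneous[where p="p+1"])

lemma part_mult:
  fixes x y :: "'g palg"
  shows "part 0 (x * y) = part 0 x * part 0 y + part 1 x * part 1 y" (is "_ = ?e")
    "part 1 (x * y) = part 0 x * part 1 y + part 1 x * part 0 y" (is "_ = ?o")
proof -
  note h = homogeneous_mult[OF part_in_homogeneous[of _ x] part_in_homogeneous[of _ y]]
  have "(part 0 x + part 1 x) * (part 0 y + part 1 y) = ?e + ?o" by (simp add: algebra_simps)
  then have *: "x * y = ?e + ?o" by (simp only: part_add_part)
  have "?e \<in> homogeneous 0" "?o \<in> homogeneous (0 + 1)"
    using h[of 0 0] h[of 1 1] h[of 0 1] h[of 1 0] by (simp_all add: homogeneous_closed)
  from part_eq[OF * this] show "part 0 (x * y) = ?e" "part 1 (x * y) = ?o" by simp_all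
qed

lemma parity_inv_plin: "plin (parity_inv :: 'g palg \<Rightarrow> _)"
  using part_plin unfolding plin_iff parity_inv_def by (simp add: algebra_simps palg.scale_right_diff_distrib)

lemma parity_inv_mult: "parity_inv (x * y) = parity_inv x * parity_inv (y :: 'g palg)"
  by (simp add: parity_inv_def part_mult algebra_simps)

lemma parity_inv_homogeneous:
  assumes "x \<in> homogeneous p"
  shows "parity_inv x = (if p = 0 then x else - (x :: 'g palg))"
  using assms by (cases p) (simp_all add: parity_inv_def part_homogeneous)

lemma one_homogeneous: "(1 :: 'g palg) \<in> homogeneous 0"
  unfolding homogeneous_eq_span
  by (rule palg.span_base) (auto simp: word_parity_def intro!: exI[of _ "[]"])

lemma gen_homogeneous: "gen (g :: 'g) \<in> homogeneous (gen_parity g)"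
  unfolding homogeneous_eq_span
  by (rule palg.span_base) (auto simp: word_parity_def intro!: exI[of _ "[g]"])

lemma part_part: "part p (part q x) = (if p = q then part q x else (0 :: 'g palg))"
  by (simp add: part_homogeneous[OF part_in_homogeneous])

lemma parity_inv_involution: "parity_inv (parity_inv x) = (x :: 'g palg)"
  using part_add_part[of x]
  by (simp add: parity_inv_def plin_diff[OF part_plin] part_part)

end

section \<open>Tensor powers\<close>

text \<open>Both scalar multiplications are parameters: the notion serves lists of algebra elements
  as well as lists of sequences indexed by the degree.\<close>

definition multilinear ::
  "(qfield \<Rightarrow> 'a \<Rightarrow> 'a::ab_group_add) \<Rightarrow> (qfield \<Rightarrow> 'v \<Rightarrow> 'v::ab_group_add) \<Rightarrow> ('a list \<Rightarrow> 'v) \<Rightarrow> bool"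
  where "multilinear sa sc f \<longleftrightarrow>
    (\<forall>xs ys x y. f (xs @ (x + y) # ys) = f (xs @ x # ys) + f (xs @ y # ys)) \<and>
    (\<forall>xs ys c x. f (xs @ sa c x # ys) = sc c (f (xs @ x # ys)))"

lemma multilinear_add:
    "multilinear sa sc f \<Longrightarrow> f (xs @ (x + y) # ys) = f (xs @ x # ys) + f (xs @ y # ys)"
  and multilinear_scale: "multilinear sa sc f \<Longrightarrow> f (xs @ sa c x # ys) = sc c (f (xs @ x # ys))"
  by (simp_all add: multilinear_def)

text \<open>Slots are reduced from spans to generators one after the other, from the left.\<close>

lemma multilinear_span:
  assumes sa: "vector_space sa" and sc: "vector_space sc" and f: "multilinear sa sc f"
    and T: "module.subspace sc T"
    and xs: "list_all2 (\<lambda>x S. x \<in> module.span sa S) xs Ss"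
    and gens: "\<And>ys. list_all2 (\<in>) ys Ss \<Longrightarrow> f ys \<in> T"
  shows "f xs \<in> T"
proof -
  interpret a: vector_space sa by (rule sa)
  interpret c: vector_space sc by (rule sc)
  \<comment> \<open>The prefix \<open>us\<close> collects the slots already replaced by generators;
    the induction needs it to be arbitrary.\<close>
  have "f (us @ xs) \<in> T" if "\<And>ys. list_all2 (\<in>) ys Ss \<Longrightarrow> f (us @ ys) \<in> T" for us
    using xs that
  proof (induction arbitrary: us rule: list_all2_induct)
    case (Cons x xs S Ss)
    have *: "f (us @ y # xs) \<in> T" if "y \<in> S" for y
      using Cons.IH[of "us @ [y]"] Cons.prems[of "y # _"] that by simp
    have zero: "f (us @ 0 # xs) = 0"
      using multilinear_scale[OF f, of us 0 0 xs] by simp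
    show ?case using Cons.hyps(1)
      by (induction rule: a.span_induct_alt)
        (simp_all add: zero multilinear_add[OF f] multilinear_scale[OF f] c.subspace_0[OF T]
          c.subspace_add[OF T] c.subspace_scale[OF T] *)
  qed simp
  from this[of "[]"] show ?thesis using gens by simp
qed

lemma tens_Nil [simp]: "tens [] = 1"
  by (simp add: tens_def)

lemma tens_append: "tens (xs @ ys) = tens xs * tens ys"
  by (simp add: tens_def)

lemma tens_Cons: "tens (x # xs) = tens [x] * tens xs"
  by (simp add: tens_def)

lemma abs_palg_rel: "r \<in> rels \<Longrightarrow> abs_palg r = 0"
  by (simp add: abs_palg_eq_0 rel_in_ideal)

lemma tens_single_plin: "plin (\<lambda>x. tens [x])"
proof -
  have *: "abs_palg \<langle>Vec (x + y)\<rangle> = abs_palg \<langle>Vec x\<rangle> + abs_palg \<langle>Vec y\<rangle>"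
    "abs_palg \<langle>Vec (c \<cdot> x)\<rangle> = c \<cdot> abs_palg \<langle>Vec x\<rangle>" for x y :: "'a palg" and c
  proof -
    have "abs_palg (\<langle>Vec (x + y)\<rangle> - \<langle>Vec x\<rangle> - \<langle>Vec y\<rangle>) = 0" "abs_palg (\<langle>Vec (c \<cdot> x)\<rangle> - c *\<^sub>f \<langle>Vec x\<rangle>) = 0"
      by (rule abs_palg_rel, force simp: rels_vec_letter_def)+
    then show "abs_palg \<langle>Vec (x + y)\<rangle> = abs_palg \<langle>Vec x\<rangle> + abs_palg \<langle>Vec y\<rangle>"
      "abs_palg \<langle>Vec (c \<cdot> x)\<rangle> = c \<cdot> abs_palg \<langle>Vec x\<rangle>"
      by (simp_all add: minus_palg.abs_eq[symmetric] plus_palg.abs_eq[symmetric] pscale.abs_eq[symmetric]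
          diff_diff_eq)
  qed
  then show ?thesis by (simp add: plin_iff tens_def gen_def)
qed

lemma tens_multilinear: "multilinear pscale pscale tens"
proof -
  have "tens (xs @ x # ys) = tens xs * (tens [x] * tens ys)" for xs ys and x :: "'a palg"
    by (metis tens_append tens_Cons)
  then show ?thesis unfolding multilinear_def
    by (simp add: plin_add[OF tens_single_plin] plin_scale[OF tens_single_plin] algebra_simps
      pscale_mult_left pscale_mult_right)
qed

lemma tens_span: "t \<in> palg.span (range tens)"
proof -
  have "range (\<lambda>w :: 'a vec_letter list. \<Prod>g\<leftarrow>w. gen g) \<subseteq> range tens"
  proof clarify
    fix w :: "'a vec_letter list"
    have "(\<Prod>g\<leftarrow>w. gen g) = tens (map (case_vec_letter id) w)"
      by (induction w) (auto simp: tens_def split: vec_letter.splits)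
    then show "(\<Prod>g\<leftarrow>w. gen g) \<in> range tens" by simp
  qed
  then show ?thesis using palg_word_span[of t] palg.span_mono by blast
qed

text \<open>The relations among the letters \<open>Vec x\<close> say precisely that words of letters
  are linear in each position, so multilinearity of \<open>f\<close> is the condition that
  \<open>palg_ext\<close> requires.\<close>

lemma tensor_ext:
  fixes f :: "'g::presented palg list \<Rightarrow> 'v::ab_group_add"
  assumes vs: "vector_space sc" and f: "multilinear pscale sc f"
  obtains L where "Vector_Spaces.linear pscale sc L" "\<And>xs. L (tens xs) = f xs"
proof -
  define f' where "f' w = f (map (case_vec_letter id) w)" for w
  have w: "Poly_Mapping.single u 1 * \<langle>g\<rangle> * Poly_Mapping.single w 1 = Poly_Mapping.single (u @ g # w) 1"
    for g :: "'g vec_letter" and u w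
    by (simp add: letter_def mult_single plus_list_def)
  have "free_ext sc f' (Poly_Mapping.single u 1 * r * Poly_Mapping.single w 1) = 0"
    if "r \<in> rels" for r u w
    using that unfolding rels_vec_letter_def
  proof (elim UnE CollectE exE conjE)
    fix x y :: "'g palg"
    assume r: "r = \<langle>Vec (x + y)\<rangle> - \<langle>Vec x\<rangle> - \<langle>Vec y\<rangle>"
    show ?thesis unfolding r right_diff_distrib left_diff_distrib w
      by (simp add: free_ext_diff[OF vs] free_ext_single[OF vs] vector_space.vector_space_assms[OF vs]
         f'_def multilinear_add[OF f])
  next
    fix c and x :: "'g palg"
    assume r: "r = \<langle>Vec (c \<cdot> x)\<rangle> - c *\<^sub>f \<langle>Vec x\<rangle>"
    have "Poly_Mapping.single u 1 * (c *\<^sub>f \<langle>Vec x\<rangle>) * Poly_Mapping.single w 1 =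
        c *\<^sub>f (Poly_Mapping.single u 1 * \<langle>Vec x\<rangle> * Poly_Mapping.single w 1)"
      by (simp add: fscale_def mult.assoc[symmetric] mult_single plus_list_def)
    then show ?thesis unfolding r right_diff_distrib left_diff_distrib w
      by (simp add: free_ext_diff[OF vs] free_ext_single[OF vs] free_ext_fscale[OF vs] vector_space.vector_space_assms[OF vs]
         f'_def multilinear_scale[OF f] w)
  qed
  note * = this
  show thesis
  proof (rule palg_ext[OF vs *])
    fix L assume L: "Vector_Spaces.linear pscale sc L" "\<And>w. L (\<Prod>g\<leftarrow>w. gen g) = f' w"
    have "L (tens xs) = f xs" for xs
      using L(2)[of "map Vec xs"] by (simp add: tens_def f'_def comp_def)
    then show thesis by (rule that[OF L(1)])
  qed
qed

lemma tensor_lift_spec: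
  assumes "multilinear pscale pscale f"
  shows "plin (tensor_lift f) \<and> (\<forall>xs. tensor_lift f (tens xs) = f xs)"
proof -
  obtain L where L: "plin L" "\<And>xs. L (tens xs) = f xs"
    using tensor_ext[OF palg.vector_space_axioms assms] by blast
  show ?thesis unfolding tensor_lift_def
  proof (rule theI[of _ L])
    show "plin L \<and> (\<forall>xs. L (tens xs) = f xs)" using L by simp
    fix M assume M: "plin M \<and> (\<forall>xs. M (tens xs) = f xs)"
    show "M = L"
      by (rule ext, rule plin_span_eq[OF _ L(1) tens_span]) (use L M in auto)
  qed
qed

lemmas tensor_lift_plin = tensor_lift_spec[THEN conjunct1]
lemmas tensor_lift_tens = tensor_lift_spec[THEN conjunct2, rule_format]

lemma plin_eqI:
  assumes "plin L" "plin L'" "\<And>xs. L (tens xs) = L' (tens xs)"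
  shows "L t = L' t"
  by (rule plin_span_eq[OF assms(1,2) tens_span]) (use assms(3) in auto)

definition bilinear :: "('a::presented palg \<Rightarrow> 'b::presented palg \<Rightarrow> 'c::presented palg) \<Rightarrow> bool"
  where "bilinear f \<longleftrightarrow> (\<forall>y. plin (\<lambda>x. f x y)) \<and> (\<forall>x. plin (f x))"

text \<open>The default 0 on lists of length other than two is compatible with multilinearity, which
  only compares lists of equal length.\<close>

lemma pair_multilinear:
  assumes "bilinear f"
  shows "multilinear pscale pscale (\<lambda>xs. case xs of [x, y] \<Rightarrow> f x y | _ \<Rightarrow> 0)"
proof -
  have *: "f (x + x') y = f x y + f x' y" "f (c \<cdot> x) y = c \<cdot> f x y"
    "f x (y + y') = f x y + f x y'" "f x (c \<cdot> y) = c \<cdot> f x y" for x x' y y' c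
    using assms by (simp_all add: bilinear_def plin_iff)
  have "(case xs @ x # ys of [x, y] \<Rightarrow> f x y | _ \<Rightarrow> 0) =
      (if length xs = 0 \<and> length ys = 1 then f x (hd ys) else if length xs = 1 \<and> length ys = 0 then f (hd xs) x else 0)"
    for xs ys x
    by (cases xs; cases "tl xs"; cases ys; cases "tl ys") (auto split: list.splits)
  then show ?thesis unfolding multilinear_def by (auto simp: *)
qed

lemma pair_lift_plin: "bilinear f \<Longrightarrow> plin (pair_lift f)"
  and pair_lift_tens: "bilinear f \<Longrightarrow> pair_lift f (tens [x, y]) = f x y"
  unfolding pair_lift_def
  by (simp_all add: tensor_lift_plin tensor_lift_tens pair_multilinear)

lemma tensor_power_2_eqI:
  assumes "plin L" "plin L'" "t \<in> tensor_power 2" "\<And>x y. L (tens [x, y]) = L' (tens [x, y])"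
  shows "L t = L' t"
  by (rule plin_span_eq[OF assms(1,2) assms(3)[unfolded tensor_power_def]])
    (auto simp: assms(4) numeral_2_eq_2 length_Suc_conv)

section \<open>The action on tensor powers\<close>

lemma parity_inv_one [simp]: "parity_inv (1 :: 'g::hom_presented palg) = 1"
  by (simp add: parity_inv_homogeneous[OF one_homogeneous])

locale super_action =
  fixes \<rho> :: "'g::hom_presented palg \<Rightarrow> 'h::hom_presented palg \<Rightarrow> 'h palg"
  assumes super: "is_supermodule pscale \<rho> UNIV homogeneous"
begin

lemma act_plin: "plin (\<rho> u)" and act_plin': "plin (\<lambda>u. \<rho> u x)"
  and act_mult: "\<rho> (u * w) x = \<rho> u (\<rho> w x)" and act_one: "\<rho> 1 x = x"
  using super by (simp_all add: is_supermodule_def is_module_def plin_iff)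

lemma act_homogeneous: "u \<in> homogeneous p \<Longrightarrow> x \<in> homogeneous q \<Longrightarrow> \<rho> u x \<in> homogeneous (p + q)"
  using super by (simp add: is_supermodule_def)

lemmas lin = plin_add[OF act_plin] plin_scale[OF act_plin] plin_add[OF act_plin'] plin_scale[OF act_plin']
  plin_zero[OF act_plin] plin_zero[OF act_plin']
  plin_add[OF part_plin] plin_scale[OF part_plin] plin_zero[OF part_plin]
  plin_add[OF tens_single_plin] plin_scale[OF tens_single_plin] plin_zero[OF tens_single_plin]
  plin_add[OF parity_inv_plin] plin_scale[OF parity_inv_plin]
  distrib_left distrib_right pscale_mult_left pscale_mult_right palg.scale_right_distrib

lemma part_act:
  shows "part 0 (\<rho> u x) = \<rho> (part 0 u) (part 0 x) + \<rho> (part 1 u) (part 1 x)" (is "_ = ?e")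
    and "part 1 (\<rho> u x) = \<rho> (part 0 u) (part 1 x) + \<rho> (part 1 u) (part 0 x)" (is "_ = ?o")
proof -
  note h = act_homogeneous[OF part_in_homogeneous[of _ u] part_in_homogeneous[of _ x]]
  have "\<rho> (part 0 u + part 1 u) (part 0 x + part 1 x) = ?e + ?o" by (simp add: lin)
  then have *: "\<rho> u x = ?e + ?o" by (simp only: part_add_part)
  have "?e \<in> homogeneous 0" "?o \<in> homogeneous (0 + 1)"
    using h[of 0 0] h[of 1 1] h[of 0 1] h[of 1 0] by (simp_all add: homogeneous_closed)
  from part_eq[OF * this] show "part 0 (\<rho> u x) = ?e" "part 1 (\<rho> u x) = ?o" by simp_all
qed

lemma word_act_Nil_right: "word_act \<rho> gs [] = (if gs = [] then 1 else 0)"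
  by (cases gs) simp_all

lemma word_act_multilinear: "multilinear pscale pscale (word_act \<rho> gs)"
proof -
  have "word_act \<rho> gs (xs @ (x + y) # ys) = word_act \<rho> gs (xs @ x # ys) + word_act \<rho> gs (xs @ y # ys)" for xs x y ys
  proof (induction xs arbitrary: gs)
    case Nil
    show ?case by (cases gs) (simp_all add: lin)
  next
    case (Cons z xs)
    show ?case by (cases gs) (simp_all add: lin Cons)
  qed
  moreover have "word_act \<rho> gs (xs @ (c \<cdot> x) # ys) = c \<cdot> word_act \<rho> gs (xs @ x # ys)" for xs c x ys
  proof (induction xs arbitrary: gs)
    case Nil
    show ?case by (cases gs) (simp_all add: lin)
  next
    case (Cons z xs)
    show ?case by (cases gs) (simp_all add: lin Cons)
  qed
  ultimately show ?thesis by (simp add: multilinear_def)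
qed

lemma word_act_multilinear': "multilinear pscale pscale (\<lambda>gs. word_act \<rho> gs vs)"
proof -
  have "word_act \<rho> (xs @ (x + y) # ys) vs = word_act \<rho> (xs @ x # ys) vs + word_act \<rho> (xs @ y # ys) vs" for xs x y ys
  proof (induction vs arbitrary: xs ys x y)
    case (Cons v vs)
    show ?case by (cases xs) (simp_all add: lin Cons)
  qed (simp add: word_act_Nil_right)
  moreover have "word_act \<rho> (xs @ (c \<cdot> x) # ys) vs = c \<cdot> word_act \<rho> (xs @ x # ys) vs" for xs c x ys
  proof (induction vs arbitrary: xs ys x)
    case (Cons v vs)
    show ?case by (cases xs) (simp_all add: lin Cons)
  qed (simp add: word_act_Nil_right)
  ultimately show ?thesis by (simp add: multilinear_def)
qed

text \<open>\<open>tensor_act\<close> is this map at the iterated comultiplication. Keeping the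
  acting tensor as a free argument makes linearity in it available.\<close>

definition tact :: "'g tensor \<Rightarrow> 'h tensor \<Rightarrow> 'h tensor"
  where "tact s t = tensor_lift (\<lambda>gs. tensor_lift (word_act \<rho> gs) t) s"

lemma tact_multilinear: "multilinear pscale pscale (\<lambda>gs. tensor_lift (word_act \<rho> gs) t)"
  unfolding multilinear_def
proof (intro conjI allI)
  note L = tensor_lift_plin[OF word_act_multilinear] and T = tensor_lift_tens[OF word_act_multilinear]
  fix xs ys and x y :: "'g palg" and c
  show "tensor_lift (word_act \<rho> (xs @ (x + y) # ys)) t =
      tensor_lift (word_act \<rho> (xs @ x # ys)) t + tensor_lift (word_act \<rho> (xs @ y # ys)) t"
    by (rule plin_eqI[OF L, where L' = "\<lambda>t. tensor_lift (word_act \<rho> (xs @ x # ys)) t + tensor_lift (word_act \<rho> (xs @ y # ys)) t"])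
      (use L in \<open>simp_all add: plin_iff T lin multilinear_add[OF word_act_multilinear']\<close>)
  show "tensor_lift (word_act \<rho> (xs @ (c \<cdot> x) # ys)) t = c \<cdot> tensor_lift (word_act \<rho> (xs @ x # ys)) t"
    by (rule plin_eqI[OF L, where L' = "\<lambda>t. c \<cdot> tensor_lift (word_act \<rho> (xs @ x # ys)) t"])
      (use L in \<open>simp_all add: plin_iff T lin mult.commute multilinear_scale[OF word_act_multilinear']\<close>)
qed

lemma tact_tens: "tact (tens gs) (tens vs) = word_act \<rho> gs vs"
  unfolding tact_def tensor_lift_tens[OF tact_multilinear] by (rule tensor_lift_tens[OF word_act_multilinear])

lemma tact_plin': "plin (\<lambda>s. tact s t)"
  unfolding tact_def by (rule tensor_lift_plin[OF tact_multilinear])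

lemma tact_plin: "plin (tact s)"
proof -
  have T: "tact (tens gs) t = tensor_lift (word_act \<rho> gs) t" for gs t
    by (simp add: tact_def tensor_lift_tens[OF tact_multilinear])
  note L = tensor_lift_plin[OF word_act_multilinear]
  have "tact s (x + y) = tact s x + tact s y" for x y
    by (rule plin_eqI[OF tact_plin', where L' = "\<lambda>s. tact s x + tact s y"])
      (use tact_plin' L in \<open>simp_all add: plin_iff T lin\<close>)
  moreover have "tact s (c \<cdot> x) = c \<cdot> tact s x" for c x
    by (rule plin_eqI[OF tact_plin', where L' = "\<lambda>s. c \<cdot> tact s x"])
      (use tact_plin' L in \<open>simp_all add: plin_iff T lin mult.commute\<close>)
  ultimately show ?thesis by (simp add: plin_iff)
qed

text \<open>The parity automorphism of the tensor algebra: by the sign rule this is what the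
  remaining factors undergo when they pass an odd vector.\<close>

definition tinv :: "'g tensor \<Rightarrow> 'g tensor"
  where "tinv = tensor_lift (\<lambda>gs. tens (map parity_inv gs))"

lemma tinv_multilinear: "multilinear pscale pscale (\<lambda>gs. tens (map parity_inv gs :: 'g palg list))"
  using multilinear_add[OF tens_multilinear] multilinear_scale[OF tens_multilinear]
  by (auto simp: multilinear_def lin)

lemmas tinv_plin = tensor_lift_plin[OF tinv_multilinear, folded tinv_def]
lemmas tinv_tens = tensor_lift_tens[OF tinv_multilinear, folded tinv_def]

lemma tinv_mult: "tinv (s * t) = tinv s * tinv t"
proof (rule plin_eqI[where L = "\<lambda>s. tinv (s * t)" and L' = "\<lambda>s. tinv s * tinv t"])
  fix xs
  show "tinv (tens xs * t) = tinv (tens xs) * tinv t"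
    by (rule plin_eqI[where L = "\<lambda>t. tinv (tens xs * t)" and L' = "\<lambda>t. tinv (tens xs) * tinv t"])
      (use tinv_plin in \<open>simp_all add: plin_iff lin tinv_tens tens_append[symmetric]\<close>)
qed (use tinv_plin in \<open>simp_all add: plin_iff lin\<close>)

text \<open>The recursion of \<open>word_act\<close> persists for arbitrary tensors in place of the
  remaining words, since both sides are linear in \<open>s\<close> and in \<open>t\<close>.\<close>

lemma tact_Cons:
  "tact (tens [a] * s) (tens [v] * t) =
    tens [\<rho> a (part 0 v)] * tact s t + tens [\<rho> a (part 1 v)] * tact (tinv s) t"
proof (rule plin_eqI[where L = "\<lambda>s. tact (tens [a] * s) (tens [v] * t)" and
      L' = "\<lambda>s. tens [\<rho> a (part 0 v)] * tact s t + tens [\<rho> a (part 1 v)] * tact (tinv s) t"])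
  fix gs
  show "tact (tens [a] * tens gs) (tens [v] * t) =
      tens [\<rho> a (part 0 v)] * tact (tens gs) t + tens [\<rho> a (part 1 v)] * tact (tinv (tens gs)) t"
    by (rule plin_eqI[where L = "\<lambda>t. tact (tens [a] * tens gs) (tens [v] * t)" and
      L' = "\<lambda>t. tens [\<rho> a (part 0 v)] * tact (tens gs) t + tens [\<rho> a (part 1 v)] * tact (tinv (tens gs)) t"])
      (use tact_plin in \<open>simp_all add: plin_iff lin tens_append[symmetric] tact_tens tinv_tens algebra_simps\<close>)
qed (use tact_plin' tinv_plin in \<open>simp_all add: plin_iff lin algebra_simps\<close>)

text \<open>On a homogeneous entry \<open>parity_inv\<close> is a sign, which multilinearity pulls
  out. The product \<delta> of the signs is fixed before \<open>f\<close> and \<open>xs\<close>,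
  because the induction moves the head entry into the prefix.\<close>

lemma multilinear_parity_inv:
  fixes gs :: "'g palg list"
  assumes "list_all2 (\<lambda>g p. g \<in> homogeneous p) gs ps"
  shows "\<exists>\<delta>. \<forall>f :: 'g palg list \<Rightarrow> 'h tensor. multilinear pscale pscale f \<longrightarrow>
    (\<forall>xs. f (xs @ map parity_inv gs) = \<delta> \<cdot> f (xs @ gs))"
  using assms
proof (induction rule: list_all2_induct)
  case Nil
  then show ?case by (intro exI[of _ 1]) simp
next
  case (Cons g gs p ps)
  then obtain \<delta> where d: "\<And>(f :: 'g palg list \<Rightarrow> 'h tensor) xs. multilinear pscale pscale f \<Longrightarrow>
    f (xs @ map parity_inv gs) = \<delta> \<cdot> f (xs @ gs)" by blast
  define c :: qfield where "c = (if p = 0 then 1 else - 1)"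
  have "parity_inv g = c \<cdot> g"
    using Cons.hyps(1) by (simp add: parity_inv_homogeneous c_def)
  then have "f (xs @ map parity_inv (g # gs)) = (\<delta> * c) \<cdot> f (xs @ g # gs)"
    if "multilinear pscale pscale f" for f :: "'g palg list \<Rightarrow> 'h tensor" and xs
    using d[OF that, of "xs @ [parity_inv g]"] by (simp add: multilinear_scale[OF that])
  then show ?case by blast
qed

text \<open>The signs depend on the vectors through their parities only, so \<epsilon> is chosen
  before \<open>vs\<close>. This order of quantifiers later allows one sign to be pulled out of a
  sum over pure tensors of equal parities.\<close>

lemma word_act_homogeneous:
  assumes "list_all2 (\<lambda>g p. g \<in> homogeneous p) gs ps" "length qs = length ps"
  shows "\<exists>\<epsilon>. \<forall>vs. list_all2 (\<lambda>v q. v \<in> homogeneous q) vs qs \<longrightarrow>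
    word_act \<rho> gs vs = \<epsilon> \<cdot> tens (map2 \<rho> gs vs)"
  using assms
proof (induction arbitrary: qs rule: list_all2_induct)
  case Nil
  then show ?case by (intro exI[of _ 1]) simp
next
  case (Cons g gs p ps)
  then obtain q qs' where qs: "qs = q # qs'" "length qs' = length ps" by (cases qs) auto
  have inv: "list_all2 (\<lambda>g p. g \<in> homogeneous p) (map parity_inv gs) ps"
    using Cons.hyps(2)
    by (simp add: list.rel_map, elim list_all2_mono) (auto simp: parity_inv_homogeneous homogeneous_closed)
  obtain \<epsilon> where e: "\<And>vs. list_all2 (\<lambda>v q. v \<in> homogeneous q) vs qs' \<Longrightarrow>
    word_act \<rho> gs vs = \<epsilon> \<cdot> tens (map2 \<rho> gs vs)"
    using Cons.IH[OF qs(2)] by blast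
  obtain \<delta> where d: "\<And>vs. word_act \<rho> (map parity_inv gs) vs = \<delta> \<cdot> word_act \<rho> gs vs"
  proof -
    from multilinear_parity_inv[OF Cons.hyps(2)] obtain \<delta> where
      "\<And>(f :: 'g palg list \<Rightarrow> 'h tensor) xs. multilinear pscale pscale f \<Longrightarrow>
        f (xs @ map parity_inv gs) = \<delta> \<cdot> f (xs @ gs)" by blast
    from this[OF word_act_multilinear', where xs = "[]"] show thesis by (intro that[of \<delta>]) simp
  qed
  show ?case
  proof (intro exI[of _ "if q = 0 then \<epsilon> else \<delta> * \<epsilon>"] allI impI)
    fix vs :: "'h palg list" assume "list_all2 (\<lambda>v q. v \<in> homogeneous q) vs qs"
    then obtain v vs' where v: "vs = v # vs'" "v \<in> homogeneous q"
      "list_all2 (\<lambda>v q. v \<in> homogeneous q) vs' qs'"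
      by (auto simp: qs list_all2_Cons2)
    then show "word_act \<rho> (g # gs) vs = (if q = 0 then \<epsilon> else \<delta> * \<epsilon>) \<cdot> tens (map2 \<rho> (g # gs) vs)"
      by (cases q) (simp_all add: part_homogeneous[OF v(2)] lin d e tens_Cons[of _ "map2 \<rho> gs vs'"])
  qed
qed

end

section \<open>Iterated comultiplication and the resulting module structure on tensor powers\<close>

lemma pair_lift_tens':
  assumes "bilinear f"
  shows "pair_lift f (tens xs) = (case xs of [x, y] \<Rightarrow> f x y | _ \<Rightarrow> 0)"
  unfolding pair_lift_def by (rule tensor_lift_tens[OF pair_multilinear[OF assms]])

lemma tens_pair: "tens [x, y] = tens [x] * tens [y]"
  by (simp add: tens_def)

lemma bilinear_iff:
  "bilinear f \<longleftrightarrow> (\<forall>x x' y. f (x + x') y = f x y + f x' y) \<and> (\<forall>c x y. f (c \<cdot> x) y = c \<cdot> f x y) \<and>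
    (\<forall>x y y'. f x (y + y') = f x y + f x y') \<and> (\<forall>c x y. f x (c \<cdot> y) = c \<cdot> f x y)"
  by (auto simp: bilinear_def plin_iff)

definition hom_tensor :: "nat \<Rightarrow> bit \<Rightarrow> 'g::super_presented tensor set"
  where "hom_tensor k p = palg.span {tens gs | gs ps.
    length gs = k \<and> list_all2 (\<lambda>g p. g \<in> homogeneous p) gs ps \<and> sum_list ps = p}"

locale super_comodule_action = super_action \<rho>
  for \<rho> :: "'g::hom_presented palg \<Rightarrow> 'h::hom_presented palg \<Rightarrow> 'h palg" +
  fixes \<Delta> :: "'g palg \<Rightarrow> 'g tensor"
  assumes comult_plin: "plin \<Delta>"
    and comult_range: "\<Delta> u \<in> tensor_power 2"
    and comult_homogeneous: "u \<in> homogeneous p \<Longrightarrow> \<Delta> u \<in> tensor2_homogeneous p"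
    and comult_one: "\<Delta> 1 = tens [1, 1]"
    and comult_mult: "\<Delta> (u * w) = \<Delta> u \<star> \<Delta> w"
begin

abbreviation comult_step :: "nat \<Rightarrow> 'g palg \<Rightarrow> 'g palg \<Rightarrow> 'g tensor"
  where "comult_step k a b \<equiv> tens [a] * iter_comult \<Delta> k b"

text \<open>A lift of pairs is linear once the lifted function is bilinear, and that function is
  bilinear once the previous stage is linear; hence the simultaneous induction.\<close>

lemma iter_comult_plin: "plin (iter_comult \<Delta> k)"
  and comult_step_bilinear: "bilinear (comult_step k)"
proof (induction k)
  case 0
  { case 1 show ?case by (simp add: tens_single_plin)
  next
    case 2 show ?case by (simp add: bilinear_iff lin) }
next
  case (Suc k)
  { case 1 show ?case using pair_lift_plin[OF Suc(2)] comult_plin by (simp add: plin_iff)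
    then show "bilinear (comult_step (Suc k))"
      by (simp only: bilinear_iff lin plin_add[OF 1] plin_scale[OF 1]) simp }
qed

text \<open>The comultiplication is even, and \<open>tinv\<close> acts on
  \<open>tensor2_homogeneous p\<close> by the sign of \<open>p\<close>; the claim follows on the
  even and the odd component of \<open>u\<close>.\<close>

lemma comult_parity_inv: "\<Delta> (parity_inv u) = tinv (\<Delta> u)"
proof -
  have *: "tinv s = (if p = 0 then s else - s)" if "s \<in> tensor2_homogeneous p" for s p
    using that unfolding tensor2_homogeneous_def
  proof (rule plin_span_eq[OF tinv_plin, rotated])
    show "plin (\<lambda>s :: 'g tensor. if p = 0 then s else - s)" by (simp add: plin_iff)
    fix y :: "'g tensor"
    assume "y \<in> {tens [a, b] |a b q r. a \<in> homogeneous q \<and> b \<in> homogeneous r \<and> q + r = p}"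
    then obtain a b q r where y: "y = tens [a, b]" "a \<in> homogeneous q" "b \<in> homogeneous r" "q + r = p"
      by blast
    have neg: "tens [- c] = - tens [c]" for c :: "'g palg"
      using plin_scale[OF tens_single_plin, of "- 1" c] by simp
    have "tinv y = tens [parity_inv a] * tens [parity_inv b]"
      unfolding y tinv_tens by (simp add: tens_pair)
    also have "\<dots> = (if p = 0 then tens [a] * tens [b] else - (tens [a] * tens [b]))"
      using y(4) by (cases q; cases r) (auto simp: parity_inv_homogeneous[OF y(2)] parity_inv_homogeneous[OF y(3)] neg)
    finally show "tinv y = (if p = 0 then y else - y)"
      unfolding y(1) tens_pair .
  qed
  have "\<Delta> (parity_inv u) = \<Delta> (part 0 u) - \<Delta> (part 1 u)"
    by (simp add: parity_inv_def plin_diff[OF comult_plin])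
  also have "\<dots> = tinv (\<Delta> (part 0 u)) + tinv (\<Delta> (part 1 u))"
    by (simp add: *[OF comult_homogeneous[OF part_in_homogeneous]])
  also have "\<dots> = tinv (\<Delta> (part 0 u + part 1 u))"
    by (simp only: plin_add[OF tinv_plin] plin_add[OF comult_plin])
  finally show ?thesis by (simp only: part_add_part)
qed

lemma iter_comult_parity_inv: "iter_comult \<Delta> k (parity_inv u) = tinv (iter_comult \<Delta> k u)"
proof (induction k arbitrary: u)
  case 0
  show ?case by (simp add: tinv_tens)
next
  case (Suc k)
  note B = pair_lift_plin[OF comult_step_bilinear[of k]] and T = pair_lift_tens[OF comult_step_bilinear[of k]]
  have "tinv (pair_lift (comult_step k) (\<Delta> u)) = pair_lift (comult_step k) (tinv (\<Delta> u))"
    by (rule tensor_power_2_eqI[OF _ _ comult_range, where L = "\<lambda>s. tinv (pair_lift (comult_step k) s)"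
          and L' = "\<lambda>s. pair_lift (comult_step k) (tinv s)"])
      (use B tinv_plin in \<open>simp_all add: plin_iff T tinv_tens tinv_mult Suc\<close>)
  then show ?case by (simp add: comult_parity_inv)
qed

text \<open>As in \<open>iter_comult\<close>, the index is one less than the number of tensor
  factors; \<open>tensor_act\<close> is the case \<open>k = CARD('n) - 1\<close>.\<close>

definition pow_act :: "nat \<Rightarrow> 'g palg \<Rightarrow> 'h tensor \<Rightarrow> 'h tensor"
  where "pow_act k u t = tact (iter_comult \<Delta> k u) t"

lemma pow_act_plin: "plin (pow_act k u)"
  unfolding pow_act_def using tact_plin by (simp add: plin_iff)

lemma pow_act_plin': "plin (\<lambda>u. pow_act k u t)"
  unfolding pow_act_def using tact_plin' iter_comult_plin[of k] by (simp add: plin_iff)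

lemmas plin2 = plin_add[OF pow_act_plin] plin_scale[OF pow_act_plin]
  plin_add[OF pow_act_plin'] plin_scale[OF pow_act_plin']

text \<open>The action of a \<otimes> b on v \<otimes> t, where b acts through its own iterated
  coproduct and is twisted on passing the odd part of v.\<close>

definition pair_act :: "nat \<Rightarrow> 'h palg \<Rightarrow> 'h tensor \<Rightarrow> 'g palg \<Rightarrow> 'g palg \<Rightarrow> 'h tensor"
  where "pair_act k v t a b = tens [\<rho> a (part 0 v)] * pow_act k b t +
    tens [\<rho> a (part 1 v)] * pow_act k (parity_inv b) t"

lemma pair_act_bilinear: "bilinear (pair_act k v t)"
  by (simp add: bilinear_iff pair_act_def lin plin2)

text \<open>By \<open>iter_comult_parity_inv\<close>, twisting the iterated coproduct of b is the
  same as twisting b beforehand, which turns \<open>tact_Cons\<close> into a recursion for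
  \<open>pow_act\<close>.\<close>

lemma pow_act_Suc: "pow_act (Suc k) u (tens [v] * t) = pair_lift (pair_act k v t) (\<Delta> u)"
proof -
  note B = pair_lift_plin[OF comult_step_bilinear[of k]] and T = pair_lift_tens[OF comult_step_bilinear[of k]]
  have "tact (pair_lift (comult_step k) (\<Delta> u)) (tens [v] * t) = pair_lift (pair_act k v t) (\<Delta> u)"
    by (rule tensor_power_2_eqI[OF _ pair_lift_plin[OF pair_act_bilinear] comult_range,
          where L = "\<lambda>s. tact (pair_lift (comult_step k) s) (tens [v] * t)"])
      (use B tact_plin' in \<open>simp_all add: plin_iff T tact_Cons pair_lift_tens[OF pair_act_bilinear]
        pair_act_def pow_act_def iter_comult_parity_inv\<close>)
  then show ?thesis by (simp add: pow_act_def)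
qed

lemma tensor_power_Suc_induct:
  assumes "plin L" "plin L'" "t \<in> tensor_power (Suc k)"
    "\<And>v t. t \<in> tensor_power k \<Longrightarrow> L (tens [v] * t) = L' (tens [v] * t)"
  shows "L t = L' t"
proof (rule plin_span_eq[OF assms(1,2) assms(3)[unfolded tensor_power_def]])
  fix y assume "y \<in> tens ` {xs :: 'a palg list. length xs = Suc k}"
  then obtain x xs where y: "y = tens (x # xs)" "length xs = k" by (auto simp: length_Suc_conv)
  then have "tens xs \<in> tensor_power k" by (simp add: tensor_power_def palg.span_base)
  from assms(4)[OF this, of x] show "L y = L' y" by (simp add: y tens_Cons[of x xs])
qed

lemma pow_act_one: "t \<in> tensor_power (Suc k) \<Longrightarrow> pow_act k 1 t = t"
proof (induction k arbitrary: t)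
  case 0
  show ?case
  proof (rule tensor_power_Suc_induct[OF pow_act_plin _ 0])
    fix v :: "'h palg" and t :: "'h tensor"
    assume "t \<in> tensor_power 0"
    \<comment> \<open>The tensor power of exponent 0 consists of the scalars.\<close>
    then obtain c where t: "t = c \<cdot> 1"
      by (auto simp: tensor_power_def palg.span_singleton)
    have "pow_act 0 1 (tens [v]) = tens [v]"
      by (simp add: pow_act_def tact_tens act_one plin_add[OF tens_single_plin, symmetric] part_add_part)
    then show "pow_act 0 1 (tens [v] * t) = tens [v] * t"
      by (simp add: t lin plin2)
  qed (simp add: plin_iff)
next
  case (Suc k)
  show ?case
  proof (rule tensor_power_Suc_induct[OF pow_act_plin _ Suc.prems])
    fix v :: "'h palg" and t :: "'h tensor"
    assume "t \<in> tensor_power (Suc k)"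
    from Suc.IH[OF this] show "pow_act (Suc k) 1 (tens [v] * t) = tens [v] * t"
      by (simp add: pow_act_Suc comult_one pair_lift_tens[OF pair_act_bilinear] pair_act_def act_one
        distrib_right[symmetric] plin_add[OF tens_single_plin, symmetric] part_add_part)
  qed (simp add: plin_iff)
qed

text \<open>The product of two pure tensors in U \<otimes> U. The nested lifts in
  \<open>tensor2_mult\<close> can be evaluated once this expression is known to be linear in each of
  its four arguments.\<close>

definition smult4 :: "'g palg \<Rightarrow> 'g palg \<Rightarrow> 'g palg \<Rightarrow> 'g palg \<Rightarrow> 'g tensor"
  where "smult4 a b c d = tens [a * part 0 c, b * d] + tens [a * part 1 c, parity_inv b * d]"

lemma smult4_bilinear: "bilinear (smult4 a b)"
  and smult4_lin: "smult4 (a + a') b c d = smult4 a b c d + smult4 a' b c d"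
    "smult4 (k \<cdot> a) b c d = k \<cdot> smult4 a b c d"
    "smult4 a (b + b') c d = smult4 a b c d + smult4 a b' c d"
    "smult4 a (k \<cdot> b) c d = k \<cdot> smult4 a b c d"
  unfolding bilinear_iff smult4_def tens_pair by (simp_all add: lin)

lemma pair_lift_add:
  assumes "bilinear f" "bilinear g"
  shows "pair_lift (\<lambda>a b. f a b + g a b) t = pair_lift f t + pair_lift g t"
proof (rule plin_eqI[where L' = "\<lambda>t. pair_lift f t + pair_lift g t"])
  have h: "bilinear (\<lambda>a b. f a b + g a b)"
    using assms by (simp add: bilinear_iff palg.scale_right_distrib)
  show "plin (pair_lift (\<lambda>a b. f a b + g a b))" by (rule pair_lift_plin[OF h])
  show "plin (\<lambda>t. pair_lift f t + pair_lift g t)"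
    using pair_lift_plin[OF assms(1)] pair_lift_plin[OF assms(2)]
    by (simp add: plin_iff palg.scale_right_distrib)
  show "pair_lift (\<lambda>a b. f a b + g a b) (tens xs) = pair_lift f (tens xs) + pair_lift g (tens xs)" for xs
    unfolding pair_lift_tens'[OF h] pair_lift_tens'[OF assms(1)] pair_lift_tens'[OF assms(2)]
    by (simp split: list.splits)
qed

lemma pair_lift_scale:
  assumes "bilinear f"
  shows "pair_lift (\<lambda>a b. c \<cdot> f a b) t = c \<cdot> pair_lift f t"
proof (rule plin_eqI[where L' = "\<lambda>t. c \<cdot> pair_lift f t"])
  have h: "bilinear (\<lambda>a b. c \<cdot> f a b)"
    using assms by (simp add: bilinear_iff palg.scale_right_distrib mult.commute)
  show "plin (pair_lift (\<lambda>a b. c \<cdot> f a b))" by (rule pair_lift_plin[OF h])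
  show "plin (\<lambda>t. c \<cdot> pair_lift f t)"
    using pair_lift_plin[OF assms] by (simp add: plin_iff palg.scale_right_distrib mult.commute)
  show "pair_lift (\<lambda>a b. c \<cdot> f a b) (tens xs) = c \<cdot> pair_lift f (tens xs)" for xs
    unfolding pair_lift_tens'[OF h] pair_lift_tens'[OF assms] by (simp split: list.splits)
qed

lemma smult4_bilinear': "bilinear (\<lambda>a b. pair_lift (smult4 a b) t)"
  unfolding bilinear_iff
  using pair_lift_add[OF smult4_bilinear smult4_bilinear] pair_lift_scale[OF smult4_bilinear]
  by (simp add: smult4_lin[abs_def])

lemma star_eq: "(s :: 'g tensor) \<star> t = pair_lift (\<lambda>a b. pair_lift (smult4 a b) t) s"
  unfolding tensor2_mult_def smult4_def[abs_def] ..

lemma star_plin: "plin (\<lambda>s :: 'g tensor. s \<star> t)" "plin (\<lambda>t :: 'g tensor. s \<star> t)"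
proof -
  show "plin (\<lambda>s :: 'g tensor. s \<star> t)" unfolding star_eq by (rule pair_lift_plin[OF smult4_bilinear'])
  show "plin (\<lambda>t :: 'g tensor. s \<star> t)" unfolding star_eq plin_iff
    by (simp add: plin_add[OF pair_lift_plin[OF smult4_bilinear]] plin_scale[OF pair_lift_plin[OF smult4_bilinear]]
      pair_lift_add[OF smult4_bilinear' smult4_bilinear'] pair_lift_scale[OF smult4_bilinear'])
qed

lemma star_tens: "tens [a, b :: 'g palg] \<star> tens [c, d] = tens [a * part 0 c, b * d] + tens [a * part 1 c, parity_inv b * d]"
  by (subst star_eq, subst pair_lift_tens[OF smult4_bilinear'], subst pair_lift_tens[OF smult4_bilinear], rule smult4_def)

text \<open>Linearity in \<open>\<Delta> w\<close> and then in \<open>\<Delta> u\<close> reduces the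
  step to pure tensors c \<otimes> d and a \<otimes> b. There the sign of moving b past c, built
  into \<star>, and that of moving b past v combine to the sign of moving b past
  \<open>\<rho> c v\<close>, whose parity is the sum by \<open>part_act\<close>.\<close>

lemma pow_act_mult:
  "t \<in> tensor_power (Suc k) \<Longrightarrow> pow_act k (u * w) t = pow_act k u (pow_act k w t)"
proof (induction k arbitrary: t u w)
  case 0
  show ?case
  proof (rule tensor_power_Suc_induct[OF pow_act_plin _ 0, where L' = "\<lambda>t. pow_act 0 u (pow_act 0 w t)"])
    fix v :: "'h palg" and t :: "'h tensor"
    assume "t \<in> tensor_power 0"
    then obtain c where t: "t = c \<cdot> 1"
      by (auto simp: tensor_power_def palg.span_singleton)
    have *: "pow_act 0 u (tens [v]) = tens [\<rho> u v]" for u v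
      by (simp add: pow_act_def tact_tens plin_add[OF tens_single_plin, symmetric] plin_add[OF act_plin, symmetric] part_add_part)
    have "pow_act 0 (u * w) (tens [v]) = pow_act 0 u (pow_act 0 w (tens [v]))"
      by (simp add: * act_mult)
    then show "pow_act 0 (u * w) (tens [v] * t) = pow_act 0 u (pow_act 0 w (tens [v] * t))"
      by (simp add: t lin plin2)
  qed (simp add: plin_iff plin2)
next
  case (Suc k)
  note P = pair_lift_plin[OF pair_act_bilinear] and PT = pair_lift_tens[OF pair_act_bilinear]
  show ?case
  proof (rule tensor_power_Suc_induct[OF pow_act_plin _ Suc.prems, where L' = "\<lambda>t. pow_act (Suc k) u (pow_act (Suc k) w t)"])
    fix v :: "'h palg" and t :: "'h tensor"
    assume t: "t \<in> tensor_power (Suc k)"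
    have "pair_lift (pair_act k v t) (\<Delta> u \<star> \<Delta> w) = pow_act (Suc k) u (pair_lift (pair_act k v t) (\<Delta> w))"
    proof (rule tensor_power_2_eqI[OF _ _ comult_range,
          where L = "\<lambda>s. pair_lift (pair_act k v t) (\<Delta> u \<star> s)"
            and L' = "\<lambda>s. pow_act (Suc k) u (pair_lift (pair_act k v t) s)"])
      fix c d
      have "pair_lift (pair_act k v t) (\<Delta> u \<star> tens [c, d]) =
          pair_lift (pair_act k (\<rho> c (part 0 v)) (pow_act k d t)) (\<Delta> u) +
          pair_lift (pair_act k (\<rho> c (part 1 v)) (pow_act k (parity_inv d) t)) (\<Delta> u)"
      proof (rule tensor_power_2_eqI[OF _ _ comult_range,
            where L = "\<lambda>s. pair_lift (pair_act k v t) (s \<star> tens [c, d])"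
              and L' = "\<lambda>s. pair_lift (pair_act k (\<rho> c (part 0 v)) (pow_act k d t)) s +
                pair_lift (pair_act k (\<rho> c (part 1 v)) (pow_act k (parity_inv d) t)) s"])
        fix a b
        show "pair_lift (pair_act k v t) (tens [a, b] \<star> tens [c, d]) =
            pair_lift (pair_act k (\<rho> c (part 0 v)) (pow_act k d t)) (tens [a, b]) +
            pair_lift (pair_act k (\<rho> c (part 1 v)) (pow_act k (parity_inv d) t)) (tens [a, b])"
          by (simp add: star_tens plin_add[OF P] PT pair_act_def act_mult Suc.IH[OF t] part_act part_part
              parity_inv_mult parity_inv_involution lin algebra_simps)
      qed (use P star_plin(1) in \<open>simp_all add: plin_iff lin algebra_simps\<close>)
      then show "pair_lift (pair_act k v t) (\<Delta> u \<star> tens [c, d]) =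
          pow_act (Suc k) u (pair_lift (pair_act k v t) (tens [c, d]))"
        by (simp add: PT pair_act_def plin2 pow_act_Suc)
    qed (use P star_plin(2) in \<open>simp_all add: plin_iff plin2\<close>)
    then show "pow_act (Suc k) (u * w) (tens [v] * t) = pow_act (Suc k) u (pow_act (Suc k) w (tens [v] * t))"
      by (simp add: pow_act_Suc comult_mult)
  qed (simp add: plin_iff plin2)
qed

lemma iter_comult_homogeneous: "u \<in> homogeneous p \<Longrightarrow> iter_comult \<Delta> k u \<in> hom_tensor (Suc k) p"
proof (induction k arbitrary: u p)
  case 0
  have "list_all2 (\<lambda>g p. g \<in> homogeneous p) [u] [p]" "sum_list [p] = p" using 0 by simp_all
  then show ?case unfolding hom_tensor_def
    by (intro palg.span_base CollectI exI[of _ "[u]"] exI[of _ "[p]"]) simp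
next
  case (Suc k)
  have "pair_lift (comult_step k) s \<in> hom_tensor (Suc (Suc k)) p" if "s \<in> tensor2_homogeneous p" for s
    using that unfolding tensor2_homogeneous_def
  proof (rule plin_span_in[OF pair_lift_plin[OF comult_step_bilinear]])
    show "palg.subspace (hom_tensor (Suc (Suc k)) p)" by (simp add: hom_tensor_def)
    fix y :: "'g tensor"
    assume "y \<in> {tens [a, b] |a b q r. a \<in> homogeneous q \<and> b \<in> homogeneous r \<and> q + r = p}"
    then obtain a b q r where y: "y = tens [a, b]" "a \<in> homogeneous q" "b \<in> homogeneous r" "q + r = p"
      by blast
    have "tens [a] * z \<in> hom_tensor (Suc (Suc k)) p" if "z \<in> hom_tensor (Suc k) r" for z
    proof (rule plin_span_in[where L = "\<lambda>z. tens [a] * z", OF _ that[unfolded hom_tensor_def]])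
      show "plin (\<lambda>z. tens [a] * z)" by (simp add: plin_iff lin)
      show "palg.subspace (hom_tensor (Suc (Suc k)) p)" by (simp add: hom_tensor_def)
      fix z :: "'g tensor"
      assume "z \<in> {tens gs |gs ps. length gs = Suc k \<and>
        list_all2 (\<lambda>g p. g \<in> homogeneous p) gs ps \<and> sum_list ps = r}"
      then obtain gs ps where z: "z = tens gs" "length gs = Suc k"
        "list_all2 (\<lambda>g p. g \<in> homogeneous p) gs ps" "sum_list ps = r" by blast
      then have "tens [a] * z = tens (a # gs)" "length (a # gs) = Suc (Suc k)"
        "list_all2 (\<lambda>g p. g \<in> homogeneous p) (a # gs) (q # ps)" "sum_list (q # ps) = p"
        using y by (simp_all add: tens_Cons[of a gs])
      then show "tens [a] * z \<in> hom_tensor (Suc (Suc k)) p"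
        unfolding hom_tensor_def by (intro palg.span_base) blast
    qed
    then show "pair_lift (comult_step k) y \<in> hom_tensor (Suc (Suc k)) p"
      using Suc.IH[OF y(3)] by (simp add: y(1) pair_lift_tens[OF comult_step_bilinear])
  qed
  then show ?case using comult_homogeneous[OF Suc.prems] by simp
qed

end

section \<open>The quantum queer superalgebra\<close>

definition free_homogeneous :: "bit \<Rightarrow> 'g::super_presented free_algebra \<Rightarrow> bool"
  where "free_homogeneous p f \<longleftrightarrow> (\<forall>w\<in>Poly_Mapping.keys f. sum_list (map gen_parity w) = p)"

lemma free_homogeneous_add:
  "free_homogeneous p f \<Longrightarrow> free_homogeneous p g \<Longrightarrow> free_homogeneous p (f + g)"
  unfolding free_homogeneous_def using keys_add[of f g] by auto

lemma free_homogeneous_single: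
  "sum_list (map gen_parity w) = p \<Longrightarrow> free_homogeneous p (Poly_Mapping.single w c)"
  by (simp add: free_homogeneous_def)

lemma free_homogeneous_diff:
  "free_homogeneous p f \<Longrightarrow> free_homogeneous p g \<Longrightarrow> free_homogeneous p (f - g)"
  unfolding free_homogeneous_def by (auto simp: in_keys_iff lookup_minus)

lemma single_Nil_one: "(1 :: 'g free_algebra) = Poly_Mapping.single [] 1"
  by (metis single_one zero_list_def)

text \<open>Expands a relation into sums and differences of single words. Its parity can then be
  checked summand by summand, without determining which words survive cancellation.\<close>

lemmas to_single = letter_def fscale_def mult_single plus_list_def power2_eq_square single_Nil_one
  distrib_left distrib_right right_diff_distrib left_diff_distrib

lemmas free_homogeneous_intros = free_homogeneous_add free_homogeneous_diff free_homogeneous_single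

lemma urels_homogeneous: "r \<in> urels n \<Longrightarrow> \<exists>p. free_homogeneous p r"
proof (induction rule: urels.induct)
  case (range g)
  show ?case unfolding letter_def by (rule exI, rule free_homogeneous_single, rule refl)
next
  case (QQ6_E i j Z)
  then show ?case
    by (elim insertE) (simp only: to_single, rule exI[of _ 0] exI[of _ 1],
      (intro free_homogeneous_intros; simp; fail))+
next
  case (QQ6_F i j Z)
  then show ?case
    by (elim insertE) (simp only: to_single, rule exI[of _ 0] exI[of _ 1],
      (intro free_homogeneous_intros; simp; fail))+
qed (simp only: to_single, rule exI[of _ 0] exI[of _ 1], (intro free_homogeneous_intros; simp; fail))+

instance ugen :: (type) hom_presented
  by standard (use urels_homogeneous in \<open>auto simp: rels_ugen_def free_homogeneous_def\<close>)

lemmas palg_abs_eq = gen_def plus_palg.abs_eq minus_palg.abs_eq times_palg.abs_eq pscale.abs_eq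
  one_palg.abs_eq zero_palg.abs_eq

context
  fixes dummy :: "'n itself"
begin

lemma ugen_rel: "r \<in> urels CARD('n) \<Longrightarrow> abs_palg r = (0 :: 'n U)"
  by (rule abs_palg_rel) (simp add: rels_ugen_def)

lemma ugen_range: "\<not> admissible CARD('n) g \<Longrightarrow> gen g = (0 :: 'n U)"
  using ugen_rel[OF urels.range] by (simp add: gen_def)

lemma K_Kinv: "i \<in> {1..CARD('n)} \<Longrightarrow> gen (qK i) * gen (qKinv i) = (1 :: 'n U)"
  using ugen_rel[OF urels.QQ1_inv_right] by (simp add: palg_abs_eq[symmetric])

lemma Kinv_K: "i \<in> {1..CARD('n)} \<Longrightarrow> gen (qKinv i) * gen (qK i) = (1 :: 'n U)"
  using ugen_rel[OF urels.QQ1_inv_left] by (simp add: palg_abs_eq[symmetric])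

lemma Ebar_Kinv: "j \<in> {1..<CARD('n)} \<Longrightarrow> gen (qEbar j) * gen (qKinv j) =
    gen (qKbar j) * gen (qE j) - \<upsilon> \<cdot> (gen (qE j) * gen (qKbar j) :: 'n U)"
  using ugen_rel[OF urels.QQ3_E_same] by (simp add: palg_abs_eq[symmetric])

lemma Fbar_K: "j \<in> {1..<CARD('n)} \<Longrightarrow> gen (qFbar j) * gen (qK j) =
    \<upsilon> \<cdot> (gen (qF j) * gen (qKbar j) :: 'n U) - gen (qKbar j) * gen (qF j)"
  using ugen_rel[OF urels.QQ3_F_same] by (simp add: palg_abs_eq[symmetric] algebra_simps eq_neg_iff_add_eq_0)

lemma Kbar_Suc_K: "j \<in> {1..<CARD('n)} \<Longrightarrow> gen (qKbar (j + 1)) * gen (qK j) =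
    gen (qK (j + 1)) * gen (qKbar j) - (gen (qEbar j) * gen (qF j) - gen (qF j) * gen (qEbar j) :: 'n U)"
  using ugen_rel[OF urels.QQ4_Ebar_F[of j _ j]] by (simp add: palg_abs_eq[symmetric] algebra_simps)

text \<open>The relations are solved for the missing generators, with \<open>qK\<close> and
  \<open>qKinv\<close> invertible. From the odd \<open>qKbar j\<close> one gets
  \<open>qEbar j\<close> by (QQ3); with it \<open>qKbar (j + 1)\<close> follows from the commutator
  of \<open>qEbar j\<close> and \<open>qF j\<close> in (QQ4), and so on upwards. Finally
  \<open>qFbar j\<close> comes from \<open>qKbar j\<close> by (QQ3).\<close>

lemma U_generated:
  fixes S :: "'n U set"
  assumes S: "palg.subspace S" "\<And>u w. u \<in> S \<Longrightarrow> w \<in> S \<Longrightarrow> u * w \<in> S" "1 \<in> S"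
    and K: "\<And>i. i \<in> {1..CARD('n)} \<Longrightarrow> gen (qK i) \<in> S" "\<And>i. i \<in> {1..CARD('n)} \<Longrightarrow> gen (qKinv i) \<in> S"
    and EF: "\<And>h. h \<in> {1..<CARD('n)} \<Longrightarrow> gen (qE h) \<in> S" "\<And>h. h \<in> {1..<CARD('n)} \<Longrightarrow> gen (qF h) \<in> S"
    and Kbar: "gen (qKbar 1) \<in> S"
  shows "u \<in> S"
proof -
  note closed = palg.subspace_diff[OF S(1)] palg.subspace_scale[OF S(1)] S(2)
  have Ebar: "gen (qEbar j) \<in> S" if j: "j \<in> {1..<CARD('n)}" and k: "gen (qKbar j) \<in> S" for j
  proof -
    have j': "j \<in> {1..CARD('n)}" using j by auto
    have "(gen (qEbar j) :: 'n U) = (gen (qEbar j) * gen (qKinv j)) * gen (qK j)"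
      by (simp only: mult.assoc Kinv_K[OF j'] mult_1_right)
    also have "\<dots> \<in> S" unfolding Ebar_Kinv[OF j]
      by (intro closed k EF(1)[OF j] K(1)[OF j'])
    finally show ?thesis .
  qed
  have Kbar: "gen (qKbar i) \<in> S" if "1 \<le> i" for i
    using that
  proof (induction i rule: dec_induct)
    case (step j)
    show ?case
    proof (cases "Suc j \<le> CARD('n)")
      case True
      then have j: "j \<in> {1..<CARD('n)}" and j': "j \<in> {1..CARD('n)}" "j + 1 \<in> {1..CARD('n)}" using step by auto
      have "(gen (qKbar (j + 1)) :: 'n U) = (gen (qKbar (j + 1)) * gen (qK j)) * gen (qKinv j)"
        by (simp only: mult.assoc K_Kinv[OF j'(1)] mult_1_right)
      also have "\<dots> \<in> S" unfolding Kbar_Suc_K[OF j]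
        by (intro closed K(1)[OF j'(2)] K(2)[OF j'(1)] EF(2)[OF j] Ebar[OF j] step.IH)
      finally show ?thesis by simp
    qed (simp add: ugen_range palg.subspace_0[OF S(1)])
  qed (rule Kbar)
  have Fbar: "gen (qFbar j) \<in> S" if j: "j \<in> {1..<CARD('n)}" for j
  proof -
    have j': "j \<in> {1..CARD('n)}" using j by auto
    have "(gen (qFbar j) :: 'n U) = (gen (qFbar j) * gen (qK j)) * gen (qKinv j)"
      by (simp only: mult.assoc K_Kinv[OF j'] mult_1_right)
    also have "\<dots> \<in> S" unfolding Fbar_K[OF j]
      using j by (intro closed Kbar EF(2)[OF j] K(2)[OF j']) auto
    finally show ?thesis .
  qed
  have gens: "gen g \<in> S" for g :: "'n ugen"
  proof (cases "admissible CARD('n) g")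
    case True
    then show ?thesis using K EF Kbar Ebar Fbar by (cases g) auto
  next
    case False
    then show ?thesis by (simp add: ugen_range palg.subspace_0[OF S(1)])
  qed
  show ?thesis
    by (induction u rule: palg_induct)
      (auto intro: gens S palg.subspace_0[OF S(1)] palg.subspace_add[OF S(1)] palg.subspace_scale[OF S(1)])
qed

end

section \<open>The quantum symmetric superalgebra\<close>

lemma upsilon_power: "\<upsilon> ^ m = Fract (monom 1 m) 1"
  by (induction m) (simp_all add: upsilon_def One_fract_def monom_Suc mult.commute[of _ "[:0, 1:]"] one_pCons
      monom_0)

lemma upsilon_nonzero [simp]: "\<upsilon> \<noteq> 0"
  by (simp add: upsilon_def Zero_fract_def eq_fract)

lemma upsilon_power_eq_1: "\<upsilon> ^ m = 1 \<Longrightarrow> m = 0"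
proof -
  assume "\<upsilon> ^ m = 1"
  then have "monom 1 m = (1 :: rat poly)" by (simp add: upsilon_power One_fract_def eq_fract)
  then show "m = 0" by (metis degree_1 degree_monom_eq one_neq_zero)
qed

lemma upsilon_powi_eq_1_iff [simp]: "\<upsilon> powi k = 1 \<longleftrightarrow> k = 0"
proof
  assume *: "\<upsilon> powi k = 1"
  show "k = 0"
  proof (cases "k \<ge> 0")
    case True
    then show ?thesis using * upsilon_power_eq_1[of "nat k"] by (simp add: power_int_def)
  next
    case False
    then have "\<upsilon> ^ nat (- k) = 1" using * by (simp add: power_int_def power_inverse)
    then show ?thesis using upsilon_power_eq_1[of "nat (- k)"] False by simp
  qed
qed simp

lemma upsilon_powi_eq_iff [simp]: "\<upsilon> powi k = \<upsilon> powi l \<longleftrightarrow> k = l"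
proof
  assume "\<upsilon> powi k = \<upsilon> powi l"
  then have "\<upsilon> powi (k - l) = 1" by (simp add: power_int_diff)
  then show "k = l" by simp
qed simp

lemma qint_nonzero: "k \<noteq> 0 \<Longrightarrow> qint k \<noteq> 0"
proof -
  assume k: "k \<noteq> 0"
  have "\<upsilon> powi k \<noteq> \<upsilon> powi (- k)" "\<upsilon> powi 1 \<noteq> \<upsilon> powi (- 1)"
    using k by (simp_all only: upsilon_powi_eq_iff)
  then show ?thesis by (simp add: qint_def power_int_minus)
qed

lemma qint_0 [simp]: "qint 0 = 0"
  by (simp add: qint_def)

lemma qint_1 [simp]: "qint 1 = 1"
proof -
  have "\<upsilon> powi 1 \<noteq> \<upsilon> powi (- 1)" by (simp only: upsilon_powi_eq_iff)
  then show ?thesis by (simp add: qint_def power_int_minus)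
qed

lemma qfact_Suc: "qfact (Suc m) = qint (int m + 1) * qfact m"
  by (simp add: qfact_def mult.commute add.commute)

lemma qfact_nonzero [simp]: "qfact m \<noteq> 0"
  by (simp add: qfact_def qint_nonzero)

lemma arels_homogeneous: "r \<in> arels n \<Longrightarrow> \<exists>p. free_homogeneous p r"
proof (induction rule: arels.induct)
qed (simp only: to_single, rule exI[of _ 0] exI[of _ 1], (intro free_homogeneous_intros; simp; fail))+

instance agen :: (type) hom_presented
  by standard (use arels_homogeneous in \<open>auto simp: rels_agen_def free_homogeneous_def\<close>)

text \<open>The factor relating the square of an odd generator to the square of its even
  companion.\<close>

definition kappa :: qfield  ("\<kappa>")
  where "\<kappa> = (\<upsilon> - inverse \<upsilon>) / (\<upsilon> + inverse \<upsilon>)"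

context
  fixes dummy :: "'n itself"
begin

lemma agen_rel: "r \<in> arels CARD('n) \<Longrightarrow> abs_palg r = (0 :: 'n A)"
  by (rule abs_palg_rel) (simp add: rels_agen_def)

lemma agen_range: "i \<notin> {1..CARD('n)} \<Longrightarrow> gen (qX i) = (0 :: 'n A)"
  "i \<notin> {1..CARD('n)} \<Longrightarrow> gen (qXbar i) = (0 :: 'n A)"
  using agen_rel[OF arels.range_X] agen_rel[OF arels.range_Xbar] by (simp_all add: gen_def)

lemma X_X: "gen (qX i) * gen (qX j) = gen (qX j) * (gen (qX i) :: 'n A)"
proof (cases "i \<in> {1..CARD('n)} \<and> j \<in> {1..CARD('n)}")
  case True
  then show ?thesis using agen_rel[OF arels.X_X[of i _ j]] by (simp add: palg_abs_eq[symmetric])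
qed (auto simp: agen_range)

lemma X_Xbar: "gen (qX i) * gen (qXbar j) = gen (qXbar j) * (gen (qX i) :: 'n A)"
proof (cases "i \<in> {1..CARD('n)} \<and> j \<in> {1..CARD('n)}")
  case True
  then show ?thesis using agen_rel[OF arels.X_Xbar[of i _ j]] by (simp add: palg_abs_eq[symmetric])
qed (auto simp: agen_range)

lemma Xbar_square: "gen (qXbar i) * gen (qXbar i) = \<kappa> \<cdot> (gen (qX i) * (gen (qX i) :: 'n A))"
proof (cases "i \<in> {1..CARD('n)}")
  case True
  then show ?thesis using agen_rel[OF arels.Xbar_square[of i]]
    by (simp add: palg_abs_eq[symmetric] kappa_def power2_eq_square)
qed (auto simp: agen_range)

lemma X_comm: "gen (qX i) * x = x * (gen (qX i) :: 'n A)"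
proof (induction x rule: palg_induct)
  case (gen g x)
  have "gen (qX i) * gen g = gen g * (gen (qX i) :: 'n A)" by (cases g) (auto simp: X_X X_Xbar)
  then show ?case using gen by (metis mult.assoc)
qed (simp_all add: pscale_mult_left pscale_mult_right distrib_left distrib_right)

lemma X_left_commute: "y * (gen (qX i) * z) = gen (qX i) * (y * z :: 'n A)"
  by (simp only: mult.assoc[symmetric] X_comm[of i y])

abbreviation Xprod :: "nat list \<Rightarrow> (nat \<Rightarrow> nat) \<Rightarrow> 'n A"
  where "Xprod xs a \<equiv> (\<Prod>i\<leftarrow>xs. gen (qX i) ^ a i)"

abbreviation Xbarprod :: "nat list \<Rightarrow> (nat \<Rightarrow> nat) \<Rightarrow> 'n A"
  where "Xbarprod xs b \<equiv> (\<Prod>i\<leftarrow>xs. gen (qXbar i) ^ b i)"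

lemma prod_list_fun_upd:
  fixes f :: "nat \<Rightarrow> nat \<Rightarrow> 'n A"
  shows "i \<notin> set xs \<Longrightarrow> (\<Prod>k\<leftarrow>xs. f k ((a(i := m)) k)) = (\<Prod>k\<leftarrow>xs. f k (a k))"
  by (induction xs) auto

lemma X_Xprod:
  "distinct xs \<Longrightarrow> i \<in> set xs \<Longrightarrow> gen (qX i) * Xprod xs a = Xprod xs (a(i := Suc (a i)))"
proof (induction xs)
  case (Cons x xs)
  show ?case
  proof (cases "x = i")
    case True
    then have "Xprod xs (a(i := Suc (a i))) = Xprod xs a" using Cons.prems by (intro prod_list_fun_upd) auto
    then show ?thesis by (simp add: True mult.assoc)
  next
    case False
    have "gen (qX i) * (gen (qX x) ^ a x * Xprod xs a) = gen (qX x) ^ a x * (gen (qX i) * Xprod xs a)"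
      by (simp only: mult.assoc[symmetric] X_comm[of i "gen (qX x) ^ a x"])
    then show ?thesis using False Cons by simp
  qed
qed simp

text \<open>The square of an odd generator is a multiple of an even central element, so it can be
  taken out from any position without a sign.\<close>

lemma Xbarprod_square:
  "distinct xs \<Longrightarrow> i \<in> set xs \<Longrightarrow> b i = 2 \<Longrightarrow>
    Xbarprod xs b = \<kappa> \<cdot> (gen (qX i) * (gen (qX i) * Xbarprod xs (b(i := 0))))"
proof (induction xs)
  case (Cons x xs)
  show ?case
  proof (cases "x = i")
    case True
    then have "Xbarprod xs (b(i := 0)) = Xbarprod xs b" using Cons.prems by (intro prod_list_fun_upd) auto
    then show ?thesis using Cons.prems
      by (simp add: True power2_eq_square Xbar_square pscale_mult_left mult.assoc)
  next
    case False
    have "gen (qXbar x) ^ b x * (gen (qX i) * (gen (qX i) * y)) =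
        gen (qX i) * (gen (qX i) * (gen (qXbar x) ^ b x * y))" for y :: "'n A"
      by (simp only: X_left_commute[of "gen (qXbar x) ^ b x"])
    then show ?thesis using False Cons by (simp add: pscale_mult_right)
  qed
qed simp

lemma X_Xmon: "i \<in> {1..CARD('n)} \<Longrightarrow> gen (qX i) * Xmon a b = (Xmon (a(i := Suc (a i))) b :: 'n A)"
  unfolding Xmon_def mult.assoc[symmetric] by (subst X_Xprod) auto

lemma Xmon_square:
  assumes "i \<in> {1..CARD('n)}" "b i = 2"
  shows "(Xmon a b :: 'n A) = \<kappa> \<cdot> Xmon (a(i := a i + 2)) (b(i := 0))"
proof -
  have "(Xmon a b :: 'n A) = Xprod [1..<Suc CARD('n)] a *
      (\<kappa> \<cdot> (gen (qX i) * (gen (qX i) * Xbarprod [1..<Suc CARD('n)] (b(i := 0)))))"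
    unfolding Xmon_def using assms by (subst Xbarprod_square[of _ i]) auto
  also have "\<dots> = \<kappa> \<cdot> (gen (qX i) * (gen (qX i) * Xmon a (b(i := 0))))"
    by (simp only: Xmon_def pscale_mult_right X_left_commute[of "Xprod _ _"])
  finally show ?thesis using assms by (simp add: X_Xmon)
qed

end

text \<open>The monomials in the generators multiply to scalar multiples of each other.  Letting words act
  from the right on functions of the exponents therefore provides a dual of the algebra in
  which the monomials are visibly independent.\<close>

definition sgB :: "nat set \<Rightarrow> nat \<Rightarrow> qfield"
  where "sgB B i = (- 1) ^ card (B \<inter> {..<i})"

text \<open>With \<psi> read as a functional on monomials, this is \<psi> composed with left
  multiplication by the generator. The sign counts the odd factors of smaller index that an odd
  generator has to pass, and \<kappa> with the exponent raised by 2 replaces a square.\<close>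

fun agen_op :: "nat \<Rightarrow> 'n agen \<Rightarrow> ((nat \<Rightarrow> nat) \<Rightarrow> nat set \<Rightarrow> qfield) \<Rightarrow> (nat \<Rightarrow> nat) \<Rightarrow> nat set \<Rightarrow> qfield"
where
  "agen_op n (qX i) \<psi> = (\<lambda>a B. if i \<in> {1..n} then \<psi> (a(i := Suc (a i))) B else 0)"
| "agen_op n (qXbar i) \<psi> = (\<lambda>a B. if i \<in> {1..n} then
      sgB B i * (if i \<in> B then \<kappa> * \<psi> (a(i := Suc (Suc (a i)))) (B - {i}) else \<psi> a (insert i B)) else 0)"

abbreviation word_op :: "nat \<Rightarrow> 'n agen list \<Rightarrow> ((nat \<Rightarrow> nat) \<Rightarrow> nat set \<Rightarrow> qfield) \<Rightarrow> (nat \<Rightarrow> nat) \<Rightarrow> nat set \<Rightarrow> qfield"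
  where "word_op n w \<psi> \<equiv> foldl (\<lambda>\<psi> g. agen_op n g \<psi>) \<psi> w"

lemma agen_op_scale: "agen_op n g (\<lambda>a B. c * \<psi> a B) = (\<lambda>a B. c * agen_op n g \<psi> a B)"
  by (cases g) (auto simp: fun_eq_iff)

lemma word_op_scale: "word_op n w (\<lambda>a B. c * \<psi> a B) = (\<lambda>a B. c * word_op n w \<psi> a B)"
  by (induction w arbitrary: \<psi>) (simp_all add: agen_op_scale)

lemma sgB_insert: "j \<notin> B \<Longrightarrow> sgB (insert j B) i = (if j < i then - sgB B i else sgB B i)"
  by (simp add: sgB_def Int_insert_left)

lemma sgB_remove: "j \<in> B \<Longrightarrow> sgB (B - {j}) i = (if j < i then - sgB B i else sgB B i)"
  using sgB_insert[of j "B - {j}" i] by (simp add: insert_absorb)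

lemma sgB_square: "sgB B i * (sgB B i * x) = x"
  by (simp add: sgB_def mult.assoc[symmetric] power_add[symmetric] flip: mult_2)

lemma agen_op_X_X:
  "agen_op n (qX i :: 'n agen) (agen_op n (qX j :: 'n agen) \<psi>) = agen_op n (qX j :: 'n agen) (agen_op n (qX i :: 'n agen) \<psi>)"
  by (cases "i = j") (auto simp: fun_eq_iff fun_upd_twist)

lemma agen_op_X_Xbar:
  "agen_op n (qX i :: 'n agen) (agen_op n (qXbar j :: 'n agen) \<psi>) = agen_op n (qXbar j :: 'n agen) (agen_op n (qX i :: 'n agen) \<psi>)"
  by (cases "i = j") (auto simp: fun_eq_iff fun_upd_twist)

text \<open>Inserting or removing the smaller index flips the sign attached to the larger one, and
  not conversely. So exactly one of the two orders acquires an extra sign.\<close>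

lemma agen_op_Xbar_Xbar:
  assumes ij: "i \<noteq> j"
  shows "agen_op n (qXbar i :: 'n agen) (agen_op n (qXbar j :: 'n agen) \<psi>) =
    (\<lambda>a B. (- 1) * agen_op n (qXbar j :: 'n agen) (agen_op n (qXbar i :: 'n agen) \<psi>) a B)"
proof (intro ext)
  fix a :: "nat \<Rightarrow> nat" and B
  have t: "a(i := x, j := y) = a(j := y, i := x)" for x y using ij by (rule fun_upd_twist)
  have s: "insert i (insert j B) = insert j (insert i B)" "B - {i} - {j} = B - {j} - {i}"
    "insert j B - {i} = insert j (B - {i})" "insert i B - {j} = insert i (B - {j})"
    using ij by auto
  have lt: "i < j \<longleftrightarrow> \<not> j < i" using ij by auto
  show "agen_op n (qXbar i :: 'n agen) (agen_op n (qXbar j :: 'n agen) \<psi>) a B =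
    (- 1) * agen_op n (qXbar j :: 'n agen) (agen_op n (qXbar i :: 'n agen) \<psi>) a B"
    using ij by (cases "i \<in> B"; cases "j \<in> B"; cases "j < i")
      (simp_all add: t s lt sgB_insert sgB_remove)
qed

lemma agen_op_Xbar_square:
  "agen_op n (qXbar i :: 'n agen) (agen_op n (qXbar i :: 'n agen) \<psi>) =
    (\<lambda>a B. \<kappa> * agen_op n (qX i :: 'n agen) (agen_op n (qX i :: 'n agen) \<psi>) a B)"
  by (auto simp: fun_eq_iff sgB_insert sgB_remove sgB_square insert_absorb)

context
  fixes dummy :: "'n itself"
begin

lemma qfield_vector_space: "vector_space ((*) :: qfield \<Rightarrow> qfield \<Rightarrow> qfield)"
  by unfold_locales (simp_all add: algebra_simps)

text \<open>The letters before a relation are absorbed into \<chi>, and those after it act linearly.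
  It therefore suffices that each relation holds for the operators on an arbitrary function.\<close>

lemma agen_functional:
  fixes \<psi> :: "(nat \<Rightarrow> nat) \<Rightarrow> nat set \<Rightarrow> qfield"
  obtains L :: "'n A \<Rightarrow> qfield" where "Vector_Spaces.linear pscale (*) L"
    "\<And>w. L (\<Prod>g\<leftarrow>w. gen g) = word_op CARD('n) w \<psi> (\<lambda>_. 0) {}"
proof (rule palg_ext[OF qfield_vector_space])
  let ?n = "CARD('n)"
  let ?f = "\<lambda>w :: 'n agen list. word_op ?n w \<psi> (\<lambda>_. 0) {}"
  fix r :: "'n agen free_algebra" and u w :: "'n agen list"
  assume r: "r \<in> rels"
  define \<chi> where "\<chi> = word_op ?n u \<psi>"
  have f: "?f (u @ v @ w) = word_op ?n w (word_op ?n v \<chi>) (\<lambda>_. 0) {}" for v :: "'n agen list"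
    by (simp add: \<chi>_def)
  have s: "Poly_Mapping.single u 1 * Poly_Mapping.single v c * Poly_Mapping.single w 1 =
      Poly_Mapping.single (u @ v @ w) (c :: qfield)" for v :: "'n agen list" and c
    by (simp add: mult_single plus_list_def)
  note ext = free_ext_single[OF qfield_vector_space] free_ext_add[OF qfield_vector_space]
    free_ext_diff[OF qfield_vector_space]
  note m = letter_def fscale_def mult_single plus_list_def power2_eq_square
  from r have "r \<in> arels ?n" by (simp add: rels_agen_def)
  then show "free_ext (*) ?f (Poly_Mapping.single u 1 * r * Poly_Mapping.single w 1) = 0"
  proof (cases rule: arels.cases)
    case (range_X i)
    have "agen_op ?n (qX i :: 'n agen) \<chi> = (\<lambda>a B. 0 * \<chi> a B)" using range_X(2) by auto
    then show ?thesis
      unfolding range_X(1) letter_def s ext f by (simp add: word_op_scale del: agen_op.simps mult_zero_left)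
  next
    case (range_Xbar i)
    have "agen_op ?n (qXbar i :: 'n agen) \<chi> = (\<lambda>a B. 0 * \<chi> a B)" using range_Xbar(2) by auto
    then show ?thesis
      unfolding range_Xbar(1) letter_def s ext f by (simp add: word_op_scale del: agen_op.simps mult_zero_left)
  next
    case (X_X i j)
    then show ?thesis
      by (simp only: X_X(1) m append_Cons append_Nil right_diff_distrib left_diff_distrib s ext f)
        (simp add: agen_op_X_X[of ?n i j] del: agen_op.simps)
  next
    case (X_Xbar i j)
    then show ?thesis
      by (simp only: X_Xbar(1) m append_Cons append_Nil right_diff_distrib left_diff_distrib s ext f)
        (simp add: agen_op_X_Xbar[of ?n i j] del: agen_op.simps)
  next
    case (Xbar_Xbar i j)
    show ?thesis
      by (simp only: Xbar_Xbar(1) m append_Cons append_Nil distrib_left distrib_right s ext f)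
        (simp add: agen_op_Xbar_Xbar[OF Xbar_Xbar(4), of ?n] word_op_scale del: agen_op.simps mult_minus_left mult_minus1)
  next
    case (Xbar_square i)
    show ?thesis
      by (simp only: Xbar_square(1) m append_Cons append_Nil right_diff_distrib left_diff_distrib s ext f)
        (simp add: agen_op_Xbar_square word_op_scale kappa_def[symmetric] del: agen_op.simps)
  qed
next
  fix L :: "'n A \<Rightarrow> qfield"
  assume "Vector_Spaces.linear pscale (*) L"
    "\<And>w. L (\<Prod>g\<leftarrow>w. gen g) = word_op CARD('n) w \<psi> (\<lambda>_. 0) {}"
  then show thesis by (rule that)
qed

definition Xword :: "(nat \<Rightarrow> nat) \<Rightarrow> (nat \<Rightarrow> nat) \<Rightarrow> nat list \<Rightarrow> nat list \<Rightarrow> 'n agen list"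
  where "Xword a b xs ys = concat (map (\<lambda>i. replicate (a i) (qX i)) xs) @ concat (map (\<lambda>i. replicate (b i) (qXbar i)) ys)"

lemma prod_Xword: "(\<Prod>g\<leftarrow>Xword a b [1..<Suc CARD('n)] [1..<Suc CARD('n)]. gen g) = (Xmon a b :: 'n A)"
proof -
  have *: "(\<Prod>g\<leftarrow>concat (map (\<lambda>i. replicate (a i) (q i)) xs). gen g) = (\<Prod>i\<leftarrow>xs. gen (q i :: 'n agen) ^ a i)" for q a xs
  proof (induction xs)
    case (Cons x xs)
    have "(\<Prod>g\<leftarrow>replicate m (q x). gen g) = (gen (q x) :: 'n A) ^ m" for m by (induction m) simp_all
    then show ?case using Cons by simp
  qed simp
  show ?thesis by (simp add: Xword_def Xmon_def * del: upt_Suc)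
qed

lemma word_op_X:
  "distinct xs \<Longrightarrow> set xs \<subseteq> {1..CARD('n)} \<Longrightarrow>
    word_op CARD('n) (concat (map (\<lambda>i. replicate (a i) (qX i :: 'n agen)) xs)) \<psi> =
    (\<lambda>a' B. \<psi> (\<lambda>i. a' i + (if i \<in> set xs then a i else 0)) B)"
proof (induction xs arbitrary: \<psi>)
  case (Cons x xs)
  have "word_op CARD('n) (replicate m (qX x :: 'n agen)) \<psi> = (\<lambda>a' B. \<psi> (a'(x := a' x + m)) B)" for m \<psi>
    using Cons.prems by (induction m arbitrary: \<psi>) (simp_all add: add.commute)
  then show ?case using Cons
    by (auto simp: fun_eq_iff intro!: arg_cong2[where f = \<psi>])
qed simp

text \<open>The indices increase, so each odd letter is multiplied onto a monomial whose odd indices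
  are all larger; no sign arises.\<close>

lemma word_op_Xbar:
  "sorted_wrt (<) xs \<Longrightarrow> set xs \<subseteq> {1..CARD('n)} \<Longrightarrow> \<forall>i. b i \<in> {0, 1} \<Longrightarrow>
    word_op CARD('n) (concat (map (\<lambda>i. replicate (b i) (qXbar i :: 'n agen)) xs)) \<psi> a {} =
    \<psi> a {i \<in> set xs. b i = 1}"
proof (induction xs arbitrary: \<psi>)
  case (Cons x xs)
  show ?case
  proof (cases "b x = 0")
    case True
    then have "{i \<in> set (x # xs). b i = 1} = {i \<in> set xs. b i = 1}" by auto
    then show ?thesis using Cons True by simp
  next
    case False
    then have b: "b x = 1" using Cons.prems(3)[rule_format, of x] by simp
    then have "{i \<in> set (x # xs). b i = 1} = insert x {i \<in> set xs. b i = 1}" by auto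
    moreover have "{i \<in> set xs. b i = 1} \<inter> {..<x} = {}" "x \<notin> set xs" using Cons.prems by auto
    ultimately show ?thesis using Cons b by (simp add: sgB_def)
  qed
qed simp

text \<open>Any assignment of scalars to exponents extends to a linear functional; this is the
  independence of the monomials in the form used below.\<close>

lemma Xmon_functional:
  fixes \<psi> :: "(nat \<Rightarrow> nat) \<Rightarrow> nat set \<Rightarrow> qfield"
  obtains L :: "'n A \<Rightarrow> qfield" where "Vector_Spaces.linear pscale (*) L"
    "\<And>a b. \<forall>i. b i \<in> {0, 1} \<Longrightarrow>
      L (Xmon a b) = \<psi> (\<lambda>i. if i \<in> {1..CARD('n)} then a i else 0) {i \<in> {1..CARD('n)}. b i = 1}"
proof (rule agen_functional)
  let ?xs = "[1..<Suc CARD('n)]"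
  have xs: "set ?xs = {1..CARD('n)}" by auto
  fix L :: "'n A \<Rightarrow> qfield"
  assume L: "Vector_Spaces.linear pscale (*) L"
    "\<And>w. L (\<Prod>g\<leftarrow>w. gen g) = word_op CARD('n) w \<psi> (\<lambda>_. 0) {}"
  have "L (Xmon a b) = \<psi> (\<lambda>i. if i \<in> {1..CARD('n)} then a i else 0) {i \<in> {1..CARD('n)}. b i = 1}"
    if b: "\<forall>i. b i \<in> {0, 1}" for a b
    unfolding prod_Xword[symmetric] L(2) Xword_def foldl_append
    by (subst word_op_Xbar[OF _ _ b]; (subst word_op_X)?) (auto simp: less_Suc_eq_le simp del: upt_Suc)
  with L(1) show thesis by (rule that)
qed

end

section \<open>The action on one tensor factor\<close>

context
  fixes dummy :: "'n itself"
begin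

definition fact_prod :: "(nat \<Rightarrow> nat) \<Rightarrow> qfield"
  where "fact_prod a = (\<Prod>i = 1..CARD('n). qfact (a i))"

lemma fact_prod_nonzero [simp]: "fact_prod a \<noteq> 0"
  by (simp add: fact_prod_def)

lemma fact_prod_Suc: "i \<in> {1..CARD('n)} \<Longrightarrow> fact_prod (a(i := Suc (a i))) = qint (int (a i) + 1) * fact_prod a"
proof -
  assume i: "i \<in> {1..CARD('n)}"
  have "(\<Prod>k \<in> {1..CARD('n)} - {i}. qfact ((a(i := Suc (a i))) k)) = (\<Prod>k \<in> {1..CARD('n)} - {i}. qfact (a k))"
    by (intro prod.cong) auto
  note rest = this
  have split: "fact_prod a = qfact (a i) * (\<Prod>k \<in> {1..CARD('n)} - {i}. qfact (a k))" for a
    by (simp only: fact_prod_def prod.remove[OF finite_atLeastAtMost i])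
  show ?thesis by (simp only: split rest fun_upd_same qfact_Suc mult.assoc)
qed

lemma Xmon_cong:
  assumes "\<And>i. i \<in> {1..CARD('n)} \<Longrightarrow> a i = a' i" "\<And>i. i \<in> {1..CARD('n)} \<Longrightarrow> b i = b' i"
  shows "Xmon a b = (Xmon a' b' :: 'n A)"
  unfolding Xmon_def using assms
  by (intro arg_cong2[where f = "(*)"] arg_cong[where f = prod_list] map_cong refl) auto

text \<open>Divided monomials with integer exponents, zero as soon as an exponent is negative.  The
  coefficients in the action formulas vanish where needed, so that no case distinctions arise.\<close>

definition YZ :: "(nat \<Rightarrow> int) \<Rightarrow> (nat \<Rightarrow> nat) \<Rightarrow> 'n A"
  where "YZ a b = (if \<forall>i\<in>{1..CARD('n)}. 0 \<le> a i
    then inverse (fact_prod (\<lambda>i. nat (a i))) \<cdot> Xmon (\<lambda>i. nat (a i)) b else 0)"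

lemma YZ_cong:
  assumes "\<And>i. i \<in> {1..CARD('n)} \<Longrightarrow> a i = a' i" "\<And>i. i \<in> {1..CARD('n)} \<Longrightarrow> b i = b' i"
  shows "YZ a b = YZ a' b'"
proof -
  have "Xmon (\<lambda>i. nat (a i)) b = (Xmon (\<lambda>i. nat (a' i)) b' :: 'n A)" using assms by (intro Xmon_cong) auto
  moreover have "fact_prod (\<lambda>i. nat (a i)) = fact_prod (\<lambda>i. nat (a' i))"
    unfolding fact_prod_def using assms by (intro prod.cong) auto
  moreover have "(\<forall>i\<in>{1..CARD('n)}. 0 \<le> a i) \<longleftrightarrow> (\<forall>i\<in>{1..CARD('n)}. 0 \<le> a' i)" using assms(1) by auto
  ultimately show ?thesis unfolding YZ_def by presburger
qed

lemma YZ_nat: "YZ (\<lambda>i. int (a i)) b = inverse (fact_prod a) \<cdot> Xmon a b"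
  by (simp add: YZ_def)

lemma YZ_neg: "i \<in> {1..CARD('n)} \<Longrightarrow> a i < 0 \<Longrightarrow> YZ a b = 0"
  unfolding YZ_def by (meson not_less)

abbreviation e :: "nat \<Rightarrow> nat \<Rightarrow> int" where "e i k \<equiv> of_bool (k = i)"

lemma YZ_raise:
  assumes i: "i \<in> {1..CARD('n)}"
  shows "inverse (fact_prod a) \<cdot> Xmon (a(i := Suc (a i))) b = qint (int (a i) + 1) \<cdot> YZ (\<lambda>k. int (a k) + e i k) b"
proof -
  have "YZ (\<lambda>k. int (a k) + e i k) b = YZ (\<lambda>k. int ((a(i := Suc (a i))) k)) b"
    by (intro YZ_cong) auto
  moreover have "qint (int (a i) + 1) \<noteq> 0" by (intro qint_nonzero) simp
  ultimately show ?thesis unfolding YZ_nat fact_prod_Suc[OF i] by (simp del: fun_upd_apply)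
qed

text \<open>The factorial absorbs the quantum integer. For \<open>a i = 0\<close> the left side
  vanishes through its coefficient and the right side through a negative exponent.\<close>

lemma YZ_lower:
  assumes i: "i \<in> {1..CARD('n)}"
  shows "(qint (int (a i)) * inverse (fact_prod a)) \<cdot> Xmon (a(i := a i - 1)) b = YZ (\<lambda>k. int (a k) - e i k) b"
proof (cases "a i")
  case 0
  then show ?thesis using i by (simp add: YZ_neg[of i])
next
  case (Suc m)
  define a' where "a' = a(i := m)"
  have a: "a = a'(i := Suc (a' i))" "a(i := a i - 1) = a'" by (auto simp: a'_def Suc)
  have "YZ (\<lambda>k. int (a k) - e i k) b = YZ (\<lambda>k. int (a' k)) b"
    by (intro YZ_cong) (auto simp: a'_def Suc)
  moreover have "qint (int (a' i) + 1) \<noteq> 0" by (intro qint_nonzero) simp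
  moreover have "fact_prod a = qint (int (a' i) + 1) * fact_prod a'" using fact_prod_Suc[OF i, of a'] a by simp
  moreover have "int (a i) = int (a' i) + 1" by (simp add: a'_def Suc)
  ultimately show ?thesis unfolding YZ_nat a(2) by (simp add: field_simps)
qed

text \<open>Passing to divided monomials trades the quantum integer of the lowered exponent for that
  of the raised one. The lower boundary at \<open>p\<close> is then enforced by the vanishing of
  \<open>YZ\<close> alone.\<close>

lemma YZ_move:
  assumes "p \<in> {1..CARD('n)}" "q \<in> {1..CARD('n)}" "p \<noteq> q"
  shows "(qint (int (a p)) * inverse (fact_prod a)) \<cdot> Xmon (a(q := a q + 1, p := a p - 1)) b =
    qint (int (a q) + 1) \<cdot> YZ (\<lambda>k. int (a k) + (e q k - e p k)) b"
proof (cases "a p")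
  case 0
  then show ?thesis using assms by (simp add: YZ_neg[of p])
next
  case (Suc m)
  define a' where "a' = a(p := m)"
  have a: "a = a'(p := Suc (a' p))" "a(q := a q + 1, p := a p - 1) = a'(q := Suc (a' q))"
    using assms(3) by (auto simp: a'_def Suc)
  have nz: "qint (int (a' p) + 1) \<noteq> 0" by (intro qint_nonzero) simp
  have f: "fact_prod a = qint (int (a' p) + 1) * fact_prod a'" using fact_prod_Suc[OF assms(1), of a'] a by simp
  have i: "int (a p) = int (a' p) + 1" "a' q = a q" using assms(3) by (simp_all add: a'_def Suc)
  have "qint (int (a p)) * inverse (fact_prod a) = inverse (fact_prod a')"
    unfolding f i using nz by (simp add: field_simps)
  moreover have "YZ (\<lambda>k. int (a k) + (e q k - e p k)) b = YZ (\<lambda>k. int (a' k) + e q k) b"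
    using assms(3) by (intro YZ_cong) (auto simp: a'_def Suc)
  ultimately show ?thesis unfolding a(2) using YZ_raise[OF assms(2), of a' b] by (simp add: i)
qed

lemma YZ_raise2:
  assumes i: "i \<in> {1..CARD('n)}"
  shows "inverse (fact_prod a) \<cdot> Xmon (a(i := a i + 2)) b =
    (qint (int (a i) + 1) * qint (int (a i) + 2)) \<cdot> YZ (\<lambda>k. int (a k) + 2 * e i k) b"
proof -
  let ?a = "a(i := Suc (a i))"
  have nz: "qint (int (a i) + 1) \<noteq> 0" by (intro qint_nonzero) simp
  have "inverse (fact_prod a) \<cdot> Xmon (a(i := a i + 2)) b =
      qint (int (a i) + 1) \<cdot> inverse (fact_prod ?a) \<cdot> (Xmon (?a(i := Suc (?a i))) b :: 'n A)"
    using nz by (simp add: fact_prod_Suc[OF i])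
  also have "\<dots> = qint (int (a i) + 1) \<cdot> qint (int (a i) + 2) \<cdot> YZ (\<lambda>k. int (?a k) + e i k) b"
    by (simp only: YZ_raise[OF i]) (simp add: add.commute)
  also have "YZ (\<lambda>k. int (?a k) + e i k) b = YZ (\<lambda>k. int (a k) + 2 * e i k) b"
    by (intro YZ_cong) auto
  finally show ?thesis by (simp only: palg.scale_scale)
qed

text \<open>Moves an odd variable from index \<open>p\<close> to index \<open>q\<close>; if the latter is already present, its
  square is replaced by a multiple of the square of the even variable.\<close>

definition odd_move :: "nat \<Rightarrow> nat \<Rightarrow> (nat \<Rightarrow> int) \<Rightarrow> (nat \<Rightarrow> nat) \<Rightarrow> 'n A"
  where "odd_move p q a b = (if b p = 0 then 0 else if b q = 0 then YZ a (b(q := 1, p := 0))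
    else (\<kappa> * (qint (a q + 1) * qint (a q + 2))) \<cdot> YZ (\<lambda>k. a k + 2 * e q k) (b(q := 0, p := 0)))"

lemma odd_move_nat:
  assumes "p \<in> {1..CARD('n)}" "q \<in> {1..CARD('n)}" "p \<noteq> q" "\<forall>i. b i \<in> {0, 1}"
  shows "(qint (int (b p)) * inverse (fact_prod a)) \<cdot> Xmon a (b(q := b q + 1, p := b p - 1)) =
    odd_move p q (\<lambda>i. int (a i)) b"
proof -
  have "b p = 0 \<or> b p = 1" "b q = 0 \<or> b q = 1" using assms(4) by auto
  moreover have "inverse (fact_prod a) \<cdot> Xmon a (b(q := 2, p := 0)) =
      (\<kappa> * (qint (int (a q) + 1) * qint (int (a q) + 2))) \<cdot> YZ (\<lambda>k. int (a k) + 2 * e q k) (b(q := 0, p := 0))"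
  proof -
    have "(Xmon a (b(q := 2, p := 0)) :: 'n A) = \<kappa> \<cdot> Xmon (a(q := a q + 2)) (b(q := 2, p := 0, q := 0))"
      using assms(3) by (intro Xmon_square[OF assms(2)]) simp
    also have "b(q := 2, p := 0, q := 0) = b(q := 0, p := 0)" using assms(3) by auto
    finally have "inverse (fact_prod a) \<cdot> (Xmon a (b(q := 2, p := 0)) :: 'n A) =
        \<kappa> \<cdot> inverse (fact_prod a) \<cdot> Xmon (a(q := a q + 2)) (b(q := 0, p := 0))"
      by (simp only: palg.scale_scale mult.commute)
    then show ?thesis by (simp only: YZ_raise2[OF assms(2)] palg.scale_scale)
  qed
  ultimately show ?thesis using assms(3)
    by (elim disjE) (simp_all add: odd_move_def YZ_nat numeral_2_eq_2[symmetric])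
qed

lemma YZ_cases:
  obtains (neg) i where "YZ a b = 0" "i \<in> {1..CARD('n)}" "a i < 0"
  | (nat) \<alpha> where "\<And>i. i \<in> {1..CARD('n)} \<Longrightarrow> a i = int (\<alpha> i)"
proof (cases "\<forall>i\<in>{1..CARD('n)}. 0 \<le> a i")
  case True
  then show ?thesis using that(2)[of "\<lambda>i. nat (a i)"] by simp
next
  case False
  then show ?thesis using that(1) YZ_neg[of _ a b] by (meson not_le)
qed

lemma Ycol_eq_YZ: "(Ycol A j :: 'n A) = YZ (\<lambda>i. int (fst A i j)) (\<lambda>i. snd A i j)"
proof -
  have "(\<Prod>i\<leftarrow>xs. divpow (gen (qX i) :: 'n A) (a i)) =
      inverse (\<Prod>i\<leftarrow>xs. qfact (a i)) \<cdot> (\<Prod>i\<leftarrow>xs. gen (qX i) ^ a i)" for xs a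
    by (induction xs) (simp_all add: divpow_def pscale_mult_left pscale_mult_right mult.commute)
  moreover have "(\<Prod>i\<leftarrow>[1..<Suc CARD('n)]. qfact (a i)) = fact_prod a" for a
    by (simp add: fact_prod_def prod.distinct_set_conv_list[symmetric] atLeastLessThanSuc_atLeastAtMost del: upt_Suc)
  ultimately show ?thesis
    by (simp only: Ycol_def YZ_nat Xmon_def pscale_mult_left)
qed

lemma YZ_functional:
  assumes "\<forall>i. \<beta> i \<in> {0, 1}"
  obtains L :: "'n A \<Rightarrow> qfield" where "Vector_Spaces.linear pscale (*) L"
    "\<And>a b. \<forall>i. b i \<in> {0, 1} \<Longrightarrow> L (YZ (\<lambda>i. int (a i)) b) =
      of_bool (\<forall>i\<in>{1..CARD('n)}. a i = \<alpha> i \<and> b i = \<beta> i)"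
proof -
  let ?r = "\<lambda>(a :: nat \<Rightarrow> nat) i. if i \<in> {1..CARD('n)} then a i else 0"
  \<comment> \<open>The value \<open>fact_prod \<alpha>\<close> cancels the normalisation of the
    divided monomial, so that the functional takes the value 1 there.\<close>
  define \<psi> where "\<psi> a B = (if a = ?r \<alpha> \<and> B = {i \<in> {1..CARD('n)}. \<beta> i = 1} then fact_prod \<alpha> else 0)" for a B
  obtain L :: "'n A \<Rightarrow> qfield" where L: "Vector_Spaces.linear pscale (*) L"
    "\<And>a b. \<forall>i. b i \<in> {0, 1} \<Longrightarrow>
      L (Xmon a b) = \<psi> (\<lambda>i. if i \<in> {1..CARD('n)} then a i else 0) {i \<in> {1..CARD('n)}. b i = 1}"
    using Xmon_functional by blast
  have "L (YZ (\<lambda>i. int (a i)) b) = of_bool (\<forall>i\<in>{1..CARD('n)}. a i = \<alpha> i \<and> b i = \<beta> i)"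
    if b: "\<forall>i. b i \<in> {0, 1}" for a b
  proof -
    have 1: "?r a = ?r \<alpha> \<longleftrightarrow> (\<forall>i\<in>{1..CARD('n)}. a i = \<alpha> i)" by (auto simp: fun_eq_iff)
    have bb: "b i = \<beta> i \<longleftrightarrow> (b i = 1 \<longleftrightarrow> \<beta> i = 1)" for i
      using b[rule_format, of i] assms[rule_format, of i] by auto
    have 2: "{i \<in> {1..CARD('n)}. b i = 1} = {i \<in> {1..CARD('n)}. \<beta> i = 1} \<longleftrightarrow> (\<forall>i\<in>{1..CARD('n)}. b i = \<beta> i)"
    proof -
      have "(\<forall>i\<in>{1..CARD('n)}. b i = \<beta> i) \<longleftrightarrow> (\<forall>i\<in>{1..CARD('n)}. b i = 1 \<longleftrightarrow> \<beta> i = 1)"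
        by (intro ball_cong refl bb)
      then show ?thesis by (simp only:) blast
    qed
    have 3: "fact_prod a = fact_prod \<alpha>" if "\<forall>i\<in>{1..CARD('n)}. a i = \<alpha> i"
      unfolding fact_prod_def using that by (intro prod.cong) auto
    have "L (YZ (\<lambda>i. int (a i)) b) = inverse (fact_prod a) * \<psi> (?r a) {i \<in> {1..CARD('n)}. b i = 1}"
      using L(1) by (simp only: YZ_nat L(2)[OF b, symmetric] Vector_Spaces.linear_iff)
    also have "\<dots> = of_bool ((\<forall>i\<in>{1..CARD('n)}. a i = \<alpha> i) \<and> (\<forall>i\<in>{1..CARD('n)}. b i = \<beta> i))"
    proof (cases "(\<forall>i\<in>{1..CARD('n)}. a i = \<alpha> i) \<and> (\<forall>i\<in>{1..CARD('n)}. b i = \<beta> i)")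
      case True
      then show ?thesis unfolding \<psi>_def 1 2 if_P[OF True] 3[OF True[THEN conjunct1]] by simp
    next
      case False
      then show ?thesis unfolding \<psi>_def 1 2 if_not_P[OF False] by simp
    qed
    finally show ?thesis by (simp only: ball_conj_distrib)
  qed
  with L(1) show thesis by (rule that)
qed

end

locale natural_action =
  fixes \<rho> :: "'n U \<Rightarrow> 'n A \<Rightarrow> 'n A"
  assumes natural: "is_natural_action \<rho>" and card: "CARD('n) \<ge> 2"
begin

sublocale super_action \<rho>
  by unfold_locales (use natural in \<open>simp add: is_natural_action_def\<close>)

abbreviation YZ' :: "(nat \<Rightarrow> int) \<Rightarrow> (nat \<Rightarrow> nat) \<Rightarrow> 'n A" where "YZ' \<equiv> YZ"

context
  fixes b :: "nat \<Rightarrow> nat"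
  assumes b: "\<forall>i. b i \<in> {0, 1}"
begin

lemma act_K:
  assumes i: "i \<in> {1..CARD('n)}"
  shows "\<rho> (gen (qK i)) (YZ a b) = \<upsilon> powi (a i + int (b i)) \<cdot> YZ a b"
proof (cases rule: YZ_cases[where 'n = 'n and a = a and b = b])
  case (nat \<alpha>)
  have Y: "YZ' a b = YZ (\<lambda>i. int (\<alpha> i)) b" using nat by (intro YZ_cong) auto
  have "\<rho> (gen (qK i)) (Xmon \<alpha> b) = \<upsilon> powi (a i + int (b i)) \<cdot> Xmon \<alpha> b"
    using natural b i nat[OF i] by (simp add: is_natural_action_def)
  then show ?thesis unfolding Y YZ_nat by (simp add: lin mult.commute)
qed (simp add: lin)

text \<open>The formulas prescribe no action of the inverse; it is recovered by cancelling that of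
  \<open>qK i\<close>.\<close>

lemma act_Kinv:
  assumes i: "i \<in> {1..CARD('n)}"
  shows "\<rho> (gen (qKinv i)) (YZ a b) = \<upsilon> powi (- (a i + int (b i))) \<cdot> YZ a b"
proof -
  have "YZ' a b = \<rho> (gen (qKinv i)) (\<rho> (gen (qK i)) (YZ a b))"
    by (simp only: act_mult[symmetric] Kinv_K[OF i] act_one)
  then have "YZ' a b = \<upsilon> powi (a i + int (b i)) \<cdot> \<rho> (gen (qKinv i)) (YZ a b)"
    by (simp only: act_K[OF i] lin)
  then have "\<upsilon> powi (- (a i + int (b i))) \<cdot> YZ' a b =
      (\<upsilon> powi (- (a i + int (b i))) * \<upsilon> powi (a i + int (b i))) \<cdot> \<rho> (gen (qKinv i)) (YZ a b)"
    by (metis palg.scale_scale)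
  then show ?thesis by (simp add: power_int_add[symmetric])
qed

lemma odd_move_neg:
  assumes "i \<in> {1..CARD('n)}" "a i < 0" "q \<in> {1..CARD('n)}"
  shows "odd_move p q a b = (0 :: 'n A)"
proof -
  have "(qint (a q + 1) * qint (a q + 2)) \<cdot> YZ' (\<lambda>k. a k + 2 * e q k) b' = 0" for b'
  proof (cases "i = q")
    case True
    then have "a q < 0" using assms by simp
    \<comment> \<open>At -1 and -2 one of the two quantum integers is zero; below that the raised
      exponent is still negative.\<close>
    then have "a q = - 1 \<or> a q = - 2 \<or> a q + 2 < 0" by linarith
    then show ?thesis using assms by (auto simp: YZ_neg[of q])
  qed (use assms in \<open>simp add: YZ_neg[of i]\<close>)
  moreover have "YZ' a b' = 0" for b' using assms YZ_neg by blast
  ultimately show ?thesis by (simp add: odd_move_def flip: palg.scale_scale)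
qed

lemma move_neg:
  assumes "i \<in> {1..CARD('n)}" "a i < 0" "q \<in> {1..CARD('n)}" "p \<noteq> q"
  shows "(c * qint (a q + 1)) \<cdot> YZ' (\<lambda>k. a k + (e q k - e p k)) b = 0"
proof (cases "i = q")
  case True
  then have "a q < 0" using assms by simp
  then have "a q = - 1 \<or> a q + 1 < 0" by linarith
  then show ?thesis using assms by (auto simp: YZ_neg[of q])
next
  case False
  then have "YZ' (\<lambda>k. a k + (e q k - e p k)) b = 0" using assms by (intro YZ_neg[of i]) auto
  then show ?thesis by simp
qed

text \<open>Common shape of the two families: \<open>qE h\<close> moves from \<open>h + 1\<close> to
  \<open>h\<close> with \<open>s = - 1\<close>, \<open>qF h\<close> moves from \<open>h\<close> to
  \<open>h + 1\<close> with \<open>s = 1\<close>; the scalar \<open>c\<close> is the power of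
  \<upsilon> determined by the odd exponent.\<close>

lemma act_move:
  assumes pq: "p \<in> {1..CARD('n)}" "q \<in> {1..CARD('n)}" "p \<noteq> q"
    and g: "\<And>\<alpha>. \<rho> g (Xmon \<alpha> b) =
      (c * qint (int (\<alpha> p))) \<cdot> Xmon (\<alpha>(q := \<alpha> q + 1, p := \<alpha> p - 1)) b +
      (\<upsilon> powi (s * int (\<alpha> p)) * qint (int (b p))) \<cdot> Xmon \<alpha> (b(q := b q + 1, p := b p - 1))"
  shows "\<rho> g (YZ a b) = (c * qint (a q + 1)) \<cdot> YZ (\<lambda>k. a k + (e q k - e p k)) b +
    \<upsilon> powi (s * a p) \<cdot> odd_move p q a b"
proof (cases rule: YZ_cases[where 'n = 'n and a = a and b = b])
  case (nat \<alpha>)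
  have Y: "YZ' a b = YZ (\<lambda>i. int (\<alpha> i)) b" using nat by (intro YZ_cong) auto
  have "\<rho> g (YZ a b) = c \<cdot> (qint (int (\<alpha> p)) * inverse (fact_prod TYPE('n) \<alpha>)) \<cdot>
        Xmon (\<alpha>(q := \<alpha> q + 1, p := \<alpha> p - 1)) b +
      \<upsilon> powi (s * int (\<alpha> p)) \<cdot> (qint (int (b p)) * inverse (fact_prod TYPE('n) \<alpha>)) \<cdot>
        Xmon \<alpha> (b(q := b q + 1, p := b p - 1))"
    unfolding Y YZ_nat by (simp only: g lin palg.scale_scale mult_ac)
  also have "\<dots> = c \<cdot> qint (int (\<alpha> q) + 1) \<cdot> YZ (\<lambda>k. int (\<alpha> k) + (e q k - e p k)) b +
      \<upsilon> powi (s * int (\<alpha> p)) \<cdot> odd_move p q (\<lambda>i. int (\<alpha> i)) b"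
    by (simp only: YZ_move[OF pq] odd_move_nat[OF pq b])
  also have "YZ' (\<lambda>k. int (\<alpha> k) + (e q k - e p k)) b = YZ (\<lambda>k. a k + (e q k - e p k)) b"
    using nat by (intro YZ_cong) auto
  also have "odd_move p q (\<lambda>i. int (\<alpha> i)) b = (odd_move p q a b :: 'n A)"
    unfolding odd_move_def using nat nat[OF pq(2)]
    by (intro if_cong refl arg_cong2[where f = "(\<cdot>)"] YZ_cong) auto
  finally show ?thesis by (simp only: nat[OF pq(1)] nat[OF pq(2)] palg.scale_scale)
next
  case (neg i)
  then show ?thesis using pq by (simp add: lin move_neg[of i] odd_move_neg[of i])
qed

lemma act_E:
  assumes h: "h \<in> {1..<CARD('n)}"
  shows "\<rho> (gen (qE h)) (YZ a b) =
    (\<upsilon> powi int (b (h + 1)) * qint (a h + 1)) \<cdot> YZ (\<lambda>k. a k + (e h k - e (h + 1) k)) b +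
    \<upsilon> powi (- 1 * a (h + 1)) \<cdot> odd_move (h + 1) h a b"
  by (rule act_move) (use natural b h in \<open>auto simp: is_natural_action_def\<close>)

lemma act_F:
  assumes h: "h \<in> {1..<CARD('n)}"
  shows "\<rho> (gen (qF h)) (YZ a b) =
    (\<upsilon> powi (- int (b h)) * qint (a (h + 1) + 1)) \<cdot> YZ (\<lambda>k. a k + (e (h + 1) k - e h k)) b +
    \<upsilon> powi (1 * a h) \<cdot> odd_move h (h + 1) a b"
  by (rule act_move) (use natural b h in \<open>auto simp: is_natural_action_def fun_upd_twist\<close>)

text \<open>If the odd variable is present, both terms of the action land on the same monomial: one
  turns it into \<open>qX 1\<close>, the other creates its square, that is \<kappa> times the square
  of \<open>qX 1\<close>. Their coefficients add up to the bracket.\<close>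

lemma act_Kbar1:
  "\<rho> (gen (qKbar 1)) (YZ a b) = (if b 1 = 0 then YZ (\<lambda>k. a k - e 1 k) (b(1 := 1))
    else ((\<upsilon> powi (- a 1) + \<upsilon> * \<kappa> * qint (a 1)) * qint (a 1 + 1)) \<cdot> YZ (\<lambda>k. a k + e 1 k) (b(1 := 0)))"
proof (cases rule: YZ_cases[where 'n = 'n and a = a and b = b])
  case (nat \<alpha>)
  have one: "1 \<in> {1..CARD('n)}" using card by simp
  have Y: "YZ' a b = YZ (\<lambda>i. int (\<alpha> i)) b" using nat by (intro YZ_cong) auto
  have a1: "a 1 = int (\<alpha> 1)" using nat[OF one] .
  have "\<rho> (gen (qKbar 1)) (Xmon \<alpha> b) =
      (\<upsilon> powi (- int (\<alpha> 1)) * qint (int (b 1))) \<cdot> Xmon (\<alpha>(1 := \<alpha> 1 + 1)) (b(1 := b 1 - 1)) +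
      (\<upsilon> powi int (b 1) * qint (int (\<alpha> 1))) \<cdot> Xmon (\<alpha>(1 := \<alpha> 1 - 1)) (b(1 := b 1 + 1))"
    using natural b by (simp add: is_natural_action_def)
  then have *: "\<rho> (gen (qKbar 1)) (YZ a b) =
      (\<upsilon> powi (- int (\<alpha> 1)) * qint (int (b 1))) \<cdot> inverse (fact_prod TYPE('n) \<alpha>) \<cdot> Xmon (\<alpha>(1 := Suc (\<alpha> 1))) (b(1 := b 1 - 1)) +
      \<upsilon> powi int (b 1) \<cdot> (qint (int (\<alpha> 1)) * inverse (fact_prod TYPE('n) \<alpha>)) \<cdot> Xmon (\<alpha>(1 := \<alpha> 1 - 1)) (b(1 := b 1 + 1))"
    unfolding Y YZ_nat by (simp only: lin palg.scale_scale mult_ac) simp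
  have up: "YZ' (\<lambda>k. int (\<alpha> k) + e 1 k) b' = YZ (\<lambda>k. a k + e 1 k) b'" for b'
    using nat by (intro YZ_cong) auto
  have down: "YZ' (\<lambda>k. int (\<alpha> k) - e 1 k) b' = YZ (\<lambda>k. a k - e 1 k) b'" for b'
    using nat by (intro YZ_cong) auto
  show ?thesis
  proof (cases "b 1 = 0")
    case True
    then show ?thesis using * YZ_lower[OF one, of \<alpha> "b(1 := 1)"] down[of "b(1 := 1)"] by simp
  next
    case False
    then have b1: "b 1 = 1" using b[rule_format, of 1] by simp
    have "(qint (int (\<alpha> 1)) * inverse (fact_prod TYPE('n) \<alpha>)) \<cdot> (Xmon (\<alpha>(1 := \<alpha> 1 - 1)) (b(1 := b 1 + 1)) :: 'n A) =
        (\<kappa> * qint (int (\<alpha> 1))) \<cdot> inverse (fact_prod TYPE('n) \<alpha>) \<cdot> Xmon (\<alpha>(1 := Suc (\<alpha> 1))) (b(1 := 0))"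
    \<comment> \<open>For exponent 0 the truncated subtraction yields a wrong monomial, but both
      sides carry the coefficient \<open>qint 0\<close>.\<close>
    proof (cases "\<alpha> 1")
      case (Suc m)
      have "(Xmon (\<alpha>(1 := \<alpha> 1 - 1)) (b(1 := b 1 + 1)) :: 'n A) =
          \<kappa> \<cdot> Xmon (\<alpha>(1 := Suc (\<alpha> 1))) (b(1 := 0))"
      proof -
        have m: "\<alpha> 1 - 1 = m" "Suc (\<alpha> 1) = m + 2" "b 1 + 1 = 2" using Suc b1 by simp_all
        have "(Xmon (\<alpha>(1 := m)) (b(1 := 2)) :: 'n A) =
            \<kappa> \<cdot> Xmon (\<alpha>(1 := m, 1 := (\<alpha>(1 := m)) 1 + 2)) (b(1 := 2, 1 := 0))"
          by (rule Xmon_square[OF one]) simp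
        then show ?thesis by (simp only: m fun_upd_upd fun_upd_same)
      qed
      then show ?thesis by (simp add: mult_ac)
    qed simp
    then have "\<rho> (gen (qKbar 1)) (YZ a b) =
        (\<upsilon> powi (- int (\<alpha> 1)) + \<upsilon> * \<kappa> * qint (int (\<alpha> 1))) \<cdot> inverse (fact_prod TYPE('n) \<alpha>) \<cdot> Xmon (\<alpha>(1 := Suc (\<alpha> 1))) (b(1 := 0))"
      unfolding * by (simp add: b1[unfolded One_nat_def] palg.scale_left_distrib distrib_left mult_ac)
    also have "\<dots> = ((\<upsilon> powi (- int (\<alpha> 1)) + \<upsilon> * \<kappa> * qint (int (\<alpha> 1))) * qint (int (\<alpha> 1) + 1)) \<cdot> YZ (\<lambda>k. a k + e 1 k) (b(1 := 0))"
      by (simp only: YZ_raise[OF one] palg.scale_scale up)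
    finally show ?thesis by (simp only: if_not_P[OF False] a1)
  qed
next
  case (neg i)
  have "qint (a 1 + 1) \<cdot> YZ' (\<lambda>k. a k + e 1 k) (b(1 := 0)) = 0"
  proof (cases "i = 1")
    case True
    then have "a 1 < 0" using neg by simp
    then have "a 1 = - 1 \<or> a 1 + 1 < 0" by linarith
    then show ?thesis using neg True by (auto simp: YZ_neg[of 1])
  qed (use neg in \<open>simp add: YZ_neg[of i]\<close>)
  moreover have "YZ' (\<lambda>k. a k - e 1 k) (b(1 := 1)) = 0" using neg by (intro YZ_neg[of i]) auto
  ultimately show ?thesis using neg(1) by (auto simp: lin)
qed

end

end

section \<open>Sequences of divided monomials along a coordinate direction, and their
  stability\<close>

definition shift :: "nat \<Rightarrow> nat \<Rightarrow> (nat \<Rightarrow> int) \<Rightarrow> (nat \<Rightarrow> nat) \<Rightarrow> int"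
  where "shift n j a b = (\<Sum>i\<in>{1..n} - {j}. a i) + (\<Sum>i = 1..n. int (b i))"

text \<open>The exponents in degree \<open>r\<close> on the line through \<open>a\<close> in direction \<open>j\<close>.\<close>

abbreviation pt :: "nat \<Rightarrow> nat \<Rightarrow> (nat \<Rightarrow> int) \<Rightarrow> (nat \<Rightarrow> nat) \<Rightarrow> nat \<Rightarrow> nat \<Rightarrow> int"
  where "pt n j a b r \<equiv> a(j := int r - shift n j a b)"

text \<open>Those functions of the degree that preserve \<open>lines j\<close> are closed under
  sums, differences and products, so the coefficients of the action can be treated by following
  their syntax.\<close>

definition multiplier :: "(nat \<Rightarrow> 'g::presented palg) set \<Rightarrow> (nat \<Rightarrow> qfield) \<Rightarrow> bool"
  where "multiplier S c \<longleftrightarrow> (\<forall>x\<in>S. (\<lambda>r. c r \<cdot> x r) \<in> S)"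

context natural_action
begin

definition line :: "nat \<Rightarrow> int \<Rightarrow> (nat \<Rightarrow> int) \<Rightarrow> (nat \<Rightarrow> nat) \<Rightarrow> nat \<Rightarrow> 'n A"
  where "line j k a b = (\<lambda>r. \<upsilon> powi (k * int r) \<cdot> YZ (pt CARD('n) j a b r) b)"

definition lines :: "nat \<Rightarrow> (nat \<Rightarrow> 'n A) set"
  where "lines j = hat.span {line j k a b | k a b. \<forall>i. b i \<in> {0, 1}}"

lemma lines_closed:
  "x \<in> lines j \<Longrightarrow> y \<in> lines j \<Longrightarrow> (\<lambda>r. x r + y r) \<in> lines j"
  "x \<in> lines j \<Longrightarrow> (\<lambda>r. c \<cdot> x r) \<in> lines j"
  "(\<lambda>r. 0) \<in> lines j"
  "x \<in> lines j \<Longrightarrow> y \<in> lines j \<Longrightarrow> (\<lambda>r. x r - y r) \<in> lines j"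
  using hat.span_add[of x _ y] hat.span_scale[of x _ c] hat.span_diff[of x _ y] hat.span_zero
  unfolding lines_def hscale_def plus_fun_def fun_diff_def zero_fun_def by auto

lemma line_in_lines: "\<forall>i. b i \<in> {0, 1} \<Longrightarrow> line j k a b \<in> lines j"
  unfolding lines_def by (rule hat.span_base) blast

lemma lines_induct [consumes 1, case_names zero step]:
  assumes "x \<in> lines j" "P (\<lambda>r. 0)"
    "\<And>c k a b y. \<forall>i. b i \<in> {0, 1} \<Longrightarrow> y \<in> lines j \<Longrightarrow> P y \<Longrightarrow> P (\<lambda>r. c \<cdot> line j k a b r + y r)"
  shows "P x"
proof -
  have "x \<in> lines j \<and> P x"
    using assms(1) unfolding lines_def
  proof (induction rule: hat.span_induct_alt)
    case base
    then show ?case using assms(2) lines_closed(3) by (simp add: zero_fun_def lines_def)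
  next
    case (step c x y)
    then obtain k a b where x: "x = line j k a b" "\<forall>i. b i \<in> {0, 1}" by blast
    have "hscale c x + y = (\<lambda>r. c \<cdot> line j k a b r + y r)" by (simp add: x hscale_def fun_eq_iff)
    then show ?case
      using assms(3)[OF x(2)] step lines_closed(1)[OF lines_closed(2)[OF line_in_lines[OF x(2)]], of y]
      by (simp add: lines_def)
  qed
  then show ?thesis ..
qed

lemma multiplier_const: "multiplier (lines j) (\<lambda>r. c)"
  by (simp add: multiplier_def lines_closed)

lemma multiplier_mult: "multiplier (lines j) c \<Longrightarrow> multiplier (lines j) d \<Longrightarrow> multiplier (lines j) (\<lambda>r. c r * d r)"
  by (simp add: multiplier_def flip: palg.scale_scale)

lemma multiplier_add: "multiplier (lines j) c \<Longrightarrow> multiplier (lines j) d \<Longrightarrow> multiplier (lines j) (\<lambda>r. c r + d r)"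
  by (simp add: multiplier_def palg.scale_left_distrib lines_closed)

lemma multiplier_diff: "multiplier (lines j) c \<Longrightarrow> multiplier (lines j) d \<Longrightarrow> multiplier (lines j) (\<lambda>r. c r - d r)"
  by (simp add: multiplier_def palg.scale_left_diff_distrib lines_closed)

text \<open>A power of \<upsilon> linear in the degree only changes the parameter \<open>k\<close>
  of a line; this is the reason for including all integers \<open>k\<close> in
  \<open>lines\<close>.\<close>

lemma multiplier_powi_degree: "multiplier (lines j) (\<lambda>r. \<upsilon> powi (m * int r))"
  unfolding multiplier_def
proof
  fix x assume "x \<in> lines j"
  then show "(\<lambda>r. \<upsilon> powi (m * int r) \<cdot> x r) \<in> lines j"
  proof (induction rule: lines_induct)
    case zero
    then show ?case by (simp add: lines_closed)
  next
    case (step c k a b y)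
    have "(\<lambda>r. \<upsilon> powi (m * int r) \<cdot> (c \<cdot> line j k a b r + y r)) =
        (\<lambda>r. c \<cdot> line j (m + k) a b r + \<upsilon> powi (m * int r) \<cdot> y r)"
      by (simp add: line_def palg.scale_right_distrib distrib_left distrib_right power_int_add mult_ac)
    then show ?case
      using lines_closed(1)[OF lines_closed(2)[OF line_in_lines[OF step(1)]] step(3)] by simp
  qed
qed

lemma multiplier_powi: "multiplier (lines j) (\<lambda>r. \<upsilon> powi (m * pt CARD('n) j a b r i + c))"
proof (cases "i = j")
  case True
  have "(\<lambda>r. \<upsilon> powi (m * pt CARD('n) j a b r i + c)) = (\<lambda>r. \<upsilon> powi (m * int r) * \<upsilon> powi (c - m * shift CARD('n) j a b))"
    by (simp add: True power_int_add[symmetric] algebra_simps)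
  then show ?thesis by (simp only: multiplier_mult multiplier_const multiplier_powi_degree)
qed (simp add: multiplier_const)

lemma multiplier_qint: "multiplier (lines j) (\<lambda>r. qint (pt CARD('n) j a b r i + c))"
proof -
  have "(\<lambda>r. qint (pt CARD('n) j a b r i + c)) = (\<lambda>r. (\<upsilon> powi (1 * pt CARD('n) j a b r i + c) - \<upsilon> powi ((- 1) * pt CARD('n) j a b r i + - c))
      * inverse (\<upsilon> - inverse \<upsilon>))"
    by (simp add: qint_def divide_inverse fun_eq_iff)
  then show ?thesis by (simp only: multiplier_mult multiplier_const multiplier_diff multiplier_powi)
qed

text \<open>The specialised instances provide the literal forms, without factor 1 or summand 0, in
  which exponents occur in the action formulas.\<close>

lemmas multipliers = multiplier_const multiplier_mult multiplier_add multiplier_diff multiplier_qint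
  multiplier_qint[where c = 0, simplified add_0_right]
  multiplier_powi multiplier_powi[where m = 1, simplified mult_1]
  multiplier_powi[where c = 0, simplified add_0_right]
  multiplier_powi[where m = "- 1" and c = 0, simplified mult_minus1 add_0_right]

lemma multiplierD: "multiplier (lines j) c \<Longrightarrow> x \<in> lines j \<Longrightarrow> (\<lambda>r. c r \<cdot> x r) \<in> lines j"
  by (simp add: multiplier_def)

text \<open>The condition on \<open>d\<close> and \<open>b'\<close> keeps the total degree, so
  displacing all exponents amounts to displacing the base point of the line, with the same
  \<open>r\<close>.\<close>

lemma line_shift:
  assumes j: "j \<in> {1..CARD('n)}" and b': "\<forall>i. b' i \<in> {0, 1}"
    and d: "(\<Sum>i = 1..CARD('n). d i) + (\<Sum>i = 1..CARD('n). int (b' i)) = (\<Sum>i = 1..CARD('n). int (b i))"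
  shows "(\<lambda>r. YZ (\<lambda>i. pt CARD('n) j a b r i + d i) b') \<in> lines j"
proof -
  have "shift CARD('n) j (\<lambda>i. a i + d i) b' = shift CARD('n) j a b - d j"
    using d sum.remove[OF finite_atLeastAtMost j, of d] by (simp add: shift_def sum.distrib)
  then have "pt CARD('n) j (\<lambda>i. a i + d i) b' r = (\<lambda>i. pt CARD('n) j a b r i + d i)" for r
    by (auto simp: fun_eq_iff)
  then have "(\<lambda>r. YZ (\<lambda>i. pt CARD('n) j a b r i + d i) b') = line j 0 (\<lambda>i. a i + d i) b'"
    by (simp add: line_def)
  then show ?thesis using line_in_lines[OF b'] by simp
qed

text \<open>The degree is preserved in both nonzero cases: one odd variable replaces another, or two
  odd variables disappear and the even exponent at \<open>q\<close> grows by 2.\<close>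

lemma odd_move_lines:
  assumes j: "j \<in> {1..CARD('n)}" and b: "\<forall>i. b i \<in> {0, 1}"
    and pq: "p \<in> {1..CARD('n)}" "q \<in> {1..CARD('n)}" "p \<noteq> q"
  shows "(\<lambda>r. odd_move p q (pt CARD('n) j a b r) b) \<in> lines j"
proof -
  consider "b p = 0" | "b p = 1" "b q = 0" | "b p = 1" "b q = 1"
    using b[rule_format, of p] b[rule_format, of q] by auto
  then show ?thesis
  proof cases
    case 1
    then show ?thesis by (simp add: odd_move_def lines_closed)
  next
    case 2
    have "(\<Sum>i = 1..CARD('n). int (f i)) = int (f p) + (int (f q) + (\<Sum>i\<in>{1..CARD('n)} - {p} - {q}. int (f i)))" for f :: "nat \<Rightarrow> nat"
      using pq by (simp add: sum.remove[of _ p] sum.remove[of _ q])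
    then have "(\<Sum>i = 1..CARD('n). int ((b(q := 1, p := 0)) i)) = (\<Sum>i = 1..CARD('n). int (b i))"
      using 2 pq(3) by simp
    then have "(\<lambda>r. YZ (\<lambda>i. pt CARD('n) j a b r i + 0) (b(q := 1, p := 0))) \<in> lines j"
      using b by (intro line_shift[OF j]) auto
    then show ?thesis using 2 by (simp add: odd_move_def del: fun_upd_apply)
  next
    case 3
    have "(\<Sum>i = 1..CARD('n). int (f i)) = int (f p) + (int (f q) + (\<Sum>i\<in>{1..CARD('n)} - {p} - {q}. int (f i)))" for f :: "nat \<Rightarrow> nat"
      using pq by (simp add: sum.remove[of _ p] sum.remove[of _ q])
    then have "(\<Sum>i = 1..CARD('n). int ((b(q := 0, p := 0)) i)) + 2 = (\<Sum>i = 1..CARD('n). int (b i))"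
      using 3 pq(3) by simp
    moreover have "(\<Sum>i = 1..CARD('n). 2 * e q i) = 2" using pq(2) by (simp flip: sum_distrib_left)
    ultimately have "(\<lambda>r. YZ (\<lambda>i. pt CARD('n) j a b r i + 2 * e q i) (b(q := 0, p := 0))) \<in> lines j"
      using b by (intro line_shift[OF j]) auto
    then have "(\<lambda>r. (\<kappa> * (qint (pt CARD('n) j a b r q + 1) * qint (pt CARD('n) j a b r q + 2))) \<cdot>
        YZ (\<lambda>i. pt CARD('n) j a b r i + 2 * e q i) (b(q := 0, p := 0))) \<in> lines j"
      by (rule multiplierD[rotated]) (intro multipliers)
    then show ?thesis using 3 by (simp add: odd_move_def del: fun_upd_apply)
  qed
qed

lemma sum_e: "i \<in> {1..CARD('n)} \<Longrightarrow> (\<Sum>k = 1..CARD('n). e i k) = 1"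
  by simp

lemma line_shift_same:
  assumes "j \<in> {1..CARD('n)}" "\<forall>i. b i \<in> {0, 1}" "(\<Sum>i = 1..CARD('n). d i) = 0"
  shows "(\<lambda>r. YZ (\<lambda>i. pt CARD('n) j a b r i + d i) b) \<in> lines j"
  using assms by (intro line_shift) simp_all

definition stab :: "nat \<Rightarrow> 'n U set"
  where "stab j = {u. \<forall>x\<in>lines j. (\<lambda>r. \<rho> u (x r)) \<in> lines j}"

lemma stabI:
  assumes "\<And>a b. \<forall>i. b i \<in> {0, 1} \<Longrightarrow> (\<lambda>r. \<rho> u (YZ (pt CARD('n) j a b r) b)) \<in> lines j"
  shows "u \<in> stab j"
  unfolding stab_def
proof (intro CollectI ballI)
  fix x assume "x \<in> lines j"
  then show "(\<lambda>r. \<rho> u (x r)) \<in> lines j"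
  proof (induction rule: lines_induct)
    case zero
    then show ?case by (simp add: lin lines_closed)
  next
    case (step c k a b y)
    have "(\<lambda>r. \<rho> u (c \<cdot> line j k a b r + y r)) =
        (\<lambda>r. c \<cdot> \<upsilon> powi (k * int r) \<cdot> \<rho> u (YZ (pt CARD('n) j a b r) b) + \<rho> u (y r))"
      by (simp add: line_def lin mult.commute)
    then show ?case
      using lines_closed(1)[OF lines_closed(2)[OF multiplierD[OF multiplier_powi_degree assms[OF step(1)]]] step(3)]
      by simp
  qed
qed

text \<open>The elements preserving \<open>lines j\<close> form a subalgebra, so the generators of
  \<open>U_generated\<close> suffice. For each of them the action consists of multipliers times
  degree-preserving displacements.\<close>

lemma lines_stable:
  assumes j: "j \<in> {1..CARD('n)}"
  shows "u \<in> stab j"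
proof (rule U_generated)
  show "palg.subspace (stab j)"
    by (auto simp: palg.subspace_def stab_def lin lines_closed)
  show "\<And>u w. u \<in> stab j \<Longrightarrow> w \<in> stab j \<Longrightarrow> u * w \<in> stab j" "1 \<in> stab j"
    by (auto simp: stab_def act_mult act_one)
  have base: "(\<lambda>r. YZ (pt CARD('n) j a b r) b) \<in> lines j" if "\<forall>i. b i \<in> {0, 1}" for a b
    using line_shift_same[OF j that, of "\<lambda>_. 0" a] by (simp del: fun_upd_apply)
  fix i assume i: "i \<in> {1..CARD('n)}"
  show "gen (qK i) \<in> stab j"
  proof (rule stabI)
    fix a and b :: "nat \<Rightarrow> nat" assume b: "\<forall>i. b i \<in> {0, 1}"
    show "(\<lambda>r. \<rho> (gen (qK i)) (YZ (pt CARD('n) j a b r) b)) \<in> lines j"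
      unfolding act_K[OF b i] by (intro multiplierD[OF _ base[OF b]] multipliers)
  qed
  show "gen (qKinv i) \<in> stab j"
  proof (rule stabI)
    fix a and b :: "nat \<Rightarrow> nat" assume b: "\<forall>i. b i \<in> {0, 1}"
    have "multiplier (lines j) (\<lambda>r. \<upsilon> powi (- (pt CARD('n) j a b r i + int (b i))))"
      using multiplier_powi[of j "- 1" a b i "- int (b i)"] by simp
    then show "(\<lambda>r. \<rho> (gen (qKinv i)) (YZ (pt CARD('n) j a b r) b)) \<in> lines j"
      unfolding act_Kinv[OF b i] by (rule multiplierD[OF _ base[OF b]])
  qed
next
  fix h assume h: "h \<in> {1..<CARD('n)}"
  then have h': "h \<in> {1..CARD('n)}" "h + 1 \<in> {1..CARD('n)}" "h \<noteq> h + 1" "h + 1 \<noteq> h" by auto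
  have sums: "(\<Sum>k = 1..CARD('n). e h k - e (h + 1) k) = 0" "(\<Sum>k = 1..CARD('n). e (h + 1) k - e h k) = 0"
    by (simp_all only: sum_subtractf sum_e[OF h'(1)] sum_e[OF h'(2)])
  show "gen (qE h) \<in> stab j"
  proof (rule stabI)
    fix a and b :: "nat \<Rightarrow> nat" assume b: "\<forall>i. b i \<in> {0, 1}"
    show "(\<lambda>r. \<rho> (gen (qE h)) (YZ (pt CARD('n) j a b r) b)) \<in> lines j"
      unfolding act_E[OF b h]
      by (intro lines_closed(1) multiplierD[OF _ line_shift_same[OF j b sums(1)]]
          multiplierD[OF _ odd_move_lines[OF j b h'(2,1,4)]] multipliers)
  qed
  show "gen (qF h) \<in> stab j"
  proof (rule stabI)
    fix a and b :: "nat \<Rightarrow> nat" assume b: "\<forall>i. b i \<in> {0, 1}"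
    show "(\<lambda>r. \<rho> (gen (qF h)) (YZ (pt CARD('n) j a b r) b)) \<in> lines j"
      unfolding act_F[OF b h]
      by (intro lines_closed(1) multiplierD[OF _ line_shift_same[OF j b sums(2)]]
          multiplierD[OF _ odd_move_lines[OF j b h'(1,2,3)]] multipliers)
  qed
next
  have one: "1 \<in> {1..CARD('n)}" using card by simp
  show "gen (qKbar 1) \<in> stab j"
  proof (rule stabI)
    fix a and b :: "nat \<Rightarrow> nat" assume b: "\<forall>i. b i \<in> {0, 1}"
    have split: "(\<Sum>i = 1..CARD('n). int (f i)) = int (f 1) + (\<Sum>i\<in>{1..CARD('n)} - {1}. int (f i))" for f :: "nat \<Rightarrow> nat"
      using one by (simp only: sum.remove[of _ 1] finite_atLeastAtMost)
    show "(\<lambda>r. \<rho> (gen (qKbar 1)) (YZ (pt CARD('n) j a b r) b)) \<in> lines j"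
    proof (cases "b 1 = 0")
      case True
      have "(\<lambda>r. YZ (\<lambda>i. pt CARD('n) j a b r i + (- e 1 i)) (b(1 := 1))) \<in> lines j"
      proof (rule line_shift[OF j])
        show "(\<Sum>i = 1..CARD('n). - e 1 i) + (\<Sum>i = 1..CARD('n). int ((b(1 := 1)) i)) = (\<Sum>i = 1..CARD('n). int (b i))"
          unfolding sum_negf sum_e[OF one] split using True by simp
      qed (use b in auto)
      then show ?thesis unfolding act_Kbar1[OF b] by (simp only: True if_True simp_thms add_uminus_conv_diff)
    next
      case False
      then have b1: "b 1 = 1" using b[rule_format, of 1] by simp
      have *: "(\<lambda>r. YZ (\<lambda>i. pt CARD('n) j a b r i + e 1 i) (b(1 := 0))) \<in> lines j"
      proof (rule line_shift[OF j])
        show "(\<Sum>i = 1..CARD('n). e 1 i) + (\<Sum>i = 1..CARD('n). int ((b(1 := 0)) i)) = (\<Sum>i = 1..CARD('n). int (b i))"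
          unfolding sum_e[OF one] split using b1 by simp
      qed (use b in auto)
      show ?thesis unfolding act_Kbar1[OF b] if_not_P[OF False]
        by (intro multiplierD[OF _ *] multipliers)
    qed
  qed
qed

end

section \<open>Products of lines\<close>

text \<open>The product in the completed tensor algebra of sequences indexed by the degree.\<close>

definition hatprod :: "(nat \<Rightarrow> 'g::presented palg) list \<Rightarrow> nat \<Rightarrow> 'g tensor"
  where "hatprod xs r = (\<Sum>ds | length ds = length xs \<and> sum_list ds = r. tens (map2 (\<lambda>x d. x d) xs ds))"

lemma finite_sum_list: "finite {ds :: nat list. length ds = n \<and> sum_list ds = r}"
proof (rule finite_subset)
  show "{ds :: nat list. length ds = n \<and> sum_list ds = r} \<subseteq> {ds. set ds \<subseteq> {..r} \<and> length ds = n}"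
    using member_le_sum_list by fastforce
  show "finite {ds :: nat list. set ds \<subseteq> {..r} \<and> length ds = n}"
    by (rule finite_lists_length_eq) simp
qed

lemma hatprod_multilinear: "multilinear hscale hscale hatprod"
proof -
  have split: "\<exists>ds1 d ds2. ds = ds1 @ d # ds2 \<and> length ds1 = length xs \<and> length ds2 = length ys"
    if "length ds = length (xs @ x # ys)" for ds :: "nat list" and xs ys and x :: "nat \<Rightarrow> 'a palg"
  proof (intro exI conjI)
    show "ds = take (length xs) ds @ ds ! length xs # drop (Suc (length xs)) ds"
      using that by (intro id_take_nth_drop) simp
  qed (use that in simp_all)
  show ?thesis unfolding multilinear_def
  proof (intro conjI allI ext)
    fix xs ys and x y :: "nat \<Rightarrow> 'a palg" and c r
    let ?D = "{ds :: nat list. length ds = length (xs @ x # ys) \<and> sum_list ds = r}"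
    let ?t = "\<lambda>x ds. tens (map2 (\<lambda>x d. x d) (xs @ x # ys) ds)"
    have h: "hatprod (xs @ z # ys) r = (\<Sum>ds\<in>?D. ?t z ds)" for z
      by (simp add: hatprod_def)
    have add: "?t (x + y) ds = ?t x ds + ?t y ds" and scale: "?t (hscale c x) ds = c \<cdot> ?t x ds" if "ds \<in> ?D" for ds
    proof -
      from that have "length ds = length (xs @ x # ys)" by simp
      from split[OF this] obtain ds1 d ds2
        where "ds = ds1 @ d # ds2" "length ds1 = length xs" "length ds2 = length ys" by blast
      then show "?t (x + y) ds = ?t x ds + ?t y ds" "?t (hscale c x) ds = c \<cdot> ?t x ds"
        by (simp_all add: hscale_def multilinear_add[OF tens_multilinear] multilinear_scale[OF tens_multilinear])
    qed
    show "hatprod (xs @ (x + y) # ys) r = (hatprod (xs @ x # ys) + hatprod (xs @ y # ys)) r"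
    proof -
      have "hatprod (xs @ (x + y) # ys) r = (\<Sum>ds\<in>?D. ?t x ds + ?t y ds)"
        unfolding h by (intro sum.cong refl add)
      then show ?thesis by (simp only: sum.distrib h[symmetric] plus_fun_apply)
    qed
    show "hatprod (xs @ hscale c x # ys) r = hscale c (hatprod (xs @ x # ys)) r"
      unfolding hscale_def[of c "hatprod _"] h palg.scale_sum_right by (intro sum.cong refl scale)
  qed
qed

lemma hatprod_zero: "(\<lambda>r. 0) \<in> set xs \<Longrightarrow> hatprod xs = (\<lambda>r. 0)"
proof -
  assume "(\<lambda>r. 0) \<in> set xs"
  then obtain us ws where xs: "xs = us @ (\<lambda>r. 0) # ws" by (meson split_list)
  show ?thesis
    using multilinear_scale[OF hatprod_multilinear, of us 0 "\<lambda>r. 0" ws] unfolding xs by (simp add: hscale_def)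
qed

lemma tens_scale: "tens (map (\<lambda>j. c j \<cdot> v j) js) = (\<Prod>j\<leftarrow>js. c j) \<cdot> tens (map v js)"
proof (induction js)
  case (Cons j js)
  then show ?case
    by (simp add: tens_Cons[of "c j \<cdot> v j" "map (\<lambda>j. c j \<cdot> v j) js"] tens_Cons[of "v j" "map v js"] plin_scale[OF tens_single_plin]
        pscale_mult_left pscale_mult_right mult.commute)
qed simp

lemma tens_zero: "0 \<in> set xs \<Longrightarrow> tens xs = 0"
proof -
  assume "0 \<in> set xs"
  then obtain us ws where "xs = us @ 0 # ws" by (meson split_list)
  then show ?thesis using multilinear_scale[OF tens_multilinear, of us 0 0 ws] by simp
qed

text \<open>Each sequence has the same parity in all degrees, so the sign from
  \<open>word_act_homogeneous\<close> is common to all summands \<open>ds\<close> and all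
  \<open>r\<close>.\<close>

lemma (in super_action) tact_hatprod:
  assumes gs: "list_all2 (\<lambda>g p. g \<in> homogeneous p) gs ps"
    and xs: "list_all2 (\<lambda>x q. \<forall>r. x r \<in> homogeneous q) xs qs" and len: "length xs = length gs"
  shows "\<exists>\<epsilon>. (\<lambda>r. tact (tens gs) (hatprod xs r)) = hscale \<epsilon> (hatprod (map2 (\<lambda>g x r. \<rho> g (x r)) gs xs))"
proof -
  have "length qs = length ps" using assms by (auto dest!: list_all2_lengthD)
  from word_act_homogeneous[OF gs this] obtain \<epsilon> where
    e: "\<And>vs. list_all2 (\<lambda>v q. v \<in> homogeneous q) vs qs \<Longrightarrow> word_act \<rho> gs vs = \<epsilon> \<cdot> tens (map2 \<rho> gs vs)"
    by blast
  have "tact (tens gs) (hatprod xs r) = \<epsilon> \<cdot> hatprod (map2 (\<lambda>g x r. \<rho> g (x r)) gs xs) r" for r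
  proof -
    have "tact (tens gs) (hatprod xs r) = (\<Sum>ds | length ds = length xs \<and> sum_list ds = r.
        word_act \<rho> gs (map2 (\<lambda>x d. x d) xs ds))"
      unfolding hatprod_def by (simp add: plin_sum[OF tact_plin] tact_tens)
    also have "\<dots> = (\<Sum>ds | length ds = length xs \<and> sum_list ds = r.
        \<epsilon> \<cdot> tens (map2 (\<lambda>x d. x d) (map2 (\<lambda>g x r. \<rho> g (x r)) gs xs) ds))"
    proof (intro sum.cong refl)
      fix ds assume "ds \<in> {ds. length ds = length xs \<and> sum_list ds = r}"
      then have l: "length ds = length xs" by simp
      have "list_all2 (\<lambda>v q. v \<in> homogeneous q) (map2 (\<lambda>x d. x d) xs ds) qs"
        using xs l by (simp add: list_all2_conv_all_nth)
      moreover have "map2 \<rho> gs (map2 (\<lambda>x d. x d) xs ds) = map2 (\<lambda>x d. x d) (map2 (\<lambda>g x r. \<rho> g (x r)) gs xs) ds"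
        by (rule nth_equalityI) (simp_all add: l len)
      ultimately show "word_act \<rho> gs (map2 (\<lambda>x d. x d) xs ds) =
          \<epsilon> \<cdot> tens (map2 (\<lambda>x d. x d) (map2 (\<lambda>g x r. \<rho> g (x r)) gs xs) ds)"
        using e by simp
    qed
    also have "\<dots> = \<epsilon> \<cdot> hatprod (map2 (\<lambda>g x r. \<rho> g (x r)) gs xs) r"
      by (simp add: hatprod_def palg.scale_sum_right len)
    finally show ?thesis .
  qed
  then show ?thesis unfolding hscale_def by blast
qed

section \<open>Parity and degree of columns; A(j) as a product of lines\<close>

lemma sum_list_upt: "(\<Sum>i\<leftarrow>[1..<Suc n]. f i) = (\<Sum>i = 1..n. f i)"
  by (simp add: sum.distinct_set_conv_list[symmetric] atLeastLessThanSuc_atLeastAtMost del: upt_Suc)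

lemma prod_list_upt: "(\<Prod>i\<leftarrow>[1..<Suc n]. f i) = (\<Prod>i = 1..n. f i)"
  by (simp add: prod.distinct_set_conv_list[symmetric] atLeastLessThanSuc_atLeastAtMost del: upt_Suc)

definition odd_count :: "nat \<Rightarrow> (nat \<Rightarrow> nat) \<Rightarrow> bit"
  where "odd_count n b = (\<Sum>i = 1..n. of_nat (b i))"

lemma Xmon_homogeneous: "(Xmon a b :: 'n A) \<in> homogeneous (odd_count CARD('n) b)"
proof -
  have pow: "x ^ m \<in> homogeneous (of_nat m * p)" if "x \<in> homogeneous p" for x :: "'n A" and p m
  proof (induction m)
    case (Suc m)
    show ?case using homogeneous_mult[OF that Suc]
      by (simp only: of_nat_Suc distrib_right mult_1_left power_Suc)
  qed (simp add: one_homogeneous)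
  have prod: "(\<Prod>i\<leftarrow>xs. f i) \<in> homogeneous (\<Sum>i\<leftarrow>xs. q i)" if "\<And>i. f i \<in> homogeneous (q i)"
    for f :: "nat \<Rightarrow> 'n A" and q xs
  proof (induction xs)
    case (Cons i xs)
    show ?case using homogeneous_mult[OF that Cons, of i] by (simp only: list.map prod_list.Cons sum_list.Cons)
  qed (simp add: one_homogeneous)
  have "gen (qX i) ^ a i \<in> (homogeneous 0 :: 'n A set)" for i
    using pow[OF gen_homogeneous[of "qX i"], of "a i"] by (simp only: gen_parity_agen.simps mult_zero_right)
  then have "(\<Prod>i\<leftarrow>xs. gen (qX i) ^ a i :: 'n A) \<in> homogeneous (\<Sum>i\<leftarrow>xs. 0)" for xs
    by (rule prod)
  moreover have "gen (qXbar i) ^ b i \<in> (homogeneous (of_nat (b i)) :: 'n A set)" for i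
    using pow[OF gen_homogeneous[of "qXbar i"], of "b i"] by (simp only: gen_parity_agen.simps mult_1_right)
  then have "(\<Prod>i\<leftarrow>xs. gen (qXbar i) ^ b i :: 'n A) \<in> homogeneous (\<Sum>i\<leftarrow>xs. of_nat (b i))" for xs
    by (rule prod)
  ultimately have "(Xmon a b :: 'n A) \<in> homogeneous (0 + (\<Sum>i\<leftarrow>[1..<Suc CARD('n)]. of_nat (b i)))"
    unfolding Xmon_def by (intro homogeneous_mult) (simp_all del: upt_Suc)
  then show ?thesis
    by (simp only: odd_count_def sum_list_upt add_0_left)
qed

lemma YZ_homogeneous: "(YZ a b :: 'n A) \<in> homogeneous (odd_count CARD('n) b)"
  by (simp add: YZ_def homogeneous_closed Xmon_homogeneous)

lemma smatrix_parity_eq: "smatrix_parity n A = (\<Sum>j = 1..n. odd_count n (\<lambda>i. snd A i j))"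
  unfolding smatrix_parity_def odd_count_def by (subst sum.swap) simp

definition column_sum :: "nat \<Rightarrow> smatrix \<Rightarrow> nat \<Rightarrow> nat"
  where "column_sum n A j = (\<Sum>i = 1..n. fst A i j + snd A i j)"

lemma entry_sum_add_diag:
  "entry_sum n (add_diag A l) = (\<Sum>j = 1..n. l j + column_sum n A j)"
proof -
  have "(\<Sum>i = 1..n. fst (add_diag A l) i j + snd (add_diag A l) i j) = l j + column_sum n A j"
    if "j \<in> {1..n}" for j
  proof -
    have "(\<Sum>i = 1..n. if i = j then l i else 0) = l j" using that by simp
    then show ?thesis by (simp add: add_diag_def column_sum_def sum.distrib)
  qed
  then show ?thesis unfolding entry_sum_def by (subst sum.swap) simp
qed

lemma upsilon_powi_sum: "\<upsilon> powi (\<Sum>j\<in>S. f j) = (\<Prod>j\<in>S. \<upsilon> powi (f j))"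
  by (induction S rule: infinite_finite_induct) (simp_all add: power_int_add)

context natural_action
begin

lemma line_zero: "i \<in> {1..CARD('n)} \<Longrightarrow> i \<noteq> j \<Longrightarrow> a i < 0 \<Longrightarrow> line j k a b = (\<lambda>r. 0)"
  by (simp add: line_def YZ_neg[of i])

lemma line_cong:
  assumes "\<And>i. i \<in> {1..CARD('n)} \<Longrightarrow> i \<noteq> j \<Longrightarrow> a i = a' i" "\<And>i. i \<in> {1..CARD('n)} \<Longrightarrow> b i = b' i"
  shows "line j k a b = line j k a' b'"
proof -
  have "shift CARD('n) j a b = shift CARD('n) j a' b'"
    unfolding shift_def using assms by (intro arg_cong2[where f = "(+)"] sum.cong) auto
  then have "YZ' (pt CARD('n) j a b r) b = YZ (pt CARD('n) j a' b' r) b'" for r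
    using assms by (intro YZ_cong) auto
  then show ?thesis by (simp add: line_def)
qed

definition hom_lines :: "nat \<Rightarrow> bit \<Rightarrow> (nat \<Rightarrow> 'n A) set"
  where "hom_lines j p = hat.span {line j k a b | k a b. (\<forall>i. b i \<in> {0, 1}) \<and> odd_count CARD('n) b = p}"

lemma line_homogeneous: "line j k a b r \<in> homogeneous (odd_count CARD('n) b)"
  by (simp add: line_def homogeneous_closed YZ_homogeneous)

lemma hom_lines_subset: "hom_lines j p \<subseteq> lines j"
  unfolding hom_lines_def lines_def by (rule hat.span_mono) blast

lemma hom_lines_homogeneous: "x \<in> hom_lines j p \<Longrightarrow> x r \<in> homogeneous p"
  unfolding hom_lines_def
proof (induction rule: hat.span_induct_alt)
  case (step c x y)
  then obtain k a b where "x = line j k a b" "odd_count CARD('n) b = p" by blast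
  then have "x r \<in> homogeneous p" using line_homogeneous[of j k a b r] by simp
  then show ?case using step by (simp add: hscale_def homogeneous_closed)
qed (simp add: homogeneous_closed)

lemma lines_part: "x \<in> lines j \<Longrightarrow> (\<lambda>r. part p (x r)) \<in> hom_lines j p"
proof (induction rule: lines_induct)
  case zero
  then show ?case using hat.span_zero by (simp add: hom_lines_def lin zero_fun_def)
next
  case (step c k a b y)
  have "(\<lambda>r. part p (line j k a b r)) \<in> hom_lines j p"
  proof (cases "odd_count CARD('n) b = p")
    case True
    have "part p (line j k a b r) = line j k a b r" for r
      using part_homogeneous[OF line_homogeneous, of p j k a b r] True by simp
    then show ?thesis unfolding hom_lines_def using step(1) True by (auto intro!: hat.span_base)
  next
    case False
    have "part p (line j k a b r) = 0" for r
      using part_homogeneous[OF line_homogeneous, of p j k a b r] False by simp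
    then have "(\<lambda>r. part p (line j k a b r)) = 0" by (simp add: fun_eq_iff)
    then show ?thesis by (simp add: hom_lines_def hat.span_zero)
  qed
  moreover have "(\<lambda>r. part p (c \<cdot> line j k a b r + y r)) =
      hscale c (\<lambda>r. part p (line j k a b r)) + (\<lambda>r. part p (y r))"
    by (simp add: lin hscale_def fun_eq_iff)
  ultimately show ?case using step(3) unfolding hom_lines_def by (simp add: hat.span_add hat.span_scale)
qed

text \<open>Stability of \<open>lines j\<close> loses track of the parity. It is restored by
  projecting to the component \<open>p + q\<close>, which leaves the sequence unchanged because
  every term is homogeneous of that parity.\<close>

lemma hom_lines_act:
  assumes "j \<in> {1..CARD('n)}" "u \<in> homogeneous p" "x \<in> hom_lines j q"
  shows "(\<lambda>r. \<rho> u (x r)) \<in> hom_lines j (p + q)"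
proof -
  have "(\<lambda>r. \<rho> u (x r)) \<in> lines j"
    using lines_stable[OF assms(1), of u] assms(3) hom_lines_subset by (auto simp: stab_def)
  moreover have "part (p + q) (\<rho> u (x r)) = \<rho> u (x r)" for r
    by (simp only: part_homogeneous[OF act_homogeneous[OF assms(2) hom_lines_homogeneous[OF assms(3)]]] simp_thms if_True)
  ultimately show ?thesis using lines_part[of "\<lambda>r. \<rho> u (x r)" j "p + q"] by (simp only:)
qed

abbreviation cols :: "smatrix \<Rightarrow> (nat \<Rightarrow> int) \<Rightarrow> (nat \<Rightarrow> 'n A) list"
  where "cols A v \<equiv> map (\<lambda>j. line j (v j) (\<lambda>i. int (fst A i j)) (\<lambda>i. snd A i j)) [1..<Suc CARD('n)]"

text \<open>The degree of column \<open>j\<close> is \<open>l j\<close> plus the sum of the fixed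
  entries of that column, so degree lists correspond to diagonals \<open>l\<close>; the others
  contribute zero. The weight of a line is taken at the whole degree of the column, while
  \<open>Aj\<close> uses only \<open>l j\<close>; the fixed part produces the scalar.\<close>

lemma hatprod_cols:
  assumes A: "A \<in> smatrices' CARD('n)"
  shows "hatprod (cols A v) = hscale (\<upsilon> powi (\<Sum>j = 1..CARD('n). v j * int (column_sum CARD('n) A j))) (Aj A v)"
proof
  fix r
  let ?n = "CARD('n)"
  let ?s = "column_sum ?n A" and ?js = "[1..<Suc ?n]"
  let ?D = "{ds :: nat list. length ds = length (cols A v) \<and> sum_list ds = r}"
  let ?L = "{l \<in> nat_vectors ?n. entry_sum ?n (add_diag A l) = r}"
  let ?h = "\<lambda>l. map (\<lambda>j. l j + ?s j) ?js"
  let ?t = "\<lambda>ds. tens (map2 (\<lambda>x d. x d) (cols A v) ds)"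
  have diag: "fst A j j = 0" for j using A by (auto simp: smatrices'_def)
  have shift: "shift ?n j (\<lambda>i. int (fst A i j)) (\<lambda>i. snd A i j) = int (?s j)" if "j \<in> {1..?n}" for j
    using diag[of j] sum.remove[OF finite_atLeastAtMost that, of "\<lambda>i. fst A i j"]
    by (simp add: shift_def column_sum_def sum.distrib)
  have js: "length ?js = ?n" "\<And>m. m < ?n \<Longrightarrow> ?js ! m = Suc m" "set ?js = {1..?n}"
    by (auto simp del: upt_Suc)
  have tl: "?t (?h l) = (\<upsilon> powi (\<Sum>j = 1..?n. v j * int (?s j)) * \<upsilon> powi (\<Sum>i = 1..?n. int (l i) * v i)) \<cdot>
      Xmat (add_diag A l)" for l
  proof -
    have "line j (v j) (\<lambda>i. int (fst A i j)) (\<lambda>i. snd A i j) (l j + ?s j) =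
        \<upsilon> powi (v j * int (?s j) + int (l j) * v j) \<cdot> Ycol (add_diag A l) j" if "j \<in> {1..?n}" for j
      unfolding line_def Ycol_eq_YZ shift[OF that]
      by (intro arg_cong2[where f = "(\<cdot>)"] YZ_cong) (auto simp: algebra_simps add_diag_def diag)
    then have "map2 (\<lambda>x d. x d) (cols A v) (?h l) =
        map (\<lambda>j. \<upsilon> powi (v j * int (?s j) + int (l j) * v j) \<cdot> Ycol (add_diag A l) j) ?js"
      by (intro nth_equalityI) (simp_all add: js del: upt_Suc)
    then show ?thesis
      by (simp only: tens_scale prod_list_upt Xmat_def upsilon_powi_sum prod.distrib power_int_add upsilon_nonzero simp_thms)
  qed
  have sub: "?h ` ?L \<subseteq> ?D"
  proof (intro image_subsetI CollectI conjI)
    fix l assume "l \<in> ?L"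
    then have "sum_list (?h l) = entry_sum ?n (add_diag A l)" "entry_sum ?n (add_diag A l) = r"
      by (simp_all only: entry_sum_add_diag sum_list_upt mem_Collect_eq)
    then show "sum_list (?h l) = r" by (rule trans)
  qed (simp only: length_map)
  have "sum ?t ?D = sum ?t (?h ` ?L)"
  proof (rule sum.mono_neutral_right[OF finite_sum_list sub], intro ballI)
    fix ds assume ds: "ds \<in> ?D - ?h ` ?L"
    then have len: "length ds = ?n" by (simp del: upt_Suc)
    have "\<exists>m<?n. ds ! m < ?s (Suc m)"
    proof (rule ccontr)
      assume neg: "\<not> (\<exists>m<?n. ds ! m < ?s (Suc m))"
      \<comment> \<open>If no degree were too small, subtracting the fixed column sums would give a
        diagonal that maps to \<open>ds\<close>. List positions start at 0, columns at 1.\<close>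
      define l where "l j = (if j \<in> {1..?n} then ds ! (j - 1) - ?s j else 0)" for j
      have h: "?h l = ds"
      proof (rule nth_equalityI)
        fix m assume "m < length (?h l)"
        then have m: "m < ?n" by (simp only: length_map js)
        then have "?s (Suc m) \<le> ds ! m" using neg by (meson not_le)
        with m show "?h l ! m = ds ! m" by (simp add: js l_def del: upt_Suc)
      qed (simp only: length_map js len)
      have "entry_sum ?n (add_diag A l) = sum_list (?h l)"
        by (simp only: entry_sum_add_diag sum_list_upt)
      then have "l \<in> ?L" using ds unfolding h by (simp add: nat_vectors_def l_def)
      with h ds show False by blast
    qed
    then obtain m where m: "m < ?n" "ds ! m < ?s (Suc m)" by blast
    then have j: "Suc m \<in> {1..?n}" by simp
    have "map2 (\<lambda>x d. x d) (cols A v) ds ! m = 0"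
      using m len by (simp add: js line_def YZ_neg[OF j] shift[OF j] del: upt_Suc)
    then have "0 \<in> set (map2 (\<lambda>x d. x d) (cols A v) ds)"
      using m(1) len by (metis (no_types, lifting) js(1) length_map length_zip min.idem nth_mem)
    then show "?t ds = 0" by (rule tens_zero)
  qed
  also have "\<dots> = (\<Sum>l\<in>?L. ?t (?h l))"
  proof (rule sum.reindex_cong[of ?h])
    show "inj_on ?h ?L"
    proof (rule inj_onI)
      fix l l' assume l: "l \<in> ?L" "l' \<in> ?L" and eq: "?h l = ?h l'"
      have "l i = l' i" for i
      proof (cases "i \<in> {1..?n}")
        case True
        then show ?thesis using eq by (auto simp: js simp del: upt_Suc)
      qed (use l in \<open>auto simp: nat_vectors_def\<close>)
      then show "l = l'" ..
    qed
  qed simp_all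
  finally show "hatprod (cols A v) r = hscale (\<upsilon> powi (\<Sum>j = 1..?n. v j * int (?s j))) (Aj A v) r"
    unfolding hatprod_def tl by (simp add: hscale_def Aj_def palg.scale_sum_right)
qed

end

section \<open>Stability of the span of the A(j) under factorwise action\<close>

lemma smatrices_01: "A \<in> smatrices n \<Longrightarrow> snd A i j \<in> {0, 1}"
  by (cases A) (simp only: smatrices_def mem_Collect_eq prod.case snd_conv)

lemma smatrices'_subset: "smatrices' n \<subseteq> smatrices n"
  by (auto simp: smatrices'_def)

context natural_action
begin

text \<open>By multilinearity it suffices to multiply lines, and a product of lines is either zero
  or a scalar multiple of some \<open>Aj A v\<close> whose matrix can be read off.\<close>

lemma hatprod_hom_lines:
  assumes len: "length xs = CARD('n)" and xs: "\<And>m. m < CARD('n) \<Longrightarrow> xs ! m \<in> hom_lines (Suc m) (p (Suc m))"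
  shows "hatprod xs \<in> VV_part (\<Sum>j = 1..CARD('n). p j)"
proof (rule multilinear_span[OF hat.vector_space_axioms hat.vector_space_axioms hatprod_multilinear])
  let ?n = "CARD('n)"
  let ?S = "\<lambda>j. {line j k a b | k a b. (\<forall>i. b i \<in> {0, 1}) \<and> odd_count ?n b = p j}"
  have js: "length [1..<Suc ?n] = ?n" "\<And>m. m < ?n \<Longrightarrow> [1..<Suc ?n] ! m = Suc m" "set [1..<Suc ?n] = {1..?n}"
    by (auto simp del: upt_Suc)
  show "hat.subspace (VV_part (\<Sum>j = 1..?n. p j) :: (nat \<Rightarrow> 'n agen tensor) set)"
    by (simp add: VV_part_def)
  show "list_all2 (\<lambda>x S. x \<in> hat.span S) xs (map ?S [1..<Suc ?n])"
    using len xs by (simp add: list_all2_conv_all_nth js hom_lines_def del: upt_Suc)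
  fix ys assume "list_all2 (\<in>) ys (map ?S [1..<Suc ?n])"
  note all = this
  have ys: "length ys = ?n"
    using list_all2_lengthD[OF all] by (simp only: length_map js)
  have ysS: "ys ! m \<in> ?S (Suc m)" if "m < ?n" for m
    using list_all2_nthD[OF all, of m] that by (simp only: ys nth_map js)
  have "\<forall>m<?n. \<exists>k a b. ys ! m = line (Suc m) k a b \<and> (\<forall>i. b i \<in> {0, 1}) \<and> odd_count ?n b = p (Suc m)"
    using ysS by blast
  then obtain k a b where ysm: "\<And>m. m < ?n \<Longrightarrow> ys ! m = line (Suc m) (k m) (a m) (b m)"
    and b: "\<And>m i. m < ?n \<Longrightarrow> b m i \<in> {0, 1}" and p: "\<And>m. m < ?n \<Longrightarrow> odd_count ?n (b m) = p (Suc m)"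
    by metis
  show "hatprod ys \<in> VV_part (\<Sum>j = 1..?n. p j)"
  \<comment> \<open>Exponents outside the free direction are constant along a line, so a negative
    one annihilates the whole factor and hence the product.\<close>
  proof (cases "\<exists>m<?n. \<exists>i\<in>{1..?n}. i \<noteq> Suc m \<and> a m i < 0")
    case True
    then obtain m i where "m < ?n" "i \<in> {1..?n}" "i \<noteq> Suc m" "a m i < 0" by blast
    then have "ys ! m = (\<lambda>r. 0)" using ysm[of m] line_zero[of i "Suc m" "a m"] by simp
    then have "(\<lambda>r. 0) \<in> set ys" using \<open>m < ?n\<close> ys by (metis nth_mem)
    then have "hatprod ys = 0" by (simp add: hatprod_zero zero_fun_def)
    then show ?thesis by (simp add: VV_part_def hat.span_zero)
  next
    case False
    let ?I = "{1..?n}"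
    have nn: "0 \<le> a m i" if "m < ?n" "i \<in> ?I" "i \<noteq> Suc m" for m i
      using False that by (meson not_le)
    \<comment> \<open>The even diagonal is set to zero because it is the free exponent of the
      corresponding line; the index \<open>j - 1\<close> converts columns to list positions.\<close>
    define A :: smatrix where "A = (\<lambda>i j. if i \<in> ?I \<and> j \<in> ?I \<and> i \<noteq> j then nat (a (j - 1) i) else 0,
        \<lambda>i j. if i \<in> ?I \<and> j \<in> ?I then b (j - 1) i else 0)"
    define v where "v j = (if j \<in> ?I then k (j - 1) else 0)" for j
    have b01: "snd A i j \<in> {0, 1}" for i j
      using b[of "j - 1" i] by (auto simp: A_def)
    have A: "A \<in> smatrices' ?n"
      using b01 by (auto simp: smatrices'_def smatrices_def A_def)
    have v: "v \<in> int_vectors ?n" by (simp add: int_vectors_def v_def)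
    have "ys = cols A v"
    proof (rule nth_equalityI)
      fix m assume "m < length ys"
      then have m: "m < ?n" using ys by simp
      have "line (Suc m) (k m) (a m) (b m) = line (Suc m) (v (Suc m)) (\<lambda>i. int (fst A i (Suc m))) (\<lambda>i. snd A i (Suc m))"
        unfolding v_def using m nn[OF m]
        by (subst line_cong[of "Suc m" "a m" "\<lambda>i. int (fst A i (Suc m))" "b m" "\<lambda>i. snd A i (Suc m)"])
          (auto simp: A_def not_less)
      then show "ys ! m = cols A v ! m" using m ysm by (simp add: js del: upt_Suc)
    qed (simp only: length_map js ys)
    moreover have "smatrix_parity ?n A = (\<Sum>j = 1..?n. p j)"
      unfolding smatrix_parity_eq
    proof (intro sum.cong refl)
      fix j assume j: "j \<in> ?I"
      have "odd_count ?n (\<lambda>i. snd A i j) = odd_count ?n (b (j - 1))"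
        unfolding odd_count_def using j by (intro sum.cong) (auto simp: A_def)
      also have "\<dots> = p (Suc (j - 1))" using j by (intro p) auto
      finally show "odd_count ?n (\<lambda>i. snd A i j) = p j" using j by simp
    qed
    ultimately show ?thesis
      unfolding VV_part_def using A v
      by (simp only: hatprod_cols) (intro hat.span_scale hat.span_base, blast)
  qed
qed

lemma Aj_cols:
  assumes "A \<in> smatrices' CARD('n)"
  shows "\<exists>c. Aj A v = hscale c (hatprod (cols A v))"
proof -
  let ?c = "\<upsilon> powi (\<Sum>j = 1..CARD('n). v j * int (column_sum CARD('n) A j))"
  have "Aj A v = hscale (inverse ?c * ?c) (Aj A v)" by simp
  also have "\<dots> = hscale (inverse ?c) (hatprod (cols A v))"
    unfolding hatprod_cols[OF assms] by (rule hat.scale_scale[symmetric])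
  finally show ?thesis by blast
qed

lemma cols_hom_lines:
  assumes A: "A \<in> smatrices' CARD('n)" and m: "m < CARD('n)"
  shows "cols A v ! m \<in> hom_lines (Suc m) (odd_count CARD('n) (\<lambda>i. snd A i (Suc m)))"
proof -
  have "cols A v ! m = line (Suc m) (v (Suc m)) (\<lambda>i. int (fst A i (Suc m))) (\<lambda>i. snd A i (Suc m))"
    using m by (simp del: upt_Suc)
  moreover have "snd A i (Suc m) \<in> {0, 1}" for i
    using A smatrices'_subset smatrices_01 by blast
  ultimately show ?thesis unfolding hom_lines_def by (intro hat.span_base) blast
qed

text \<open>Up to a scalar the word acts on each column separately, each factor stays within the
  lines of its own direction, and \<open>hatprod_hom_lines\<close> leads back to the span. Parities
  add up column by column.\<close>

lemma tact_hom_Aj: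
  assumes A: "A \<in> smatrices' CARD('n)" and gs: "length gs = CARD('n)"
    "list_all2 (\<lambda>g p. g \<in> homogeneous p) gs ps"
  shows "(\<lambda>r. tact (tens gs) (Aj A v r)) \<in> VV_part (sum_list ps + smatrix_parity CARD('n) A)"
proof -
  let ?n = "CARD('n)"
  let ?q = "\<lambda>j. odd_count ?n (\<lambda>i. snd A i j)"
  let ?xs = "cols A v"
  have len: "length ?xs = ?n" by (simp del: upt_Suc)
  obtain c where c: "Aj A v = hscale c (hatprod ?xs)" using Aj_cols[OF A] by blast
  have "list_all2 (\<lambda>x q. \<forall>r. x r \<in> homogeneous q) ?xs (map (\<lambda>m. ?q (Suc m)) [0..<?n])"
  proof (rule list_all2_all_nthI)
    fix m assume "m < length ?xs"
    then have m: "m < ?n" by (simp only: len)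
    then have "map (\<lambda>m. ?q (Suc m)) [0..<?n] ! m = ?q (Suc m)" by simp
    then show "\<forall>r. (?xs ! m) r \<in> homogeneous (map (\<lambda>m. ?q (Suc m)) [0..<?n] ! m)"
      using hom_lines_homogeneous[OF cols_hom_lines[OF A m]] by (simp only:) blast
  qed (simp only: len length_map length_upt diff_zero)
  from tact_hatprod[OF gs(2) this] obtain \<epsilon>
    where e: "(\<lambda>r. tact (tens gs) (hatprod ?xs r)) = hscale \<epsilon> (hatprod (map2 (\<lambda>g x r. \<rho> g (x r)) gs ?xs))"
    using gs(1) len by auto
  have ps: "length ps = ?n" using gs by (auto dest: list_all2_lengthD)
  have "hatprod (map2 (\<lambda>g x r. \<rho> g (x r)) gs ?xs) \<in> VV_part (\<Sum>j = 1..?n. ps ! (j - 1) + ?q j)"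
  proof (rule hatprod_hom_lines)
    fix m assume m: "m < ?n"
    have "(\<lambda>r. \<rho> (gs ! m) ((?xs ! m) r)) \<in> hom_lines (Suc m) (ps ! m + ?q (Suc m))"
      using gs m by (intro hom_lines_act cols_hom_lines[OF A]) (auto simp: list_all2_conv_all_nth)
    then show "map2 (\<lambda>g x r. \<rho> g (x r)) gs ?xs ! m \<in> hom_lines (Suc m) (ps ! (Suc m - 1) + ?q (Suc m))"
      using m gs(1) len by (simp only: nth_map nth_zip length_zip length_map min.idem prod.case diff_Suc_1)
  qed (simp add: gs del: upt_Suc)
  moreover have "(\<Sum>j = 1..?n. ps ! (j - 1) + ?q j) = sum_list ps + smatrix_parity ?n A"
  proof -
    have "(\<Sum>j = 1..?n. ps ! (j - 1)) = sum_list ps"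
      unfolding sum_list_sum_nth ps by (rule sum.reindex_bij_witness[of _ Suc "\<lambda>j. j - 1"]) auto
    then show ?thesis by (simp only: sum.distrib smatrix_parity_eq)
  qed
  moreover have "(\<lambda>r. tact (tens gs) (Aj A v r)) = hscale c (\<lambda>r. tact (tens gs) (hatprod ?xs r))"
    by (simp add: c hscale_def plin_scale[OF tact_plin])
  ultimately show ?thesis unfolding e VV_part_def by (simp only: hat.span_scale)
qed

section \<open>Preservation of the degree\<close>

definition deg_span :: "nat \<Rightarrow> 'n A set"
  where "deg_span d = palg.span {YZ a b | a b. (\<forall>i. b i \<in> {0, 1}) \<and>
    (\<Sum>i = 1..CARD('n). a i) + (\<Sum>i = 1..CARD('n). int (b i)) = int d}"

lemma deg_span_act:
  assumes "x \<in> deg_span d"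
  shows "\<rho> u x \<in> deg_span d"
proof (rule plin_span_in[OF act_plin assms[unfolded deg_span_def]])
  let ?n = "CARD('n)"
  have one: "1 \<in> {1..?n}" using card by simp
  have lines: "x d \<in> deg_span d" if "x \<in> lines 1" for x
    using that
  proof (induction rule: lines_induct)
    case (step c k a b y)
    have deg: "(\<Sum>i = 1..?n. pt ?n 1 a b d i) = int d - (\<Sum>i = 1..?n. int (b i))"
    proof -
      have "(\<Sum>i \<in> {1..?n} - {1}. pt ?n 1 a b d i) = (\<Sum>i \<in> {1..?n} - {1}. a i)"
        by (intro sum.cong) auto
      then have "(\<Sum>i = 1..?n. pt ?n 1 a b d i) = pt ?n 1 a b d 1 + (\<Sum>i \<in> {1..?n} - {1}. a i)"
        by (simp only: sum.remove[OF finite_atLeastAtMost one, of "pt ?n 1 a b d"])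
      then show ?thesis by (simp only: fun_upd_same shift_def)
    qed
    then have "YZ (pt ?n 1 a b d) b \<in> deg_span d"
      unfolding deg_span_def using step(1)
      by (intro palg.span_base CollectI exI[of _ "pt ?n 1 a b d"] exI[of _ b])
        (simp only: deg simp_thms diff_add_cancel)
    then show ?case using step(3) by (simp add: line_def deg_span_def palg.span_add palg.span_scale)
  qed (simp add: deg_span_def palg.span_zero)
  show "palg.subspace (deg_span d)" by (simp add: deg_span_def)
  fix y :: "'n A" assume "y \<in> {YZ a b | a b. (\<forall>i. b i \<in> {0, 1}) \<and>
    (\<Sum>i = 1..?n. a i) + (\<Sum>i = 1..?n. int (b i)) = int d}"
  then obtain a b where y: "y = YZ a b" "\<forall>i. b i \<in> {0, 1}"
    "(\<Sum>i = 1..?n. a i) + (\<Sum>i = 1..?n. int (b i)) = int d" by blast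
  have "shift ?n 1 a b = int d - a 1"
    using y(3) sum.remove[OF finite_atLeastAtMost one, of a] by (simp add: shift_def)
  then have "pt ?n 1 a b d = a" by (simp add: fun_eq_iff)
  then have "y = line 1 0 a b d" by (simp add: y line_def)
  moreover have "(\<lambda>r. \<rho> u (line 1 0 a b r)) \<in> lines 1"
    using lines_stable[OF one, of u] line_in_lines[OF y(2)] by (auto simp: stab_def)
  ultimately show "\<rho> u y \<in> deg_span d" using lines by blast
qed

lemma tens_deg_span:
  assumes len: "length xs = CARD('n)" and xs: "\<And>m. m < CARD('n) \<Longrightarrow> xs ! m \<in> deg_span (d (Suc m))"
  shows "tens xs \<in> tensor_deg (\<Sum>j = 1..CARD('n). d j)"
proof (rule multilinear_span[OF palg.vector_space_axioms palg.vector_space_axioms tens_multilinear])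
  let ?n = "CARD('n)"
  let ?S = "\<lambda>j. {YZ a b | a b. (\<forall>i. b i \<in> {0, 1}) \<and>
    (\<Sum>i = 1..?n. a i) + (\<Sum>i = 1..?n. int (b i)) = int (d j)} :: 'n A set"
  have js: "length [1..<Suc ?n] = ?n" "\<And>m. m < ?n \<Longrightarrow> [1..<Suc ?n] ! m = Suc m" "set [1..<Suc ?n] = {1..?n}"
    by (auto simp del: upt_Suc)
  show "palg.subspace (tensor_deg (\<Sum>j = 1..?n. d j) :: 'n agen tensor set)"
    by (simp add: tensor_deg_def)
  show "list_all2 (\<lambda>x S. x \<in> palg.span S) xs (map ?S [1..<Suc ?n])"
    using len xs by (simp add: list_all2_conv_all_nth js deg_span_def del: upt_Suc)
  fix ys assume "list_all2 (\<in>) ys (map ?S [1..<Suc ?n])"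
  note all = this
  have ys: "length ys = ?n"
    using list_all2_lengthD[OF all] by (simp only: length_map js)
  have ysS: "ys ! m \<in> ?S (Suc m)" if "m < ?n" for m
    using list_all2_nthD[OF all, of m] that by (simp only: ys nth_map js)
  have "\<forall>m<?n. \<exists>a b. ys ! m = YZ a b \<and> (\<forall>i. b i \<in> {0, 1}) \<and>
    (\<Sum>i = 1..?n. a i) + (\<Sum>i = 1..?n. int (b i)) = int (d (Suc m))"
    using ysS by blast
  then obtain a b where ysm: "\<And>m. m < ?n \<Longrightarrow> ys ! m = YZ (a m) (b m)"
    and b: "\<And>m i. m < ?n \<Longrightarrow> b m i \<in> {0, 1}"
    and deg: "\<And>m. m < ?n \<Longrightarrow> (\<Sum>i = 1..?n. a m i) + (\<Sum>i = 1..?n. int (b m i)) = int (d (Suc m))"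
    by metis
  show "tens ys \<in> tensor_deg (\<Sum>j = 1..?n. d j)"
  proof (cases "\<exists>m<?n. \<exists>i\<in>{1..?n}. a m i < 0")
    case True
    then obtain m i where "m < ?n" "i \<in> {1..?n}" "a m i < 0" by blast
    then have "ys ! m = 0" using ysm YZ_neg by metis
    then have "0 \<in> set ys" using \<open>m < ?n\<close> ys by (metis nth_mem)
    then show ?thesis by (simp add: tens_zero tensor_deg_def palg.span_zero)
  next
    case False
    let ?I = "{1..?n}"
    have nn: "0 \<le> a m i" if "m < ?n" "i \<in> ?I" for m i
      using False that by (meson not_le)
    define A :: smatrix where "A = (\<lambda>i j. if i \<in> ?I \<and> j \<in> ?I then nat (a (j - 1) i) else 0,
        \<lambda>i j. if i \<in> ?I \<and> j \<in> ?I then b (j - 1) i else 0)"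
    have b01: "snd A i j \<in> {0, 1}" for i j
      using b[of "j - 1" i] by (auto simp: A_def)
    have A: "A \<in> smatrices ?n"
      using b01 by (auto simp: smatrices_def A_def)
    have "ys = map (Ycol A) [1..<Suc ?n]"
    proof (rule nth_equalityI)
      fix m assume "m < length ys"
      then have m: "m < ?n" using ys by simp
      have "YZ (a m) (b m) = (Ycol A (Suc m) :: 'n A)"
        unfolding Ycol_eq_YZ using m nn[OF m] by (intro YZ_cong) (auto simp: A_def)
      then show "ys ! m = map (Ycol A) [1..<Suc ?n] ! m" using m ysm by (simp add: js del: upt_Suc)
    qed (simp only: length_map js ys)
    then have "tens ys = Xmat A" by (simp only: Xmat_def)
    moreover have "entry_sum ?n A = (\<Sum>j = 1..?n. d j)"
      unfolding entry_sum_def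
    proof (subst sum.swap, intro sum.cong refl)
      fix j assume j: "j \<in> ?I"
      have "int (\<Sum>i = 1..?n. fst A i j + snd A i j) = (\<Sum>i = 1..?n. a (j - 1) i) + (\<Sum>i = 1..?n. int (b (j - 1) i))"
        unfolding of_nat_sum sum.distrib[symmetric] using j nn[of "j - 1"]
        by (intro sum.cong) (auto simp: A_def)
      also have "\<dots> = int (d (Suc (j - 1)))" using j by (intro deg) auto
      finally have "(\<Sum>i = 1..?n. fst A i j + snd A i j) = d (Suc (j - 1))" by (simp only: of_nat_eq_iff)
      then show "(\<Sum>i = 1..?n. fst A i j + snd A i j) = d j" using j by simp
    qed
    ultimately show ?thesis
      unfolding tensor_deg_def using A by (intro palg.span_base) auto
  qed
qed

lemma tact_hom_Xmat:
  assumes A: "A \<in> smatrices CARD('n)" and gs: "length gs = CARD('n)"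
    "list_all2 (\<lambda>g p. g \<in> homogeneous p) gs ps"
  shows "tact (tens gs) (Xmat A) \<in> tensor_deg (entry_sum CARD('n) A)"
proof -
  let ?n = "CARD('n)"
  let ?vs = "map (Ycol A) [1..<Suc ?n] :: 'n A list"
  have len: "length ?vs = ?n" by (simp del: upt_Suc)
  have ps: "length ps = ?n" using gs by (auto dest: list_all2_lengthD)
  have nth: "?vs ! m = YZ (\<lambda>i. int (fst A i (Suc m))) (\<lambda>i. snd A i (Suc m))" if "m < ?n" for m
    using that by (simp add: Ycol_eq_YZ del: upt_Suc)
  let ?qs = "map (\<lambda>m. odd_count ?n (\<lambda>i. snd A i (Suc m))) [0..<?n]"
  have hom: "list_all2 (\<lambda>v q. v \<in> homogeneous q) ?vs ?qs"
  proof (rule list_all2_all_nthI)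
    fix m assume "m < length ?vs"
    then have m: "m < ?n" by (simp only: len)
    then have "?qs ! m = odd_count ?n (\<lambda>i. snd A i (Suc m))" by simp
    then show "?vs ! m \<in> homogeneous (?qs ! m)" by (simp only: nth[OF m] YZ_homogeneous)
  qed (simp only: len length_map length_upt diff_zero)
  have "length ?qs = length ps" by (simp add: ps)
  from word_act_homogeneous[OF gs(2) this] obtain \<epsilon> where "word_act \<rho> gs ?vs = \<epsilon> \<cdot> tens (map2 \<rho> gs ?vs)"
    using hom by blast
  moreover have "tens (map2 \<rho> gs ?vs) \<in> tensor_deg (\<Sum>j = 1..?n. column_sum ?n A j)"
  proof (rule tens_deg_span)
    fix m assume m: "m < ?n"
    have "snd A i (Suc m) \<in> {0, 1}" for i using A by (rule smatrices_01)
    then have "?vs ! m \<in> deg_span (column_sum ?n A (Suc m))"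
      unfolding nth[OF m] deg_span_def column_sum_def
      by (intro palg.span_base) (auto simp: sum.distrib intro!: exI)
    from deg_span_act[OF this, of "gs ! m"]
    show "map2 \<rho> gs ?vs ! m \<in> deg_span (column_sum ?n A (Suc m))"
      using m gs(1) len by (simp only: nth_map nth_zip length_zip length_map min.idem prod.case)
  qed (simp add: gs del: upt_Suc)
  moreover have "(\<Sum>j = 1..?n. column_sum ?n A j) = entry_sum ?n A"
    unfolding column_sum_def entry_sum_def by (rule sum.swap)
  ultimately show ?thesis
    by (simp add: Xmat_def tact_tens tensor_deg_def palg.span_scale del: upt_Suc)
qed

text \<open>The unit and product laws of \<open>pow_act\<close> were obtained on tensors with a
  fixed number of factors; this inclusion makes them applicable.\<close>

lemma tensor_deg_subset: "tensor_deg r \<subseteq> (tensor_power CARD('n) :: 'n agen tensor set)"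
  unfolding tensor_deg_def tensor_power_def Xmat_def
  by (intro palg.span_mono) (auto simp del: upt_Suc)

end

section \<open>Linear independence\<close>

text \<open>Dedekind's argument: shifting the argument by a unit vector multiplies distinct characters by
  distinct factors somewhere, which eliminates one of them.\<close>

lemma upsilon_characters_independent:
  assumes "finite V" "V \<subseteq> int_vectors n"
    "\<And>l. l \<in> nat_vectors n \<Longrightarrow> (\<Sum>v\<in>V. c v * \<upsilon> powi (\<Sum>i = 1..n. int (l i) * v i)) = 0"
  shows "\<forall>v\<in>V. c v = 0"
  using assms
proof (induction V arbitrary: c rule: finite_induct)
  case (insert w V)
  let ?\<chi> = "\<lambda>v l. \<upsilon> powi (\<Sum>i = 1..n. int (l i) * v i)"
  have c0: "c v = 0" if v: "v \<in> V" for v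
  proof -
    have "v \<in> int_vectors n" "w \<in> int_vectors n" "v \<noteq> w" using insert v by auto
    moreover from this obtain m where m: "v m \<noteq> w m" by (auto simp: fun_eq_iff)
    ultimately have mn: "m \<in> {1..n}" unfolding int_vectors_def by fastforce
    have "\<forall>u\<in>V. c u * (\<upsilon> powi u m - \<upsilon> powi w m) = 0"
    proof (rule insert.IH)
      fix l assume l: "l \<in> nat_vectors n"
      define l' where "l' = l(m := Suc (l m))"
      have l': "l' \<in> nat_vectors n" using l mn by (auto simp: nat_vectors_def l'_def)
      have shift: "?\<chi> u l' = \<upsilon> powi u m * ?\<chi> u l" for u
      proof -
        have "(\<Sum>i = 1..n. int (l' i) * u i) = (\<Sum>i = 1..n. int (l i) * u i + (if i = m then u m else 0))"
          by (intro sum.cong) (auto simp: l'_def algebra_simps)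
        also have "\<dots> = (\<Sum>i = 1..n. int (l i) * u i) + u m" using mn by (simp add: sum.distrib)
        finally show ?thesis by (simp add: power_int_add)
      qed
      have "(\<Sum>u\<in>V. c u * (\<upsilon> powi u m - \<upsilon> powi w m) * ?\<chi> u l) =
          (\<Sum>u\<in>V. c u * (\<upsilon> powi u m * ?\<chi> u l)) - \<upsilon> powi w m * (\<Sum>u\<in>V. c u * ?\<chi> u l)"
        unfolding sum_distrib_left sum_subtractf[symmetric] by (intro sum.cong) (simp_all add: algebra_simps)
      also have "\<dots> = (\<Sum>u\<in>insert w V. c u * ?\<chi> u l') - \<upsilon> powi w m * (\<Sum>u\<in>insert w V. c u * ?\<chi> u l)"
        unfolding shift sum.insert[OF insert.hyps] by (simp add: distrib_left mult.left_commute)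
      also have "\<dots> = 0" unfolding insert.prems(2)[OF l] insert.prems(2)[OF l'] by simp
      finally show "(\<Sum>u\<in>V. c u * (\<upsilon> powi u m - \<upsilon> powi w m) * ?\<chi> u l) = 0" .
    qed (use insert.prems in auto)
    then show ?thesis using v m by auto
  qed
  have "(\<Sum>v\<in>insert w V. c v * ?\<chi> v (\<lambda>_. 0)) = 0"
    by (rule insert.prems) (simp add: nat_vectors_def)
  then have "c w = 0" using insert.hyps c0 by simp
  with c0 show ?case by simp
qed simp

section \<open>Coordinate functionals on the tensor space and independence of the A(j)\<close>

lemma smatrices_eqI:
  assumes "A \<in> smatrices n" "B \<in> smatrices n"
    "\<And>i j. i \<in> {1..n} \<Longrightarrow> j \<in> {1..n} \<Longrightarrow> fst A i j = fst B i j \<and> snd A i j = snd B i j"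
  shows "A = B"
proof -
  have "fst A i j = fst B i j \<and> snd A i j = snd B i j" for i j
    using assms(3)[of i j] assms(1,2) unfolding smatrices_def by (cases "i \<in> {1..n} \<and> j \<in> {1..n}") force+
  then show ?thesis by (simp add: prod_eq_iff fun_eq_iff)
qed

text \<open>The product of the coordinate functionals of the columns is multilinear, so it lifts to
  the tensor algebra and separates the matrices.\<close>

lemma Xmat_functional:
  assumes A: "A \<in> smatrices CARD('n)"
  obtains L :: "'n agen tensor \<Rightarrow> qfield" where "Vector_Spaces.linear pscale (*) L"
    "\<And>B. B \<in> smatrices CARD('n) \<Longrightarrow> L (Xmat B) = of_bool (B = A)"
proof -
  let ?n = "CARD('n)"
  define good where "good j l \<longleftrightarrow> Vector_Spaces.linear pscale (*) l \<and>
    (\<forall>a b. (\<forall>i. b i \<in> {0, 1}) \<longrightarrow> l (YZ (\<lambda>i. int (a i)) b) =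
      of_bool (\<forall>i\<in>{1..?n}. a i = fst A i j \<and> b i = snd A i j))" for j and l :: "'n A \<Rightarrow> qfield"
  have "\<exists>l. good j l" for j
  proof -
    have "\<forall>i. snd A i j \<in> {0, 1}" using smatrices_01[OF A] by blast
    then obtain l :: "'n A \<Rightarrow> qfield" where "Vector_Spaces.linear pscale (*) l"
      "\<And>a b. \<forall>i. b i \<in> {0, 1} \<Longrightarrow> l (YZ (\<lambda>i. int (a i)) b) =
        of_bool (\<forall>i\<in>{1..?n}. a i = fst A i j \<and> b i = snd A i j)"
      by (rule YZ_functional[where \<alpha> = "\<lambda>i. fst A i j"]) blast
    then have "good j l" unfolding good_def by blast
    then show ?thesis by blast
  qed
  then obtain l where good: "\<And>j. good j (l j)" by metis
  have l: "Vector_Spaces.linear pscale (*) (l j)"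
    "\<forall>i. b i \<in> {0, 1} \<Longrightarrow> l j (YZ (\<lambda>i. int (a i)) b) =
      of_bool (\<forall>i\<in>{1..?n}. a i = fst A i j \<and> b i = snd A i j)" for j a b
    using good[of j] unfolding good_def by blast+
  have lin: "l j (x + y) = l j x + l j y" "l j (c \<cdot> x) = c * l j x" for j x y c
    using l(1)[of j] by (simp_all add: Vector_Spaces.linear_iff)
  \<comment> \<open>The default 0 covers lists of other lengths, as the lift to the tensor algebra
    is defined on tensors of every length.\<close>
  define f where "f xs = (if length xs = ?n then \<Prod>m<?n. l (Suc m) (xs ! m) else 0)" for xs
  have "multilinear pscale (*) f"
    unfolding multilinear_def
  proof (intro conjI allI)
    fix xs ys and x y :: "'n A" and c
    \<comment> \<open>The placeholder 0 fills the distinguished slot, whose index is excluded from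
      the remaining product; the dependence on \<open>z\<close> is thus confined to one
      factor.\<close>
    have prod: "f (xs @ z # ys) = (if Suc (length xs + length ys) = ?n then
        l (Suc (length xs)) z * (\<Prod>m \<in> {..<?n} - {length xs}. l (Suc m) ((xs @ 0 # ys) ! m)) else 0)" for z
    proof (cases "Suc (length xs + length ys) = ?n")
      case True
      then have "length xs \<in> {..<?n}" by simp
      then have "f (xs @ z # ys) = l (Suc (length xs)) z *
          (\<Prod>m \<in> {..<?n} - {length xs}. l (Suc m) ((xs @ z # ys) ! m))"
        using True by (simp add: f_def prod.remove[of _ "length xs"])
      also have "(\<Prod>m \<in> {..<?n} - {length xs}. l (Suc m) ((xs @ z # ys) ! m)) =
          (\<Prod>m \<in> {..<?n} - {length xs}. l (Suc m) ((xs @ 0 # ys) ! m))"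
        by (intro prod.cong) (auto simp: nth_append nth_Cons split: nat.splits)
      finally show ?thesis using True by simp
    qed (simp add: f_def)
    show "f (xs @ (x + y) # ys) = f (xs @ x # ys) + f (xs @ y # ys)" unfolding prod by (simp add: lin distrib_right)
    show "f (xs @ (c \<cdot> x) # ys) = c * f (xs @ x # ys)" unfolding prod by (simp add: lin)
  qed
  from tensor_ext[OF qfield_vector_space this]
  obtain L where L: "Vector_Spaces.linear pscale (*) L" "\<And>xs. L (tens xs) = f xs" by blast
  have "L (Xmat B) = of_bool (B = A)" if B: "B \<in> smatrices ?n" for B
  proof -
    have "L (Xmat B) = (\<Prod>m<?n. l (Suc m) (Ycol B (Suc m)))"
      unfolding Xmat_def L(2) f_def by (simp del: upt_Suc)
    also have "\<dots> = (\<Prod>m<?n. of_bool (\<forall>i\<in>{1..?n}. fst B i (Suc m) = fst A i (Suc m) \<and> snd B i (Suc m) = snd A i (Suc m)))"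
    proof (intro prod.cong refl)
      fix m
      have "\<forall>i. snd B i (Suc m) \<in> {0, 1}" using smatrices_01[OF B] by blast
      then show "l (Suc m) (Ycol B (Suc m)) = of_bool (\<forall>i\<in>{1..?n}. fst B i (Suc m) = fst A i (Suc m) \<and> snd B i (Suc m) = snd A i (Suc m))"
        unfolding Ycol_eq_YZ by (rule l(2))
    qed
    also have "\<dots> = of_bool (\<forall>m<?n. \<forall>i\<in>{1..?n}. fst B i (Suc m) = fst A i (Suc m) \<and> snd B i (Suc m) = snd A i (Suc m))"
    proof -
      have "(\<Prod>m<k. of_bool (P m)) = (of_bool (\<forall>m<k. P m) :: qfield)" for P and k :: nat
        by (induction k) (auto simp: less_Suc_eq)
      then show ?thesis .
    qed
    also have "(\<forall>m<?n. \<forall>i\<in>{1..?n}. fst B i (Suc m) = fst A i (Suc m) \<and> snd B i (Suc m) = snd A i (Suc m)) \<longleftrightarrow> B = A"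
    proof
      assume *: "\<forall>m<?n. \<forall>i\<in>{1..?n}. fst B i (Suc m) = fst A i (Suc m) \<and> snd B i (Suc m) = snd A i (Suc m)"
      show "B = A"
      proof (rule smatrices_eqI[OF B A])
        fix i j assume ij: "i \<in> {1..?n}" "j \<in> {1..?n}"
        then obtain m where "j = Suc m" "m < ?n" by (cases j) auto
        with * ij(1) show "fst B i j = fst A i j \<and> snd B i j = snd A i j" by blast
      qed
    qed simp
    finally show ?thesis .
  qed
  with L(1) show thesis by (rule that)
qed

lemma add_diag_smatrices: "A \<in> smatrices n \<Longrightarrow> l \<in> nat_vectors n \<Longrightarrow> add_diag A l \<in> smatrices n"
  unfolding smatrices_def case_prod_beta by (auto simp: add_diag_def nat_vectors_def simp del: insert_iff)

text \<open>Since the even parts have zero diagonal, the diagonal of the sum recovers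
  \<open>l\<close> and the rest recovers the matrix.\<close>

lemma add_diag_eq_iff:
  assumes "A \<in> smatrices' n" "B \<in> smatrices' n"
  shows "add_diag A l = add_diag B l' \<longleftrightarrow> A = B \<and> l = l'"
proof
  assume "add_diag A l = add_diag B l'"
  then have *: "fst A i j + (if i = j then l i else 0) = fst B i j + (if i = j then l' i else 0)"
    "snd A = snd B" for i j
    by (auto simp: add_diag_def fun_eq_iff)
  have diag: "fst A i i = 0" "fst B i i = 0" for i using assms by (auto simp: smatrices'_def)
  have l: "l i = l' i" for i using *(1)[of i i] by (simp add: diag)
  have "fst A i j = fst B i j" for i j using *(1)[of i j] l[of i] by (cases "i = j") auto
  with l show "A = B \<and> l = l'" using *(2) by (simp add: prod_eq_iff fun_eq_iff)
qed simp

text \<open>The entry sum bounds every \<open>l i\<close>. Finiteness matters because a sum over an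
  infinite set is 0 by convention.\<close>

lemma finite_nat_vectors: "finite {l \<in> nat_vectors n. entry_sum n (add_diag A l) = r}"
proof (rule finite_subset)
  show "{l \<in> nat_vectors n. entry_sum n (add_diag A l) = r} \<subseteq> {l. \<forall>i. (i \<in> {1..n} \<longrightarrow> l i \<in> {..r}) \<and> (i \<notin> {1..n} \<longrightarrow> l i = 0)}"
  proof clarify
    fix l i assume l: "l \<in> nat_vectors n" and r: "r = entry_sum n (add_diag A l)"
    have "l i \<le> entry_sum n (add_diag A l)" if "i \<in> {1..n}"
      unfolding entry_sum_add_diag
      using member_le_sum[OF that, of "\<lambda>j. l j + column_sum n A j"] by simp
    then show "(i \<in> {1..n} \<longrightarrow> l i \<in> {..entry_sum n (add_diag A l)}) \<and> (i \<notin> {1..n} \<longrightarrow> l i = 0)"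
      using l by (auto simp: nat_vectors_def)
  qed
  show "finite {l :: nat \<Rightarrow> nat. \<forall>i. (i \<in> {1..n} \<longrightarrow> l i \<in> {..r}) \<and> (i \<notin> {1..n} \<longrightarrow> l i = 0)}"
    by (rule finite_set_of_finite_funs) simp_all
qed

text \<open>The coordinate functional at \<open>add_diag A l\<close> ignores all matrices other than
  \<open>A\<close> and turns the relation into one between characters of \<open>l\<close>. Stating
  it for families indexed by pairs makes injectivity of the parametrisation a corollary.\<close>

lemma Aj_family_independent:
  assumes P: "finite P" "P \<subseteq> smatrices' CARD('n) \<times> int_vectors CARD('n)"
    and zero: "(\<Sum>(A, v)\<in>P. hscale (c (A, v)) (Aj A v :: nat \<Rightarrow> 'n agen tensor)) = 0"
  shows "\<forall>p\<in>P. c p = 0"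
proof (intro ballI)
  let ?n = "CARD('n)"
  fix p assume p: "p \<in> P"
  obtain A w where Aw: "p = (A, w)" by (cases p)
  define V where "V = {v. (A, v) \<in> P}"
  have A: "A \<in> smatrices' ?n" using p P Aw by auto
  have V: "finite V" "V \<subseteq> int_vectors ?n"
  proof -
    have "V = snd ` {p \<in> P. fst p = A}" by (force simp: V_def)
    then show "finite V" using P(1) by simp
    show "V \<subseteq> int_vectors ?n" using P(2) by (auto simp: V_def)
  qed
  have "\<forall>v\<in>V. c (A, v) = 0"
  proof (rule upsilon_characters_independent[OF V])
    fix l assume l: "l \<in> nat_vectors ?n"
    let ?\<chi> = "\<lambda>v. \<upsilon> powi (\<Sum>i = 1..?n. int (l i) * v i)"
    have Al: "add_diag A l \<in> smatrices ?n" using A l smatrices'_subset add_diag_smatrices by blast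
    obtain L :: "'n agen tensor \<Rightarrow> qfield" where L: "Vector_Spaces.linear pscale (*) L"
      "\<And>B. B \<in> smatrices ?n \<Longrightarrow> L (Xmat B) = of_bool (B = add_diag A l)"
      using Xmat_functional[OF Al] by blast
    have lin: "L (x + y) = L x + L y" "L (k \<cdot> x) = k * L x" for x y k
      using L(1) by (simp_all add: Vector_Spaces.linear_iff)
    have L0: "L 0 = 0" using lin(2)[of 0 0] by simp
    have Lsum: "L (sum f S) = (\<Sum>x\<in>S. L (f x))" for f and S :: "'b set"
      by (induction S rule: infinite_finite_induct) (simp_all add: L0 lin)
    \<comment> \<open>The component of the sequences in which the basis vector
      \<open>Xmat (add_diag A l)\<close> occurs.\<close>
    define r where "r = entry_sum ?n (add_diag A l)"
    have LA: "L (Aj B v r) = (if B = A then ?\<chi> v else 0)" if B: "B \<in> smatrices' ?n" for B v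
    proof -
      let ?N = "{l' \<in> nat_vectors ?n. entry_sum ?n (add_diag B l') = r}"
      have "L (Aj B v r) = (\<Sum>l'\<in>?N. \<upsilon> powi (\<Sum>i = 1..?n. int (l' i) * v i) * of_bool (B = A \<and> l' = l))"
      proof -
        have "L (Xmat (add_diag B l')) = of_bool (B = A \<and> l' = l)" if "l' \<in> ?N" for l'
        proof -
          have "add_diag B l' \<in> smatrices ?n"
            using add_diag_smatrices[OF subsetD[OF smatrices'_subset B]] that by blast
          then show ?thesis by (simp only: L(2) add_diag_eq_iff[OF B A])
        qed
        then show ?thesis unfolding Aj_def Lsum lin by (intro sum.cong refl arg_cong2[where f = "(*)"]) simp
      qed
      also have "\<dots> = (if B = A then ?\<chi> v else 0)"
      proof (cases "B = A")
        case True
        have "l \<in> ?N" using l by (simp add: True r_def)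
        have "(\<Sum>l'\<in>?N. \<upsilon> powi (\<Sum>i = 1..?n. int (l' i) * v i) * of_bool (B = A \<and> l' = l)) =
            (\<Sum>l'\<in>?N. if l' = l then ?\<chi> v else 0)"
          by (intro sum.cong refl) (simp add: True)
        then show ?thesis using \<open>l \<in> ?N\<close> finite_nat_vectors[of ?n B r] True by simp
      qed simp
      finally show ?thesis .
    qed
    have "0 = L ((\<Sum>(A, v)\<in>P. hscale (c (A, v)) (Aj A v)) r)"
      unfolding zero by (simp add: L0)
    also have "\<dots> = (\<Sum>p\<in>P. L (hscale (c p) (Aj (fst p) (snd p)) r))"
    proof -
      have "(\<Sum>p\<in>S. F p) r = (\<Sum>p\<in>S. F p r)" for F :: "smatrix \<times> (nat \<Rightarrow> int) \<Rightarrow> nat \<Rightarrow> 'n agen tensor" and S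
        by (induction S rule: infinite_finite_induct) simp_all
      then show ?thesis by (simp add: Lsum case_prod_beta)
    qed
    also have "\<dots> = (\<Sum>p\<in>P. if fst p = A then c p * ?\<chi> (snd p) else 0)"
      using P(2) by (intro sum.cong) (auto simp: hscale_def lin LA)
    also have "\<dots> = (\<Sum>p\<in>Pair A ` V. c p * ?\<chi> (snd p))"
      using P(1) by (intro sum.mono_neutral_cong_right) (auto simp: V_def)
    also have "\<dots> = (\<Sum>v\<in>V. c (A, v) * ?\<chi> v)"
      by (subst sum.reindex) (auto simp: inj_on_def)
    finally show "(\<Sum>v\<in>V. c (A, v) * ?\<chi> v) = 0" by simp
  qed
  then show "c p = 0" using p by (simp add: Aw V_def)
qed

text \<open>Equal members at distinct indices would give a nontrivial relation with coefficients 1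
  and -1.\<close>

lemma Aj_inj:
  "inj_on (\<lambda>(A, v). Aj A v :: nat \<Rightarrow> 'n agen tensor) (smatrices' CARD('n) \<times> int_vectors CARD('n))"
proof (rule inj_onI, rule ccontr)
  fix p q assume p: "p \<in> smatrices' CARD('n) \<times> int_vectors CARD('n)"
    and q: "q \<in> smatrices' CARD('n) \<times> int_vectors CARD('n)"
    and eq: "(\<lambda>(A, v). Aj A v :: nat \<Rightarrow> 'n agen tensor) p = (\<lambda>(A, v). Aj A v) q" and ne: "p \<noteq> q"
  define c :: "_ \<Rightarrow> qfield" where "c x = (if x = p then 1 else - 1)" for x
  have "(\<Sum>(A, v)\<in>{p, q}. hscale (c (A, v)) (Aj A v :: nat \<Rightarrow> 'n agen tensor)) = 0"
    using ne eq by (simp add: c_def case_prod_beta)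
  from Aj_family_independent[OF _ _ this] p q have "c p = 0" by auto
  then show False by (simp add: c_def)
qed

lemma LV_eq: "LV = (\<lambda>(A, v). Aj A v :: nat \<Rightarrow> 'n agen tensor) ` (smatrices' CARD('n) \<times> int_vectors CARD('n))"
  unfolding LV_def by auto

lemma LV_independent: "hat.independent (LV :: (nat \<Rightarrow> 'n agen tensor) set)"
  unfolding hat.dependent_explicit
proof (intro notI, elim exE conjE)
  let ?F = "\<lambda>(A, v). Aj A v :: nat \<Rightarrow> 'n agen tensor"
  fix T u assume T: "finite T" "T \<subseteq> (LV :: (nat \<Rightarrow> 'n agen tensor) set)"
    and zero: "(\<Sum>x\<in>T. hscale (u x) x) = 0" and ne: "\<exists>x\<in>T. u x \<noteq> 0"
  from T obtain P where P: "finite P" "P \<subseteq> smatrices' CARD('n) \<times> int_vectors CARD('n)" "T = ?F ` P"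
    unfolding LV_eq by (metis finite_subset_image)
  have inj: "inj_on ?F P" using Aj_inj P(2) by (rule inj_on_subset)
  have "(\<Sum>(A, v)\<in>P. hscale (u (?F (A, v))) (Aj A v :: nat \<Rightarrow> 'n agen tensor)) =
      (\<Sum>p\<in>P. hscale (u (?F p)) (?F p))"
    by (intro sum.cong) auto
  also have "\<dots> = (\<Sum>x\<in>?F ` P. hscale (u x) x)" by (subst sum.reindex[OF inj]) (simp only: comp_def)
  finally have "(\<Sum>(A, v)\<in>P. hscale (u (?F (A, v))) (Aj A v :: nat \<Rightarrow> 'n agen tensor)) = 0"
    using zero unfolding P(3) by (rule trans)
  from Aj_family_independent[OF P(1,2) this] ne show False unfolding P(3) by auto
qed

text \<open>By injectivity an element \<open>Aj A v\<close> determines the parity of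
  \<open>A\<close>, so the basis splits into two disjoint parts. A vector in both spans has a
  representation supported on each part, hence the zero representation.\<close>

lemma VV_superspace: "superspace hscale (VV :: (nat \<Rightarrow> 'n agen tensor) set) VV_part"
proof -
  define S where "S p = {Aj A v :: nat \<Rightarrow> 'n agen tensor | A v.
    A \<in> smatrices' CARD('n) \<and> v \<in> int_vectors CARD('n) \<and> smatrix_parity CARD('n) A = p}" for p
  have VS: "VV_part p = hat.span (S p)" for p by (simp add: VV_part_def S_def)
  have LV: "LV = S 0 \<union> S 1"
    unfolding LV_def S_def using bit.exhaust by blast
  have disj: "x \<notin> S 1" if "x \<in> S 0" for x
  proof
    assume "x \<in> S 1"
    with that obtain A v A' v' where *: "x = Aj A v" "A \<in> smatrices' CARD('n)" "v \<in> int_vectors CARD('n)"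
      "smatrix_parity CARD('n) A = 0" "x = Aj A' v'" "A' \<in> smatrices' CARD('n)" "v' \<in> int_vectors CARD('n)"
      "smatrix_parity CARD('n) A' = 1"
      unfolding S_def by blast
    then have "(A, v) = (A', v')" using inj_onD[OF Aj_inj[where 'n = 'n], of "(A, v)" "(A', v')"] by simp
    then show False using * by simp
  qed
  have "x = 0" if x: "x \<in> hat.span (S 0)" "x \<in> hat.span (S 1)" for x
  proof -
    have sub: "S 0 \<subseteq> LV" "S 1 \<subseteq> LV" by (simp_all add: LV)
    have r: "hat.representation LV x = hat.representation (S 0) x" "hat.representation LV x = hat.representation (S 1) x"
      using hat.representation_extend[OF LV_independent] x sub by blast+
    have "hat.representation LV x b = 0" for b
      using hat.representation_ne_zero[of "S 0" x b] hat.representation_ne_zero[of "S 1" x b] r disj by metis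
    moreover have "x \<in> hat.span LV" using x(1) hat.span_mono[OF sub(1)] by blast
    ultimately show ?thesis
      using hat.sum_nonzero_representation_eq[OF LV_independent, of x] by simp
  qed
  then show ?thesis
    unfolding superspace_def VS VV_def LV hat.span_Un by (auto simp: hat.span_zero)
qed

section \<open>The module structure\<close>

lemma is_module_subspace:
  assumes "is_module sc act M" "module.subspace sc N" "N \<subseteq> M" "\<And>u x. x \<in> N \<Longrightarrow> act u x \<in> N"
  shows "is_module sc act N"
  using assms by (simp add: is_module_def subset_iff)

locale natural_comodule = natural_action \<rho> + super_comodule_action \<rho> \<Delta>
  for \<rho> :: "'n U \<Rightarrow> 'n A \<Rightarrow> 'n A" and \<Delta> :: "'n U \<Rightarrow> 'n ugen tensor"
begin

lemma hat_act_eq: "hat_act \<Delta> \<rho> u x = (\<lambda>r. pow_act (CARD('n) - 1) u (x r))"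
  by (simp add: hat_act_def tensor_act_def pow_act_def tact_def)

lemma Suc_card: "Suc (CARD('n) - 1) = CARD('n)"
  using card by simp

text \<open>The iterated coproduct of a homogeneous element is a combination of words of homogeneous
  factors with the same total parity. To each word \<open>tact_hom_Aj\<close> applies, and the rest
  is linearity in both arguments.\<close>

lemma hat_act_VV_part:
  assumes "u \<in> homogeneous p" "x \<in> VV_part q"
  shows "hat_act \<Delta> \<rho> u x \<in> VV_part (p + q)"
proof -
  have hom: "(\<lambda>r. tact s (Aj A v r)) \<in> VV_part (p + smatrix_parity CARD('n) A)"
    if "s \<in> hom_tensor CARD('n) p" and A: "A \<in> smatrices' CARD('n)" for s A v
    using that(1) unfolding hom_tensor_def
  proof (induction rule: palg.span_induct_alt)
    case base
    have "(\<lambda>r. tact 0 (Aj A v r)) = 0" by (simp add: plin_zero[OF tact_plin'] fun_eq_iff)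
    then show ?case by (simp add: VV_part_def hat.span_zero)
  next
    case (step c y z)
    then obtain gs ps where gs: "y = tens gs" "length gs = CARD('n)"
      "list_all2 (\<lambda>g p. g \<in> homogeneous p) gs ps" "sum_list ps = p" by blast
    have "(\<lambda>r. tact (c \<cdot> y + z) (Aj A v r)) = hscale c (\<lambda>r. tact (tens gs) (Aj A v r)) + (\<lambda>r. tact z (Aj A v r))"
      by (simp add: gs(1) plin_add[OF tact_plin'] plin_scale[OF tact_plin'] hscale_def fun_eq_iff)
    then show ?case
      using tact_hom_Aj[OF A gs(2,3), of v] step(2) unfolding gs(4) VV_part_def
      by (simp only: hat.span_add hat.span_scale)
  qed
  show ?thesis
    using assms(2) unfolding VV_part_def
  proof (induction rule: hat.span_induct_alt)
    case base
    have "hat_act \<Delta> \<rho> u 0 = 0" by (simp add: hat_act_eq plin_zero[OF pow_act_plin] fun_eq_iff)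
    then show ?case by (simp only: hat.span_zero)
  next
    case (step c y z)
    then obtain A v where A: "y = Aj A v" "A \<in> smatrices' CARD('n)" "smatrix_parity CARD('n) A = q" by blast
    have "iter_comult \<Delta> (CARD('n) - 1) u \<in> hom_tensor CARD('n) p"
      using iter_comult_homogeneous[OF assms(1), of "CARD('n) - 1"] by (simp only: Suc_card)
    from hom[OF this A(2), of v] have "hat_act \<Delta> \<rho> u y \<in> VV_part (p + q)"
      by (simp only: hat_act_eq pow_act_def A)
    moreover have "hat_act \<Delta> \<rho> u (hscale c y + z) = hscale c (hat_act \<Delta> \<rho> u y) + hat_act \<Delta> \<rho> u z"
      by (simp add: hat_act_eq plin_add[OF pow_act_plin] plin_scale[OF pow_act_plin] hscale_def fun_eq_iff)
    ultimately show ?case using step(2) unfolding VV_part_def by (simp only: hat.span_add hat.span_scale)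
  qed
qed

lemma hat_act_add_left: "hat_act \<Delta> \<rho> (u + w) x = hat_act \<Delta> \<rho> u x + hat_act \<Delta> \<rho> w x"
  by (simp add: hat_act_eq plin2 fun_eq_iff)

lemma VV_eq: "VV = {x + y | x y. x \<in> VV_part 0 \<and> y \<in> (VV_part 1 :: (nat \<Rightarrow> 'n agen tensor) set)}"
  using VV_superspace[where 'n = 'n] by (simp only: superspace_def)

lemma VV_part_subset: "VV_part p \<subseteq> (VV :: (nat \<Rightarrow> 'n agen tensor) set)"
  unfolding VV_def VV_part_def LV_def by (intro hat.span_mono) blast

text \<open>Both the acting element and the vector are split into even and odd components, since
  \<open>hat_act_VV_part\<close> speaks of homogeneous ones only.\<close>

lemma hat_act_VV:
  assumes "x \<in> VV"
  shows "hat_act \<Delta> \<rho> u x \<in> VV"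
proof -
  obtain y z where x: "x = y + z" "y \<in> VV_part 0" "z \<in> VV_part 1" using assms unfolding VV_eq by blast
  have add: "hat_act \<Delta> \<rho> u (y + z) = hat_act \<Delta> \<rho> u y + hat_act \<Delta> \<rho> u z" for u
    by (simp add: hat_act_eq plin2 fun_eq_iff)
  have "hat_act \<Delta> \<rho> (part p u) w \<in> VV" if "w \<in> VV_part q" for p q w
    using hat_act_VV_part[OF part_in_homogeneous[of p u] that] VV_part_subset by blast
  then have "hat_act \<Delta> \<rho> (part 0 u + part 1 u) x \<in> VV"
    unfolding x(1) add unfolding hat_act_add_left VV_def using x by (intro hat.span_add) (auto simp: VV_def)
  then show ?thesis by (simp only: part_add_part)
qed

lemma pow_act_tensor_deg:
  assumes "t \<in> tensor_deg r"
  shows "pow_act (CARD('n) - 1) u t \<in> tensor_deg r"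
proof (rule plin_span_in[OF pow_act_plin assms[unfolded tensor_deg_def]])
  show sub: "palg.subspace (tensor_deg r :: 'n agen tensor set)" by (simp add: tensor_deg_def)
  fix y :: "'n agen tensor" assume "y \<in> Xmat ` {A \<in> smatrices CARD('n). entry_sum CARD('n) A = r}"
  then obtain A where A: "y = Xmat A" "A \<in> smatrices CARD('n)" "entry_sum CARD('n) A = r" by blast
  have "pow_act (CARD('n) - 1) w y \<in> tensor_deg r" if w: "w \<in> homogeneous p" for w p
    unfolding pow_act_def
  proof (rule plin_span_in[OF tact_plin' _ sub])
    show "iter_comult \<Delta> (CARD('n) - 1) w \<in> palg.span {tens gs | gs ps.
        length gs = CARD('n) \<and> list_all2 (\<lambda>g p. g \<in> homogeneous p) gs ps \<and> sum_list ps = p}"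
      using iter_comult_homogeneous[OF w, of "CARD('n) - 1"] by (simp only: Suc_card hom_tensor_def)
    fix s :: "'n ugen tensor" assume "s \<in> {tens gs | gs ps.
        length gs = CARD('n) \<and> list_all2 (\<lambda>g p. g \<in> homogeneous p) gs ps \<and> sum_list ps = p}"
    then obtain gs ps where "s = tens gs" "length gs = CARD('n)" "list_all2 (\<lambda>g p. g \<in> homogeneous p) gs ps" by blast
    then show "tact s y \<in> tensor_deg r" using tact_hom_Xmat[OF A(2), of gs ps] by (simp only: A)
  qed
  from this[OF part_in_homogeneous[of 0 u]] this[OF part_in_homogeneous[of 1 u]]
  have "pow_act (CARD('n) - 1) (part 0 u + part 1 u) y \<in> tensor_deg r"
    unfolding plin2 by (rule palg.subspace_add[OF sub])
  then show "pow_act (CARD('n) - 1) u y \<in> tensor_deg r" by (simp only: part_add_part)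
qed

lemma That_module: "is_module hscale (hat_act \<Delta> \<rho>) (That :: (nat \<Rightarrow> 'n agen tensor) set)"
proof -
  \<comment> \<open>Components of a completed tensor have exactly n factors, as the unit and product
    laws of \<open>pow_act\<close> require.\<close>
  have power: "x r \<in> tensor_power (Suc (CARD('n) - 1))" if "x \<in> That" for x :: "nat \<Rightarrow> 'n agen tensor" and r
    unfolding Suc_card using that tensor_deg_subset[of r] by (auto simp: That_def)
  have sub: "hat.subspace (That :: (nat \<Rightarrow> 'n agen tensor) set)"
    unfolding hat.subspace_def That_def
    by (auto simp: tensor_deg_def hscale_def palg.span_zero palg.span_add palg.span_scale)
  show ?thesis
    unfolding is_module_def
  proof (intro conjI ballI allI sub)
    fix u w c and x y :: "nat \<Rightarrow> 'n agen tensor"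
    assume x: "x \<in> That"
    show "hat_act \<Delta> \<rho> u x \<in> That" 
      using x unfolding That_def hat_act_eq by (blast intro: pow_act_tensor_deg)
    show "hat_act \<Delta> \<rho> u (x + y) = hat_act \<Delta> \<rho> u x + hat_act \<Delta> \<rho> u y"
      by (simp add: hat_act_eq plin2 fun_eq_iff)
    show "hat_act \<Delta> \<rho> u (hscale c x) = hscale c (hat_act \<Delta> \<rho> u x)"
      by (simp add: hat_act_eq hscale_def plin2)
    show "hat_act \<Delta> \<rho> (u + w) x = hat_act \<Delta> \<rho> u x + hat_act \<Delta> \<rho> w x" by (rule hat_act_add_left)
    show "hat_act \<Delta> \<rho> (c \<cdot> u) x = hscale c (hat_act \<Delta> \<rho> u x)"
      by (simp add: hat_act_eq hscale_def plin2)
    show "hat_act \<Delta> \<rho> (u * w) x = hat_act \<Delta> \<rho> u (hat_act \<Delta> \<rho> w x)"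
      by (simp only: hat_act_eq pow_act_mult[OF power[OF x]])
    show "hat_act \<Delta> \<rho> 1 x = x" by (simp only: hat_act_eq pow_act_one[OF power[OF x]])
  qed
qed

lemma VV_subset: "VV \<subseteq> (That :: (nat \<Rightarrow> 'n agen tensor) set)"
proof -
  have "hat.subspace (That :: (nat \<Rightarrow> 'n agen tensor) set)"
    using That_module by (simp add: is_module_def)
  moreover have "(LV :: (nat \<Rightarrow> 'n agen tensor) set) \<subseteq> That"
  proof
    fix x :: "nat \<Rightarrow> 'n agen tensor" assume "x \<in> LV"
    then obtain A v where A: "x = Aj A v" "A \<in> smatrices' CARD('n)" unfolding LV_def by blast
    have "x r \<in> tensor_deg r" for r
      unfolding A(1) Aj_def tensor_deg_def
    proof (intro palg.span_sum palg.span_scale palg.span_base imageI CollectI conjI)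
      fix l assume l: "l \<in> {l \<in> nat_vectors CARD('n). entry_sum CARD('n) (add_diag A l) = r}"
      then show "add_diag A l \<in> smatrices CARD('n)" "entry_sum CARD('n) (add_diag A l) = r"
        using A(2) smatrices'_subset add_diag_smatrices by blast+
    qed
    then show "x \<in> That" by (simp add: That_def)
  qed
  ultimately show ?thesis unfolding VV_def by (intro hat.span_minimal)
qed

lemma VV_submodule: "is_submodule hscale (hat_act \<Delta> \<rho>) That (VV :: (nat \<Rightarrow> 'n agen tensor) set)"
  unfolding is_submodule_def using That_module VV_subset hat_act_VV by (auto simp: VV_def)

lemma VV_supermodule: "is_supermodule hscale (hat_act \<Delta> \<rho>) (VV :: (nat \<Rightarrow> 'n agen tensor) set) VV_part"
proof -
  have "is_module hscale (hat_act \<Delta> \<rho>) (VV :: (nat \<Rightarrow> 'n agen tensor) set)"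
    using hat_act_VV by (intro is_module_subspace[OF That_module _ VV_subset]) (simp_all add: VV_def)
  then show ?thesis unfolding is_supermodule_def using VV_superspace hat_act_VV_part by blast
qed

end

text \<open>Being a basis is stated as injectivity of the parametrisation together with independence
  and spanning of \<open>LV\<close>, because the set by itself does not record whether different
  pairs give the same vector.\<close>

theorem theorem8p2:
  fixes \<Delta> :: "'n U \<Rightarrow> 'n ugen tensor"
    and \<rho> :: "'n U \<Rightarrow> 'n A \<Rightarrow> 'n A"
  assumes "CARD('n) \<ge> 2"
    and "is_comultiplication \<Delta>"
    and "is_natural_action \<rho>"
  shows "is_submodule hscale (hat_act \<Delta> \<rho>) That (VV :: (nat \<Rightarrow> 'n agen tensor) set) \<and>
    inj_on (\<lambda>(A, j). Aj A j :: nat \<Rightarrow> 'n agen tensor)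
      (smatrices' CARD('n) \<times> int_vectors CARD('n)) \<and>
    hat.independent (LV :: (nat \<Rightarrow> 'n agen tensor) set) \<and>
    hat.span (LV :: (nat \<Rightarrow> 'n agen tensor) set) = VV \<and>
    is_supermodule hscale (hat_act \<Delta> \<rho>) (VV :: (nat \<Rightarrow> 'n agen tensor) set) VV_part"
proof -
  interpret natural_action \<rho> using assms(1,3) by unfold_locales
  note comult = assms(2)[unfolded is_comultiplication_def]
  have "super_comodule_action_axioms \<Delta>"
  proof (rule super_comodule_action_axioms.intro)
    show "plin \<Delta>" "\<Delta> 1 = tens [1, 1]" using comult by blast+
    show "\<Delta> (u * w) = \<Delta> u \<star> \<Delta> w" for u w using comult by blast
    show "\<Delta> u \<in> tensor_power 2" for u using comult by blast
    show "\<Delta> u \<in> tensor2_homogeneous p" if "u \<in> homogeneous p" for u p using comult that by blast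
  qed
  then interpret natural_comodule \<rho> \<Delta>
    by (intro natural_comodule.intro super_comodule_action.intro natural_action_axioms super_action_axioms)
  show ?thesis
    using VV_submodule Aj_inj LV_independent VV_supermodule by (simp add: VV_def)
qed

end
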